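(* Suppose that $$0<g\neq\frac{3}{\ell^3}\quad\text{and}\quad\lim_{\xi\to0}(\mu(\xi)-g)=0 .$$ Then for $\xi$ sufficiently small, there is a solution $(u,h)$ on $\Sigma=\mathbb{R}^{N-1}$ to the system $$\begin{cases}\partial_tu+\nabla p=\Delta u&\text{in }\Omega\\ \operatorname{div}u=0&\text{in }\Omega\\ \partial_th=u_N&\text{on }\{y=\ell\}\\ (pI-\mathbb{D}u)e_N=M(h)e_N&\text{on }\{y=\ell\}\\ u=0&\text{on }\{y=0\}\end{cases}$$ such that $$\mathcal{E}_\xi(t)\ge b_1e^{-b_2|\xi|^2t}\,\mathcal{E}_\xi(0)$$ for constants $b_1,b_2>0$ independent of $\xi$.
   Context: Fix an integer $N\ge 2$, $\ell>0$ and a constant $g$. Here $\Sigma=\mathbb{R}^{N-1}$, with dual group $\hat\Sigma=\mathbb{R}^{N-1}$. Set $\Omega=\Sigma\times(0,\ell)$, with points $(x,y)$, $x\in\Sigma$, $y\in(0,\ell)$. The unknowns are the velocity $u(\cdot,t):\Omega\to\mathbb{R}^N$, the pressure $p(\cdot,t):\Omega\to\mathbb{R}$, and the free surface function $h(\cdot,t):\Sigma\to\mathbb{R}$, for times $t\ge0$. Here $u_N$ is the last (vertical) component of $u$, $e_N=(0,\dots,0,1)$, $I$ is the $N\times N$ identity matrix and $(\mathbb{D}u)_{ij}=\partial_iu_j+\partial_ju_i$. The Fourier transform is always in the horizontal variable $x$ only: $\hat f(\xi)=\mathcal{F}f(\xi)=\int_\Sigma f(x)e^{-2\pi i\xi\cdot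 x}\,dx$, $\xi\in\hat\Sigma$. Boundary operator: $\mu:\hat\Sigma\to\mathbb{R}$ satisfies, for some $\theta>0$, $\theta\le\mu(\xi)\le\frac1\theta(1+|\xi|)^3$ for all $\xi\in\hat\Sigma$, and $M$ is defined by $\mathcal{F}M(h)(\xi)=\mu(\xi)\mathcal{F}h(\xi)$. Energy at frequency $\xi$: $$\mathcal{E}_\xi(t)=\frac12\int_0^\ell|\hat u(\xi,y,t)|^2\,dy+\frac{\mu(\xi)}2|\hat h(\xi,t)|^2 .$$ *)

theory Defs
  imports "HOL-Analysis.Analysis"
begin

text \<open>
  The horizontal space is \<open>\<Sigma> = real ^ 'm\<close> with \<open>N = CARD('m) + 1\<close>. The \<open>N\<close> coordinate directions of
  \<open>\<Sigma> \<times> \<real>\<close> are indexed by \<^typ>\<open>'m option\<close>: \<open>Some j\<close> is horizontal and \<open>None\<close> is the vertical one.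

  Fields are complex valued, because \<open>M\<close> maps real functions to real functions only if its symbol
  is even; \<open>real_fields\<close> singles out the real ones.
\<close>

type_synonym 'm point = "(real ^ 'm) \<times> real"

definition slab :: "real \<Rightarrow> ('m::finite) point set"
  where "slab l = UNIV \<times> {0..l}"

definition open_slab :: "real \<Rightarrow> ('m::finite) point set"
  where "open_slab l = UNIV \<times> {0<..<l}"

fun edir :: "('m::finite) option \<Rightarrow> 'm point"
  where
    "edir (Some j) = (axis j 1, 0)"
  | "edir None = (0, 1)"


subsection \<open>Derivatives, one-sided at the boundary and at the initial time\<close>

definition line_in :: "real \<Rightarrow> ('m::finite) option \<Rightarrow> 'm point \<Rightarrow> real set"
  where "line_in l i z = {s. z + s *\<^sub>R edir i \<in> slab l}"

definition pd :: "real \<Rightarrow> ('m::finite) option \<Rightarrow> ('m point \<Rightarrow> complex) \<Rightarrow> 'm point \<Rightarrow> complex"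
  where "pd l i f z = vector_derivative (\<lambda>s. f (z + s *\<^sub>R edir i)) (at 0 within line_in l i z)"

definition has_pd :: "real \<Rightarrow> ('m::finite) option \<Rightarrow> ('m point \<Rightarrow> complex) \<Rightarrow> 'm point \<Rightarrow> bool"
  where "has_pd l i f z \<longleftrightarrow> (\<lambda>s. f (z + s *\<^sub>R edir i)) differentiable (at 0 within line_in l i z)"

definition dt :: "(real \<Rightarrow> complex) \<Rightarrow> real \<Rightarrow> complex"
  where "dt f t = vector_derivative f (at t within {0..})"

definition laplacian :: "real \<Rightarrow> (('m::finite) point \<Rightarrow> complex) \<Rightarrow> 'm point \<Rightarrow> complex"
  where "laplacian l f z = (\<Sum>i\<in>UNIV. pd l i (pd l i f) z)"

definition divergence :: "real \<Rightarrow> (('m::finite) point \<Rightarrow> complex ^ 'm option) \<Rightarrow> 'm point \<Rightarrow> complex"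
  where "divergence l v z = (\<Sum>i\<in>UNIV. pd l i (\<lambda>w. v w $ i) z)"

definition sym_grad ::
    "real \<Rightarrow> (('m::finite) point \<Rightarrow> complex ^ 'm option) \<Rightarrow> 'm point \<Rightarrow> complex ^ 'm option ^ 'm option"
  where "sym_grad l v z = (\<chi> i j. pd l i (\<lambda>w. v w $ j) z + pd l j (\<lambda>w. v w $ i) z)"


subsection \<open>Regularity of classical solutions\<close>

definition cont_field :: "real \<Rightarrow> (real \<Rightarrow> ('m::finite) point \<Rightarrow> complex) \<Rightarrow> bool"
  where "cont_field l f \<longleftrightarrow> continuous_on ({0..} \<times> slab l) (\<lambda>(t, z). f t z)"

definition space_C1 :: "real \<Rightarrow> (real \<Rightarrow> ('m::finite) point \<Rightarrow> complex) \<Rightarrow> bool"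
  where "space_C1 l f \<longleftrightarrow> cont_field l f \<and>
    (\<forall>i. (\<forall>t\<ge>0. \<forall>z\<in>slab l. has_pd l i (f t) z) \<and> cont_field l (\<lambda>t. pd l i (f t)))"

definition space_C2 :: "real \<Rightarrow> (real \<Rightarrow> ('m::finite) point \<Rightarrow> complex) \<Rightarrow> bool"
  where "space_C2 l f \<longleftrightarrow> space_C1 l f \<and> (\<forall>i. space_C1 l (\<lambda>t. pd l i (f t)))"

definition time_C1 :: "real \<Rightarrow> (real \<Rightarrow> ('m::finite) point \<Rightarrow> complex) \<Rightarrow> bool"
  where "time_C1 l f \<longleftrightarrow> cont_field l f \<and>
    (\<forall>z\<in>slab l. \<forall>t\<ge>0. (\<lambda>s. f s z) differentiable (at t within {0..})) \<and>
    cont_field l (\<lambda>t z. dt (\<lambda>s. f s z) t)"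

definition surface_C1 :: "(real \<Rightarrow> real ^ ('m::finite) \<Rightarrow> complex) \<Rightarrow> bool"
  where "surface_C1 h \<longleftrightarrow> continuous_on ({0..} \<times> UNIV) (\<lambda>(t, x). h t x) \<and>
    (\<forall>x. \<forall>t\<ge>0. (\<lambda>s. h s x) differentiable (at t within {0..})) \<and>
    continuous_on ({0..} \<times> UNIV) (\<lambda>(t, x). dt (\<lambda>s. h s x) t)"


subsection \<open>The Fourier transform in the horizontal variable\<close>

definition square_integrable :: "(real ^ ('m::finite) \<Rightarrow> complex) \<Rightarrow> bool"
  where "square_integrable f \<longleftrightarrow> f \<in> borel_measurable lebesgue \<and>
    integrable lebesgue (\<lambda>x. (norm (f x))\<^sup>2)"

definition fourier_integral :: "(real ^ ('m::finite) \<Rightarrow> complex) \<Rightarrow> real ^ 'm \<Rightarrow> complex"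
  where "fourier_integral f \<xi> =
    (LINT x|lebesgue. f x * exp (- 2 * of_real pi * \<i> * of_real (\<xi> \<bullet> x)))"

text \<open>
  The symbol \<open>\<mu>\<close> need not be continuous, so solutions are in general not integrable in the
  horizontal variable, and the Fourier transform has to be the one of \<open>L\<^sup>2\<close>:
  \<open>F\<close> is a Fourier transform of \<open>f\<close> if it is the \<open>L\<^sup>2\<close> limit, as \<open>R \<longrightarrow> \<infinity>\<close>, of the Fourier integrals
  of \<open>f\<close> restricted to \<open>cball 0 R\<close>. This determines \<open>F\<close> up to a null set.
\<close>

definition is_fourier :: "(real ^ ('m::finite) \<Rightarrow> complex) \<Rightarrow> (real ^ 'm \<Rightarrow> complex) \<Rightarrow> bool"
  where "is_fourier f F \<longleftrightarrow> square_integrable f \<and> square_integrable F \<and>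
    ((\<lambda>R. \<integral>\<^sup>+ \<xi>. ennreal ((norm (F \<xi> -
        fourier_integral (\<lambda>x. if x \<in> cball 0 R then f x else 0) \<xi>))\<^sup>2) \<partial>lebesgue) \<longlongrightarrow> 0) at_top"

text \<open>\<open>is_multiplier \<mu> f k\<close> says that \<open>k = M(f)\<close>.\<close>

definition is_multiplier ::
    "(real ^ ('m::finite) \<Rightarrow> real) \<Rightarrow> (real ^ 'm \<Rightarrow> complex) \<Rightarrow> (real ^ 'm \<Rightarrow> complex) \<Rightarrow> bool"
  where "is_multiplier \<mu> f k \<longleftrightarrow>
    (\<exists>F. is_fourier f F \<and> is_fourier k (\<lambda>\<xi>. of_real (\<mu> \<xi>) * F \<xi>))"


subsection \<open>The linear free boundary problem\<close>

definition solution ::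
    "real \<Rightarrow> (real ^ ('m::finite) \<Rightarrow> real) \<Rightarrow> (real \<Rightarrow> 'm point \<Rightarrow> complex ^ 'm option) \<Rightarrow>
     (real \<Rightarrow> 'm point \<Rightarrow> complex) \<Rightarrow> (real \<Rightarrow> real ^ 'm \<Rightarrow> complex) \<Rightarrow> bool"
  where "solution l \<mu> u p h \<longleftrightarrow>
    (\<forall>i. space_C2 l (\<lambda>t z. u t z $ i) \<and> time_C1 l (\<lambda>t z. u t z $ i)) \<and>
    space_C1 l p \<and> surface_C1 h \<and>
    (\<forall>t\<ge>0.
      (\<forall>z\<in>open_slab l. \<forall>i.
        dt (\<lambda>s. u s z $ i) t + pd l i (p t) z = laplacian l (\<lambda>w. u t w $ i) z) \<and>
      (\<forall>z\<in>open_slab l. divergence l (u t) z = 0) \<and>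
      (\<forall>x. dt (\<lambda>s. h s x) t = u t (x, l) $ None) \<and>
      (\<exists>k. is_multiplier \<mu> (h t) k \<and>
        (\<forall>x. (mat (p t (x, l)) - sym_grad l (u t) (x, l)) *v axis None 1 = k x *s axis None 1)) \<and>
      (\<forall>x. u t (x, 0) = 0))"

definition real_fields ::
    "real \<Rightarrow> (real \<Rightarrow> ('m::finite) point \<Rightarrow> complex ^ 'm option) \<Rightarrow>
     (real \<Rightarrow> 'm point \<Rightarrow> complex) \<Rightarrow> (real \<Rightarrow> real ^ 'm \<Rightarrow> complex) \<Rightarrow> bool"
  where "real_fields l u p h \<longleftrightarrow>
    (\<forall>t\<ge>0. (\<forall>z\<in>slab l. (\<forall>i. u t z $ i \<in> \<real>) \<and> p t z \<in> \<real>) \<and> (\<forall>x. h t x \<in> \<real>))"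

text \<open>
  The continuity requirement makes the values \<open>U \<xi> y t\<close> and \<open>H \<xi> t\<close> for all \<open>y\<close> and \<open>t\<close> unique
  outside a single null set of frequencies \<open>\<xi>\<close>, so that the energy at frequency \<open>\<xi>\<close> is meaningful
  although every single Fourier transform is only determined almost everywhere.
\<close>

definition horizontal_fourier ::
    "real \<Rightarrow> (real \<Rightarrow> ('m::finite) point \<Rightarrow> complex ^ 'm option) \<Rightarrow> (real \<Rightarrow> real ^ 'm \<Rightarrow> complex) \<Rightarrow>
     (real ^ 'm \<Rightarrow> real \<Rightarrow> real \<Rightarrow> complex ^ 'm option) \<Rightarrow> (real ^ 'm \<Rightarrow> real \<Rightarrow> complex) \<Rightarrow> bool"
  where "horizontal_fourier l u h U H \<longleftrightarrow>
    (\<forall>t\<ge>0. (\<forall>y\<in>{0..l}. \<forall>i. is_fourier (\<lambda>x. u t (x, y) $ i) (\<lambda>\<xi>. U \<xi> y t $ i)) \<and>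
      is_fourier (h t) (\<lambda>\<xi>. H \<xi> t)) \<and>
    (\<forall>\<xi>. continuous_on ({0..l} \<times> {0..}) (\<lambda>(y, t). U \<xi> y t) \<and> continuous_on {0..} (H \<xi>))"

definition energy ::
    "real \<Rightarrow> (real ^ ('m::finite) \<Rightarrow> real) \<Rightarrow> (real ^ 'm \<Rightarrow> real \<Rightarrow> real \<Rightarrow> complex ^ 'm option) \<Rightarrow>
     (real ^ 'm \<Rightarrow> real \<Rightarrow> complex) \<Rightarrow> real ^ 'm \<Rightarrow> real \<Rightarrow> real"
  where "energy l \<mu> U H \<xi> t =
    1 / 2 * integral {0..l} (\<lambda>y. (norm (U \<xi> y t))\<^sup>2) + \<mu> \<xi> / 2 * (norm (H \<xi> t))\<^sup>2"

end

theory Submission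
  imports Defs "HOL-Probability.Characteristic_Functions"
begin

text \<open>
  For each small frequency \<open>\<xi>\<close> there is a normal mode decaying like \<open>exp (\<lambda> t)\<close> with \<open>\<lambda> = - \<sigma> k\<^sup>2\<close>,
  \<open>k = 2 \<pi> \<bar>\<xi>\<bar>\<close>. With \<open>m\<^sup>2 = k\<^sup>2 + \<lambda>\<close> its horizontal velocity, vertical velocity, pressure and
  surface are \<open>2 \<pi> i \<xi> w'\<close>, \<open>k\<^sup>2 w\<close>, \<open>w''' - m\<^sup>2 w'\<close> and \<open>- w(l) / \<sigma>\<close>, where
  \<open>(D\<^sup>2 - k\<^sup>2) (D\<^sup>2 - m\<^sup>2) w = 0\<close>. Three of the boundary conditions determine \<open>w\<close> up to a factor; the
  normal stress balance is then an equation for \<open>\<sigma>\<close> that tends to \<open>- \<sigma> + \<mu> l\<^sup>3 / 3 = 0\<close> as \<open>k \<rightarrow> 0\<close>, so it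
  has a root near \<open>g l\<^sup>3 / 3\<close>, which can be chosen measurably in \<open>\<xi>\<close>. The hypothesis on \<open>g\<close> keeps \<open>\<sigma>\<close>
  away from \<open>1\<close>, where \<open>m = 0\<close> and the exponentials \<open>exp (\<plusminus> k y)\<close>, \<open>exp (\<plusminus> m y)\<close> no longer span the
  solutions. Superposing the modes over a small ball of frequencies gives the solution. As \<open>\<mu>\<close> is merely
  measurable, its Fourier transform has to be identified by Plancherel's theorem, which follows by
  regularising with Gaussians.
\<close>

section \<open>Plancherel's theorem\<close>

text \<open>The value g l^3 / 3 is that of lubrication theory. As k tends to 0, the profile
  normalised by \<open>wcoeff1\<close> and \<open>wcoeff2\<close> tends to the cubic l y^2 / 2 - y^3
  / 6, which vanishes to first order at the bottom, has w''(l) = 0 and w''' = -1, and ends at w(l) =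
  l^3 / 3. The hypothesis on g says that this limiting root is not 1, so some compact interval
  \<open>{p..q}\<close> around it avoids 1. Confining \<sigma> to this interval makes all bounds
  uniform in the frequency. Every mode is an exact exponential, so its energy is multiplied by exp
  (- 2 \<sigma> k^2 t); this is the origin of the constants 1 and \<open>8 * pi\<^sup>2 * q\<close>
  in the final bound. The root m is real for \<sigma> < 1 and imaginary for \<sigma> > 1. The
  profiles are even in m, hence real in both cases. Since \<mu> may jump, \<sigma> cannot be
  expected to be continuous in \<xi>; in place of an implicit function argument, a change of sign
  between p and q yields a root, and taking the smallest point of nonnegativity makes it
  measurable.\<close>

lemma lborel_integral_affine:
  fixes f :: "'a::euclidean_space \<Rightarrow> 'b::{banach, second_countable_topology}"
  assumes "c \<noteq> 0" and [measurable]: "f \<in> borel_measurable borel"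
  shows "(LINT x|lborel. f x) = (\<bar>c\<bar> ^ DIM('a)) *\<^sub>R (LINT x|lborel. f (t + c *\<^sub>R x))"
  by (subst lborel_affine[OF assms(1), of t])
     (simp add: integral_density integral_distr)

lemma lborel_integrable_affine:
  fixes f :: "'a::euclidean_space \<Rightarrow> 'b::{banach, second_countable_topology}"
  assumes "c \<noteq> 0" and f: "integrable lborel f"
  shows "integrable lborel (\<lambda>x. f (t + c *\<^sub>R x))"
proof -
  have [measurable]: "f \<in> borel_measurable borel" using f by auto
  have "integrable (density (distr lborel borel (\<lambda>x. t + c *\<^sub>R x)) (\<lambda>_. ennreal (\<bar>c\<bar> ^ DIM('a)))) f"
    using f by (subst (asm) lborel_affine[OF assms(1), of t]) (simp add: ennreal_power)
  then have "integrable lborel (\<lambda>x. (\<bar>c\<bar> ^ DIM('a)) *\<^sub>R f (t + c *\<^sub>R x))"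
    by (subst (asm) integrable_density) (auto simp: integrable_distr_eq)
  then have "integrable lborel (\<lambda>x. (1 / \<bar>c\<bar> ^ DIM('a)) *\<^sub>R (\<bar>c\<bar> ^ DIM('a)) *\<^sub>R f (t + c *\<^sub>R x))"
    by (rule integrable_scaleR_right)
  then show ?thesis
    using assms(1) by simp
qed

text \<open>\<open>lborel\<close> is the image of a product of one-dimensional Lebesgue measures
  under the coordinate map. This reduces Gaussian integrals to the real line.\<close>

lemma
  fixes f :: "'a::euclidean_space \<Rightarrow> real \<Rightarrow> complex"
  assumes int: "\<And>b. b \<in> Basis \<Longrightarrow> integrable lborel (f b)"
  shows lborel_integral_prod_Basis:
      "(LINT x|lborel. (\<Prod>b\<in>Basis. f b (x \<bullet> b))) = (\<Prod>b\<in>Basis. (LINT x|lborel. f b x))"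
    and lborel_integrable_prod_Basis:
      "integrable lborel (\<lambda>x. (\<Prod>b\<in>Basis. f b (x \<bullet> b)))"
proof -
  interpret product_sigma_finite "\<lambda>_::'a. lborel::real measure"
    by unfold_locales
  have [measurable]: "f b \<in> borel_measurable borel" if "b \<in> Basis" for b
    using int[OF that] by auto
  have coord: "(\<Sum>b\<in>Basis. g b *\<^sub>R b) \<bullet> b = g b" if "b \<in> Basis" for g and b :: 'a
    using that by simp
  show "(LINT x|lborel. (\<Prod>b\<in>Basis. f b (x \<bullet> b))) = (\<Prod>b\<in>Basis. (LINT x|lborel. f b x))"
    by (subst lborel_eq) (simp add: integral_distr coord product_integral_prod int cong: prod.cong)
  show "integrable lborel (\<lambda>x. (\<Prod>b\<in>Basis. f b (x \<bullet> b)))"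
    by (subst lborel_eq) (simp add: integrable_distr_eq coord product_integrable_prod int cong: prod.cong)
qed

section \<open>Gaussian integrals\<close>

definition gauss :: "'a::euclidean_space \<Rightarrow> real"
  where "gauss x = exp (- (norm x)\<^sup>2 / 2)"

lemma gauss_measurable [measurable]: "gauss \<in> borel_measurable borel"
  unfolding gauss_def by measurable

lemma gauss_pos: "gauss x > 0" and gauss_le_1: "gauss x \<le> 1" and gauss_minus [simp]: "gauss (- x) = gauss x"
  by (auto simp: gauss_def)

lemma gauss_prod: "gauss x = (\<Prod>b\<in>Basis. exp (- (x \<bullet> b)\<^sup>2 / 2))"
proof -
  have "(norm x)\<^sup>2 = (\<Sum>b\<in>Basis. (x \<bullet> b)\<^sup>2)"
    by (subst power2_norm_eq_inner, subst euclidean_inner) (simp add: power2_eq_square)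
  then show ?thesis
    by (simp add: gauss_def exp_sum[symmetric] sum_negf sum_divide_distrib)
qed

lemma real_gauss_eq: "exp (- x\<^sup>2 / 2) = sqrt (2 * pi) * std_normal_density x" for x :: real
  by (simp add: std_normal_density_def)

text \<open>This is the characteristic function of the standard normal distribution with the
  normalising constant moved to the other side.\<close>

lemma
  shows real_gauss_cis: "(LINT x|lborel. of_real (exp (- x\<^sup>2 / 2)) * cis (t * x)) =
      of_real (sqrt (2 * pi) * exp (- t\<^sup>2 / 2))"
    and integrable_real_gauss_cis: "integrable lborel (\<lambda>x. of_real (exp (- x\<^sup>2 / 2)) * cis (t * x))"
proof -
  have "(LINT x|lborel. std_normal_density x *\<^sub>R cis (t * x)) = of_real (exp (- t\<^sup>2 / 2))"
    using fun_cong[OF char_std_normal_distribution, of t]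
    by (simp add: char_def integral_density cis_conv_exp normal_density_nonneg)
  then show "(LINT x|lborel. of_real (exp (- x\<^sup>2 / 2)) * cis (t * x)) =
      of_real (sqrt (2 * pi) * exp (- t\<^sup>2 / 2))"
    unfolding real_gauss_eq by (simp add: scaleR_conv_of_real mult.assoc)
  have "integrable lborel std_normal_density"
    by (rule integrable_normal_density) simp
  then have "integrable lborel (\<lambda>x::real. exp (- x\<^sup>2 / 2))"
    unfolding real_gauss_eq by auto
  then show "integrable lborel (\<lambda>x. of_real (exp (- x\<^sup>2 / 2)) * cis (t * x))"
    by (rule Bochner_Integration.integrable_bound) (auto simp: norm_mult cis_conv_exp)
qed

lemma
  fixes t :: "'a::euclidean_space"
  shows gauss_cis: "(LINT x|lborel. of_real (gauss x) * cis (t \<bullet> x)) =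
      of_real (sqrt (2 * pi) ^ DIM('a) * gauss t)"
    and integrable_gauss_cis: "integrable lborel (\<lambda>x. of_real (gauss x) * cis (t \<bullet> x))"
proof -
  have eq: "of_real (gauss x) * cis (t \<bullet> x) =
      (\<Prod>b\<in>Basis. of_real (exp (- (x \<bullet> b)\<^sup>2 / 2)) * cis ((t \<bullet> b) * (x \<bullet> b)))" for x
    by (subst euclidean_inner) (simp add: gauss_prod prod.distrib cis_conv_exp sum_distrib_left exp_sum)
  show "integrable lborel (\<lambda>x. of_real (gauss x) * cis (t \<bullet> x))"
    unfolding eq by (rule lborel_integrable_prod_Basis[OF integrable_real_gauss_cis])
  have "(LINT x|lborel. of_real (gauss x) * cis (t \<bullet> x)) =
      (\<Prod>b\<in>(Basis::'a set). of_real (sqrt (2 * pi) * exp (- (t \<bullet> b)\<^sup>2 / 2)))"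
    unfolding eq
    by (subst lborel_integral_prod_Basis[OF integrable_real_gauss_cis], unfold real_gauss_cis) (rule refl)
  then show "(LINT x|lborel. of_real (gauss x) * cis (t \<bullet> x)) =
      of_real (sqrt (2 * pi) ^ DIM('a) * gauss t)"
    by (simp add: prod.distrib gauss_prod)
qed

lemma gauss_integrable: "integrable lborel (gauss :: 'a::euclidean_space \<Rightarrow> real)"
  using integrable_norm[OF integrable_gauss_cis[of 0]]
  by (simp add: abs_of_nonneg[OF less_imp_le[OF gauss_pos]])

lemma gauss_integral: "(LINT x|lborel. gauss (x::'a::euclidean_space)) = sqrt (2 * pi) ^ DIM('a)"
proof -
  have "complex_of_real (LINT x|lborel. gauss (x::'a)) = of_real (sqrt (2 * pi) ^ DIM('a))"
    using gauss_cis[of "0::'a"] by (simp add: gauss_def)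
  then show ?thesis
    using of_real_eq_iff by blast
qed

text \<open>The Fourier transform of \<open>gauss\<close> in the convention with 2 pi in the
  exponent. Its integral is 1, so its rescalings form an approximate identity.\<close>

definition gauss_kernel :: "'a::euclidean_space \<Rightarrow> real"
  where "gauss_kernel z = sqrt (2 * pi) ^ DIM('a) * gauss ((2 * pi) *\<^sub>R z)"

lemma gauss_kernel_measurable [measurable]: "gauss_kernel \<in> borel_measurable borel"
  unfolding gauss_kernel_def by measurable

lemma gauss_kernel_nonneg [simp]: "gauss_kernel z \<ge> 0"
  using gauss_pos[of "(2 * pi) *\<^sub>R z"] by (simp add: gauss_kernel_def)

lemma gauss_kernel_integrable: "integrable lborel (gauss_kernel :: 'a::euclidean_space \<Rightarrow> real)"
  unfolding gauss_kernel_def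
  using lborel_integrable_affine[OF _ gauss_integrable, of "2 * pi" 0] by simp

text \<open>The factor \<open>sqrt (2 * pi) ^ DIM('a)\<close> of the kernel and the equal factor
  from \<open>gauss_integral\<close> multiply to the Jacobian of the dilation by
  \<open>2 * pi\<close>.\<close>

lemma gauss_kernel_integral: "(LINT z|lborel. gauss_kernel (z::'a::euclidean_space)) = 1"
proof -
  have "sqrt (2 * pi) ^ DIM('a) = (2 * pi) ^ DIM('a) * (LINT x|lborel. gauss ((2 * pi) *\<^sub>R (x::'a)))"
    using lborel_integral_affine[of "2 * pi" gauss "0::'a"] gauss_integral[where 'a='a] by simp
  moreover have "sqrt (2 * pi) ^ DIM('a) * sqrt (2 * pi) ^ DIM('a) = (2 * pi) ^ DIM('a)"
    by (subst power_mult_distrib[symmetric]) simp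
  ultimately have "sqrt (2 * pi) ^ DIM('a) * 1 = sqrt (2 * pi) ^ DIM('a) *
      (sqrt (2 * pi) ^ DIM('a) * (LINT x|lborel. gauss ((2 * pi) *\<^sub>R (x::'a))))"
    by (metis mult.assoc mult.right_neutral)
  then have "1 = sqrt (2 * pi) ^ DIM('a) * (LINT x|lborel. gauss ((2 * pi) *\<^sub>R (x::'a)))"
    by (subst (asm) mult_cancel_left) simp
  then show ?thesis
    unfolding gauss_kernel_def by simp
qed

lemma gauss_kernel_cis:
  "(LINT x|lborel. of_real (gauss x) * cis (2 * pi * (z \<bullet> x))) = of_real (gauss_kernel z)"
  using gauss_cis[of "(2 * pi) *\<^sub>R z"] by (simp add: gauss_kernel_def)

section \<open>The inverse Fourier transform of bounded functions with bounded support\<close>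

lemma integrable_lborel_pair_bound:
  fixes k :: "'a::euclidean_space \<Rightarrow> 'b::euclidean_space \<Rightarrow> complex"
  assumes a: "integrable lborel a" and b: "integrable lborel b"
    and [measurable]: "(\<lambda>(x, y). k x y) \<in> borel_measurable (lborel \<Otimes>\<^sub>M lborel)"
    and le: "\<And>x y. norm (k x y) \<le> a x * b y"
  shows "integrable (lborel \<Otimes>\<^sub>M lborel) (\<lambda>(x, y). k x y)"
proof (rule Bochner_Integration.integrable_bound)
  have [measurable]: "a \<in> borel_measurable borel" "b \<in> borel_measurable borel"
    using a b by auto
  have "integrable (lborel \<Otimes>\<^sub>M lborel) (\<lambda>z. a (fst z) * b (snd z))"
  proof (rule lborel_pair.Fubini_integrable)
    show "integrable lborel (\<lambda>x. LINT y|lborel. norm (a (fst (x, y)) * b (snd (x, y))))"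
      using a b by (simp add: norm_mult abs_mult)
    show "AE x in lborel. integrable lborel (\<lambda>y. a (fst (x, y)) * b (snd (x, y)))"
      using b by simp
  qed measurable
  then show "integrable (lborel \<Otimes>\<^sub>M lborel) (\<lambda>z. a (fst z) * b (snd z))" .
  show "AE z in lborel \<Otimes>\<^sub>M lborel. norm (case z of (x, y) \<Rightarrow> k x y) \<le> norm (a (fst z) * b (snd z))"
    using order_trans[OF le abs_ge_self] by (intro AE_I2) (auto simp: split_beta)
qed measurable

text \<open>On this class the transform is an absolutely convergent integral. Measurability is meant
  in the Borel sense, so that compositions with translations and dilations stay measurable;
  amplitudes that are only Lebesgue measurable are reduced to this case in
  \<open>is_fourier_synthesis\<close>.\<close>

definition bounded_support :: "('a::euclidean_space \<Rightarrow> complex) \<Rightarrow> bool"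
  where "bounded_support F \<longleftrightarrow> F \<in> borel_measurable borel \<and>
    (\<exists>B. \<forall>x. norm (F x) \<le> B) \<and> (\<exists>R. \<forall>x. norm x > R \<longrightarrow> F x = 0)"

definition inv_fourier :: "('a::euclidean_space \<Rightarrow> complex) \<Rightarrow> 'a \<Rightarrow> complex"
  where "inv_fourier F x = (LINT \<xi>|lborel. F \<xi> * cis (2 * pi * (\<xi> \<bullet> x)))"

lemma bounded_support_measurable: "bounded_support F \<Longrightarrow> F \<in> borel_measurable borel"
  by (simp add: bounded_support_def)

lemma bounded_support_bound:
  assumes "bounded_support F"
  obtains B where "B \<ge> 0" "\<And>x. norm (F x) \<le> B"
  using assms unfolding bounded_support_def by (meson norm_ge_zero order_trans)

lemma integrable_bounded_cball:
  fixes F :: "'a::euclidean_space \<Rightarrow> 'b::{banach, second_countable_topology}"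
  assumes "F \<in> borel_measurable borel" "\<And>x. norm (F x) \<le> B" "\<And>x. norm x > R \<Longrightarrow> F x = 0"
  shows "integrable lborel F"
proof (rule integrableI_bounded_set)
  show "emeasure lborel (cball (0::'a) R) < \<infinity>"
    using emeasure_bounded_finite[OF bounded_cball] .
  show "AE x\<in>cball 0 R in lborel. norm (F x) \<le> B"
    using assms by auto
  show "AE x in lborel. x \<notin> cball 0 R \<longrightarrow> F x = 0"
    using assms(3) by auto
qed (use assms in auto)

lemma bounded_support_integrable:
  assumes "bounded_support F"
  shows "integrable lborel F"
  using assms integrable_bounded_cball unfolding bounded_support_def by metis

lemma bounded_support_integrable_sq:
  assumes "bounded_support F"
  shows "integrable lborel (\<lambda>x. (norm (F x))\<^sup>2)"
proof -
  obtain B R where "\<And>x. norm (F x) \<le> B" "\<And>x. norm x > R \<Longrightarrow> F x = 0"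
    using assms unfolding bounded_support_def by metis
  then show ?thesis
    using bounded_support_measurable[OF assms]
    by (intro integrable_bounded_cball[where B = "B\<^sup>2" and R = R]) (auto intro!: power_mono)
qed

lemma cis_measurable [measurable]: "cis \<in> borel_measurable borel"
  by (intro borel_measurable_continuous_onI continuous_intros)

lemma inv_fourier_measurable [measurable]:
  assumes "bounded_support F"
  shows "inv_fourier F \<in> borel_measurable borel"
proof -
  have [measurable]: "F \<in> borel_measurable borel"
    using assms by (rule bounded_support_measurable)
  show ?thesis
    unfolding inv_fourier_def by measurable
qed

lemma norm_inv_fourier_le: "norm (inv_fourier F x) \<le> (LINT \<xi>|lborel. norm (F \<xi>))"
  unfolding inv_fourier_def
  by (rule order_trans[OF integral_norm_bound]) (simp add: norm_mult)

lemma borel_measurable_cnj [measurable (raw)]: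
  "f \<in> borel_measurable M \<Longrightarrow> (\<lambda>x. cnj (f x)) \<in> borel_measurable M"
  by (rule borel_measurable_continuous_on[of cnj]) (intro continuous_intros)

text \<open>Both factors of f times its conjugate are written as integrals over frequencies. The
  Gaussian weight makes the triple integral absolutely convergent, and carrying out the x-integral
  first produces the kernel at (\<xi> - \<eta>) / s.\<close>

lemma inv_fourier_gauss_identity:
  fixes F :: "'a::euclidean_space \<Rightarrow> complex"
  assumes F: "bounded_support F" and s: "s > 0"
  shows "of_real (LINT x|lborel. gauss (s *\<^sub>R x) * (norm (inv_fourier F x))\<^sup>2) =
    (LINT \<xi>|lborel. F \<xi> * (LINT z|lborel. of_real (gauss_kernel z) * cnj (F (\<xi> + s *\<^sub>R z))))"
proof -
  note [measurable] = bounded_support_measurable[OF F] inv_fourier_measurable[OF F]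
  define f where "f = inv_fourier F"
  have [measurable]: "f \<in> borel_measurable borel"
    unfolding f_def by measurable
  define M where "M = (LINT \<xi>|lborel. norm (F \<xi>))"
  have fM: "norm (f x) \<le> M" for x
    unfolding f_def M_def by (rule norm_inv_fourier_le)
  have gs: "integrable lborel (\<lambda>x::'a. gauss (s *\<^sub>R x))"
    using lborel_integrable_affine[OF _ gauss_integrable, of s 0] s by simp
  have Fi: "integrable lborel (\<lambda>\<xi>. norm (F \<xi>))"
    using bounded_support_integrable[OF F] by simp
  have 1: "of_real (gauss (s *\<^sub>R x) * (norm (f x))\<^sup>2) =
      (LINT \<xi>|lborel. F \<xi> * cis (2 * pi * (\<xi> \<bullet> x)) * (cnj (f x) * of_real (gauss (s *\<^sub>R x))))" for x
  proof -
    have "of_real (gauss (s *\<^sub>R x) * (norm (f x))\<^sup>2) = f x * (cnj (f x) * of_real (gauss (s *\<^sub>R x)))"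
      by (simp only: of_real_mult complex_norm_square mult_ac)
    then show ?thesis
      by (subst integral_mult_left_zero) (simp add: f_def inv_fourier_def)
  qed
  have inner: "(LINT x|lborel. F \<xi> * cis (2 * pi * (\<xi> \<bullet> x)) * (cnj (f x) * of_real (gauss (s *\<^sub>R x)))) =
      F \<xi> * (LINT z|lborel. of_real (gauss_kernel z) * cnj (F (\<xi> + s *\<^sub>R z)))" for \<xi>
  proof -
    have 2: "cis (2 * pi * (\<xi> \<bullet> x)) * (cnj (f x) * of_real (gauss (s *\<^sub>R x))) =
        (LINT \<eta>|lborel. cis (2 * pi * ((\<xi> - \<eta>) \<bullet> x)) * (cnj (F \<eta>) * of_real (gauss (s *\<^sub>R x))))" for x
    proof -
      have "cnj (f x) = (LINT \<eta>|lborel. cnj (F \<eta>) * cis (- (2 * pi * (\<eta> \<bullet> x))))"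
        unfolding f_def inv_fourier_def Bochner_Integration.integral_cnj[symmetric]
        by (simp add: cis_cnj del: Bochner_Integration.integral_cnj)
      then show ?thesis
        by (simp add: inner_diff_left right_diff_distrib cis_divide[symmetric] divide_inverse mult_ac
            flip: integral_mult_left_zero integral_mult_right_zero cis_inverse)
    qed
    have 3: "(LINT x|lborel. cis (2 * pi * ((\<xi> - \<eta>) \<bullet> x)) * (cnj (F \<eta>) * of_real (gauss (s *\<^sub>R x)))) =
        cnj (F \<eta>) * of_real (gauss_kernel ((1 / s) *\<^sub>R (\<xi> - \<eta>)) / s ^ DIM('a))" for \<eta>
    proof -
      have "of_real (gauss_kernel ((1 / s) *\<^sub>R (\<xi> - \<eta>))) =
          (LINT x|lborel. of_real (gauss x) * cis (2 * pi * (((1 / s) *\<^sub>R (\<xi> - \<eta>)) \<bullet> (x::'a))))"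
        by (rule gauss_kernel_cis[symmetric])
      also have "\<dots> = s ^ DIM('a) *\<^sub>R (LINT x|lborel. of_real (gauss (s *\<^sub>R (x::'a))) *
          cis (2 * pi * (((1 / s) *\<^sub>R (\<xi> - \<eta>)) \<bullet> (s *\<^sub>R x))))"
        using s by (subst lborel_integral_affine[of s _ 0]) auto
      also have "\<dots> = s ^ DIM('a) *\<^sub>R (LINT x|lborel. of_real (gauss (s *\<^sub>R (x::'a))) *
          cis (2 * pi * ((\<xi> - \<eta>) \<bullet> x)))"
        using s by simp
      finally have "of_real (gauss_kernel ((1 / s) *\<^sub>R (\<xi> - \<eta>)) / s ^ DIM('a)) =
          (LINT x|lborel. of_real (gauss (s *\<^sub>R (x::'a))) * cis (2 * pi * ((\<xi> - \<eta>) \<bullet> x)))"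
        using s by (simp add: scaleR_conv_of_real)
      then show ?thesis
        by (simp only: integral_mult_right_zero[symmetric] mult_ac)
    qed
    have "(LINT x|lborel. cis (2 * pi * (\<xi> \<bullet> x)) * (cnj (f x) * of_real (gauss (s *\<^sub>R x)))) =
        (LINT \<eta>|lborel. (LINT x|lborel. cis (2 * pi * ((\<xi> - \<eta>) \<bullet> x)) * (cnj (F \<eta>) * of_real (gauss (s *\<^sub>R x)))))"
      unfolding 2
    proof (rule lborel_pair.Fubini_integral)
      show "integrable (lborel \<Otimes>\<^sub>M lborel) (\<lambda>(\<eta>, x). cis (2 * pi * ((\<xi> - \<eta>) \<bullet> x)) * (cnj (F \<eta>) * of_real (gauss (s *\<^sub>R x))))"
        by (rule integrable_lborel_pair_bound[OF Fi gs])
           (measurable, simp add: norm_mult abs_of_nonneg[OF less_imp_le[OF gauss_pos]])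
    qed
    also have "\<dots> = (LINT \<eta>|lborel. cnj (F \<eta>) * of_real (gauss_kernel ((1 / s) *\<^sub>R (\<xi> - \<eta>)) / s ^ DIM('a)))"
      unfolding 3 ..
    \<comment> \<open>Substituting \<eta> = \<xi> + s z produces the Jacobian
      \<open>s ^ DIM('a)\<close>, which cancels the denominator; the kernel is even, so its argument
      - z may be read as z.\<close>
    also have "\<dots> = s ^ DIM('a) *\<^sub>R (LINT z|lborel. cnj (F (\<xi> + s *\<^sub>R z)) *
        of_real (gauss_kernel ((1 / s) *\<^sub>R (\<xi> - (\<xi> + s *\<^sub>R z))) / s ^ DIM('a)))"
      using s by (subst lborel_integral_affine[of s _ \<xi>]) auto
    also have "\<dots> = (LINT z|lborel. s ^ DIM('a) *\<^sub>R (cnj (F (\<xi> + s *\<^sub>R z)) *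
        of_real (gauss_kernel ((1 / s) *\<^sub>R (\<xi> - (\<xi> + s *\<^sub>R z))) / s ^ DIM('a))))"
      by (rule Bochner_Integration.integral_scaleR_right[symmetric])
    also have "\<dots> = (LINT z|lborel. of_real (gauss_kernel z) * cnj (F (\<xi> + s *\<^sub>R z)))"
      using s by (intro Bochner_Integration.integral_cong refl) (simp add: gauss_kernel_def scaleR_conv_of_real)
    finally show ?thesis
      by (simp add: mult.assoc)
  qed
  have "of_real (LINT x|lborel. gauss (s *\<^sub>R x) * (norm (f x))\<^sup>2) =
      (LINT x|lborel. (LINT \<xi>|lborel. F \<xi> * cis (2 * pi * (\<xi> \<bullet> x)) * (cnj (f x) * of_real (gauss (s *\<^sub>R x)))))"
    by (subst 1[symmetric]) (rule integral_complex_of_real[symmetric])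
  also have "\<dots> = (LINT \<xi>|lborel. (LINT x|lborel. F \<xi> * cis (2 * pi * (\<xi> \<bullet> x)) * (cnj (f x) * of_real (gauss (s *\<^sub>R x)))))"
  proof (rule lborel_pair.Fubini_integral)
    show "integrable (lborel \<Otimes>\<^sub>M lborel)
        (\<lambda>(\<xi>, x). F \<xi> * cis (2 * pi * (\<xi> \<bullet> x)) * (cnj (f x) * of_real (gauss (s *\<^sub>R x))))"
    proof (rule integrable_lborel_pair_bound[OF Fi integrable_mult_right[OF gs, of M]])
      show "norm (F \<xi> * cis (2 * pi * (\<xi> \<bullet> x)) * (cnj (f x) * of_real (gauss (s *\<^sub>R x))))
          \<le> norm (F \<xi>) * (M * gauss (s *\<^sub>R x))" for \<xi> x
        using fM[of x] gauss_pos[of "s *\<^sub>R x"]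
        by (simp add: norm_mult) (intro mult_left_mono mult_right_mono, auto)
    qed measurable
  qed
  finally show ?thesis
    unfolding inner by (simp only: f_def)
qed

definition autocorrelation :: "('a::euclidean_space \<Rightarrow> complex) \<Rightarrow> 'a \<Rightarrow> complex"
  where "autocorrelation F v = (LINT \<xi>|lborel. F \<xi> * cnj (F (\<xi> + v)))"

lemma autocorrelation_measurable [measurable]:
  assumes [measurable]: "F \<in> borel_measurable borel"
  shows "autocorrelation F \<in> borel_measurable borel"
  unfolding autocorrelation_def by measurable

text \<open>Pointwise 2 a b \<le> a^2 + b^2, and both squares have the same integral by translation
  invariance.\<close>

lemma norm_autocorrelation_le:
  assumes F: "bounded_support F"
  shows "norm (autocorrelation F v) \<le> (LINT \<xi>|lborel. (norm (F \<xi>))\<^sup>2)"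
proof -
  note [measurable] = bounded_support_measurable[OF F]
  note sq = bounded_support_integrable_sq[OF F]
  have shift: "integrable lborel (\<lambda>\<xi>. (norm (F (\<xi> + v)))\<^sup>2)"
    using lborel_integrable_affine[OF _ sq, of 1 v] by (simp add: add.commute)
  have "norm (autocorrelation F v) \<le> (LINT \<xi>|lborel. ((norm (F \<xi>))\<^sup>2 + (norm (F (\<xi> + v)))\<^sup>2) / 2)"
    unfolding autocorrelation_def
  proof (rule Bochner_Integration.integral_norm_bound_integral)
    show "norm (F \<xi> * cnj (F (\<xi> + v))) \<le> ((norm (F \<xi>))\<^sup>2 + (norm (F (\<xi> + v)))\<^sup>2) / 2" for \<xi>
      using sum_squares_bound[of "norm (F \<xi>)" "norm (F (\<xi> + v))"] by (simp add: norm_mult)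
    then show "integrable lborel (\<lambda>\<xi>. F \<xi> * cnj (F (\<xi> + v)))"
      using sq shift
      by (intro Bochner_Integration.integrable_bound[where g = "\<lambda>\<xi>. F \<xi> * cnj (F (\<xi> + v))" and
            f = "\<lambda>\<xi>. ((norm (F \<xi>))\<^sup>2 + (norm (F (\<xi> + v)))\<^sup>2) / 2"]) auto
  qed (use sq shift in auto)
  also have "\<dots> = (LINT \<xi>|lborel. (norm (F \<xi>))\<^sup>2)"
    using sq shift lborel_integral_affine[of 1 "\<lambda>\<xi>. (norm (F \<xi>))\<^sup>2" v] by (simp add: add.commute)
  finally show ?thesis .
qed

text \<open>Exchanging the two remaining integrals moves all dependence on s into the argument of
  the autocorrelation, where it can be estimated uniformly or sent to 0.\<close>

lemma inv_fourier_gauss_autocorrelation: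
  fixes F :: "'a::euclidean_space \<Rightarrow> complex"
  assumes F: "bounded_support F" and s: "s > 0"
  shows "of_real (LINT x|lborel. gauss (s *\<^sub>R x) * (norm (inv_fourier F x))\<^sup>2) =
    (LINT z|lborel. of_real (gauss_kernel z) * autocorrelation F (s *\<^sub>R z))"
proof -
  note [measurable] = bounded_support_measurable[OF F]
  obtain B where B: "B \<ge> 0" "\<And>x. norm (F x) \<le> B"
    using bounded_support_bound[OF F] by blast
  have "(LINT \<xi>|lborel. F \<xi> * (LINT z|lborel. of_real (gauss_kernel z) * cnj (F (\<xi> + s *\<^sub>R z)))) =
      (LINT \<xi>|lborel. (LINT z|lborel. F \<xi> * (of_real (gauss_kernel z) * cnj (F (\<xi> + s *\<^sub>R z)))))"
    by (simp flip: integral_mult_right_zero)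
  also have "\<dots> = (LINT z|lborel. (LINT \<xi>|lborel. F \<xi> * (of_real (gauss_kernel z) * cnj (F (\<xi> + s *\<^sub>R z)))))"
  proof (rule lborel_pair.Fubini_integral)
    show "integrable (lborel \<Otimes>\<^sub>M lborel)
        (\<lambda>(z, \<xi>). F \<xi> * (of_real (gauss_kernel z) * cnj (F (\<xi> + s *\<^sub>R z))))"
    proof (rule integrable_lborel_pair_bound[OF integrable_mult_right[OF gauss_kernel_integrable, of B]
          integrable_norm[OF bounded_support_integrable[OF F]]])
      show "norm (F \<xi> * (of_real (gauss_kernel z) * cnj (F (\<xi> + s *\<^sub>R z))))
          \<le> B * gauss_kernel z * norm (F \<xi>)" for z \<xi>
        using mult_mono[OF B(2)[of "\<xi> + s *\<^sub>R z"] order_refl[of "gauss_kernel z * norm (F \<xi>)"]] B(1)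
        by (simp add: norm_mult mult_ac)
    qed measurable
  qed
  finally show ?thesis
    unfolding inv_fourier_gauss_identity[OF F s] autocorrelation_def
    by (simp add: mult_ac flip: integral_mult_right_zero)
qed

text \<open>The kernel is a probability density, so averaging the autocorrelation against it keeps
  the bound, uniformly in s.\<close>

lemma inv_fourier_gauss_le:
  assumes F: "bounded_support F" and s: "s > 0"
  shows "(LINT x|lborel. gauss (s *\<^sub>R x) * (norm (inv_fourier F x))\<^sup>2) \<le> (LINT \<xi>|lborel. (norm (F \<xi>))\<^sup>2)"
proof -
  note [measurable] = bounded_support_measurable[OF F]
  define N where "N = (LINT \<xi>|lborel. (norm (F \<xi>))\<^sup>2)"
  have "norm (LINT z|lborel. of_real (gauss_kernel z) * autocorrelation F (s *\<^sub>R z)) \<le>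
      (LINT z|lborel. gauss_kernel (z::'a) * N)"
  proof (rule Bochner_Integration.integral_norm_bound_integral)
    show *: "norm (of_real (gauss_kernel z) * autocorrelation F (s *\<^sub>R z)) \<le> gauss_kernel z * N" for z
      using norm_autocorrelation_le[OF F, of "s *\<^sub>R z"] by (simp add: norm_mult N_def mult_left_mono)
    have "N \<ge> 0"
      unfolding N_def by simp
    then show "integrable lborel (\<lambda>z. of_real (gauss_kernel z) * autocorrelation F (s *\<^sub>R z))"
      using * by (intro Bochner_Integration.integrable_bound[OF integrable_mult_left[OF gauss_kernel_integrable, of N]])
         auto
  qed (use gauss_kernel_integrable in auto)
  then show ?thesis
    unfolding inv_fourier_gauss_autocorrelation[OF F s, symmetric]
    using gauss_kernel_integral[where 'a='a] by (simp add: N_def)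
qed

text \<open>The transform is bounded, so the Gaussian alone provides integrability; that the
  transform is square integrable is only derived afterwards.\<close>

lemma integrable_gauss_inv_fourier:
  fixes F :: "'a::euclidean_space \<Rightarrow> complex"
  assumes F: "bounded_support F" and s: "s > 0"
  shows "integrable lborel (\<lambda>x. gauss (s *\<^sub>R x) * (norm (inv_fourier F x))\<^sup>2)"
proof (rule Bochner_Integration.integrable_bound)
  note [measurable] = inv_fourier_measurable[OF F]
  define M where "M = (LINT \<xi>|lborel. norm (F \<xi>))"
  show "integrable lborel (\<lambda>x::'a. gauss (s *\<^sub>R x) * M\<^sup>2)"
    using lborel_integrable_affine[OF _ gauss_integrable, of s 0] s by (intro integrable_mult_left) simp
  show "AE x in lborel. norm (gauss (s *\<^sub>R x) * (norm (inv_fourier F x))\<^sup>2) \<le> norm (gauss (s *\<^sub>R x) * M\<^sup>2)"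
    using norm_inv_fourier_le[of F]
    by (intro AE_I2) (auto simp: abs_mult M_def intro!: mult_left_mono power_mono)
  show "(\<lambda>x. gauss (s *\<^sub>R x) * (norm (inv_fourier F x))\<^sup>2) \<in> borel_measurable lborel"
    by measurable
qed

lemma gauss_tendsto: "(\<lambda>n. gauss ((1 / real (Suc n)) *\<^sub>R x)) \<longlonglongrightarrow> 1"
proof -
  have "(\<lambda>n. (1 / real (Suc n)) *\<^sub>R x) \<longlonglongrightarrow> 0 *\<^sub>R x"
    by (intro tendsto_intros LIMSEQ_inverse_real_of_nat[unfolded inverse_eq_divide])
  then have "(\<lambda>n. exp (- (norm ((1 / real (Suc n)) *\<^sub>R x))\<^sup>2 / 2)) \<longlonglongrightarrow> exp (- (norm (0::'a))\<^sup>2 / 2)"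
    by (intro tendsto_intros) simp_all
  then show ?thesis
    by (simp add: gauss_def)
qed

text \<open>Fatou's lemma along s = 1 / (n + 1) removes the Gaussian weight from the uniform
  bound.\<close>

lemma
  fixes F :: "'a::euclidean_space \<Rightarrow> complex"
  assumes F: "bounded_support F"
  shows inv_fourier_integrable_sq: "integrable lborel (\<lambda>x. (norm (inv_fourier F x))\<^sup>2)"
    and inv_fourier_bessel:
      "(LINT x|lborel. (norm (inv_fourier F x))\<^sup>2) \<le> (LINT \<xi>|lborel. (norm (F \<xi>))\<^sup>2)"
proof -
  note [measurable] = inv_fourier_measurable[OF F]
  define N where "N = (LINT \<xi>|lborel. (norm (F \<xi>))\<^sup>2)"
  define f where "f = (\<lambda>x. (norm (inv_fourier F x))\<^sup>2)"
  have [measurable]: "f \<in> borel_measurable borel"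
    unfolding f_def by measurable
  have le: "(\<integral>\<^sup>+x. ennreal (gauss ((1 / real (Suc n)) *\<^sub>R x) * f x) \<partial>lborel) \<le> ennreal N" for n
  proof -
    have s: "1 / real (Suc n) > 0"
      by simp
    show ?thesis
      unfolding f_def N_def
      using inv_fourier_gauss_le[OF F s] less_imp_le[OF gauss_pos]
      by (subst nn_integral_eq_integral[OF integrable_gauss_inv_fourier[OF F s]]) (auto intro!: AE_I2 mult_nonneg_nonneg less_imp_le[OF gauss_pos])
  qed
  have "liminf (\<lambda>n. ennreal (gauss ((1 / real (Suc n)) *\<^sub>R x) * f x)) = ennreal (f x)" for x
    using tendsto_mult[OF gauss_tendsto[of x] tendsto_const[of "f x"]]
    by (intro lim_imp_Liminf tendsto_ennrealI) simp_all
  then have "(\<integral>\<^sup>+x. ennreal (f x) \<partial>lborel) =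
      (\<integral>\<^sup>+x. liminf (\<lambda>n. ennreal (gauss ((1 / real (Suc n)) *\<^sub>R x) * f x)) \<partial>lborel)"
    by simp
  also have "\<dots> \<le> liminf (\<lambda>n. \<integral>\<^sup>+x. ennreal (gauss ((1 / real (Suc n)) *\<^sub>R x) * f x) \<partial>lborel)"
    by (rule nn_integral_liminf) measurable
  also have "\<dots> \<le> limsup (\<lambda>n. \<integral>\<^sup>+x. ennreal (gauss ((1 / real (Suc n)) *\<^sub>R x) * f x) \<partial>lborel)"
    by (rule Liminf_le_Limsup) simp
  also have "\<dots> \<le> ennreal N"
    by (rule Limsup_bounded) (use le in auto)
  finally have *: "(\<integral>\<^sup>+x. ennreal (f x) \<partial>lborel) \<le> ennreal N" .
  show int: "integrable lborel (\<lambda>x. (norm (inv_fourier F x))\<^sup>2)"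
    unfolding f_def[symmetric]
    using * by (intro integrableI_nonneg) (auto simp: f_def intro: order.strict_trans1)
  show "(LINT x|lborel. (norm (inv_fourier F x))\<^sup>2) \<le> (LINT \<xi>|lborel. (norm (F \<xi>))\<^sup>2)"
    using * unfolding f_def N_def by (subst (asm) nn_integral_eq_integral[OF int]) auto
qed

text \<open>For continuous F the autocorrelation converges along every ray to its value at 0, the
  squared norm of F. Both sides of the regularised identity then have limits as s tends to
  0.\<close>

lemma inv_fourier_plancherel_continuous:
  fixes F :: "'a::euclidean_space \<Rightarrow> complex"
  assumes F: "bounded_support F" and cont: "continuous_on UNIV F"
  shows "(LINT x|lborel. (norm (inv_fourier F x))\<^sup>2) = (LINT \<xi>|lborel. (norm (F \<xi>))\<^sup>2)"
proof -
  note [measurable] = bounded_support_measurable[OF F] inv_fourier_measurable[OF F]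
  obtain B where B: "B \<ge> 0" "\<And>x. norm (F x) \<le> B"
    using bounded_support_bound[OF F] by blast
  define s where "s n = 1 / real (Suc n)" for n
  have s0: "s \<longlonglongrightarrow> 0"
    unfolding s_def by (rule LIMSEQ_inverse_real_of_nat[unfolded inverse_eq_divide])
  have s_pos: "s n > 0" for n
    by (simp add: s_def)
  have auto_lim: "(\<lambda>n. autocorrelation F (s n *\<^sub>R z)) \<longlonglongrightarrow> autocorrelation F 0" for z
    unfolding autocorrelation_def
  proof (rule integral_dominated_convergence[where w = "\<lambda>\<xi>. norm (F \<xi>) * B"])
    show "integrable lborel (\<lambda>\<xi>. norm (F \<xi>) * B)"
      using bounded_support_integrable[OF F] by simp
    show "AE \<xi> in lborel. (\<lambda>n. F \<xi> * cnj (F (\<xi> + s n *\<^sub>R z))) \<longlonglongrightarrow> F \<xi> * cnj (F (\<xi> + 0))"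
    proof (intro AE_I2 tendsto_intros)
      fix \<xi>
      have "(\<lambda>n. \<xi> + s n *\<^sub>R z) \<longlonglongrightarrow> \<xi> + 0 *\<^sub>R z"
        by (intro tendsto_intros s0)
      moreover have "isCont F (\<xi> + 0 *\<^sub>R z)"
        using cont by (simp add: continuous_on_eq_continuous_at)
      ultimately show "(\<lambda>n. F (\<xi> + s n *\<^sub>R z)) \<longlonglongrightarrow> F (\<xi> + 0)"
        using isCont_tendsto_compose by fastforce
    qed
    show "AE \<xi> in lborel. norm (F \<xi> * cnj (F (\<xi> + s n *\<^sub>R z))) \<le> norm (F \<xi>) * B" for n
      using B by (intro AE_I2) (auto simp: norm_mult intro!: mult_left_mono)
  qed measurable
  define N where "N = (LINT \<xi>|lborel. (norm (F \<xi>))\<^sup>2)"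
  have "(\<lambda>n. LINT z|lborel. of_real (gauss_kernel (z::'a)) * autocorrelation F (s n *\<^sub>R z))
      \<longlonglongrightarrow> (LINT z|lborel. of_real (gauss_kernel (z::'a)) * autocorrelation F 0)"
  proof (rule integral_dominated_convergence[where w = "\<lambda>z. gauss_kernel z * N"])
    show "AE z::'a in lborel. norm (of_real (gauss_kernel z) * autocorrelation F (s n *\<^sub>R z)) \<le> gauss_kernel z * N" for n
      using norm_autocorrelation_le[OF F] by (intro AE_I2) (simp add: norm_mult N_def mult_left_mono)
    show "AE z::'a in lborel. (\<lambda>n. of_real (gauss_kernel z) * autocorrelation F (s n *\<^sub>R z))
        \<longlonglongrightarrow> of_real (gauss_kernel z) * autocorrelation F 0"
      by (intro AE_I2 tendsto_intros auto_lim)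
    show "integrable lborel (\<lambda>z::'a. gauss_kernel z * N)"
      by (intro integrable_mult_left gauss_kernel_integrable)
  qed measurable
  also have "(LINT z|lborel. of_real (gauss_kernel (z::'a)) * autocorrelation F 0) = of_real N"
  proof -
    have "autocorrelation F 0 = (LINT \<xi>|lborel. of_real ((norm (F \<xi>))\<^sup>2))"
      unfolding autocorrelation_def by (simp only: complex_norm_square add_0_right)
    then have "autocorrelation F 0 = of_real N"
      unfolding N_def by (simp only: integral_complex_of_real)
    then show ?thesis
      using gauss_kernel_integral[where 'a='a] by simp
  qed
  finally have 1: "(\<lambda>n. LINT x|lborel. gauss (s n *\<^sub>R x) * (norm (inv_fourier F x))\<^sup>2) \<longlonglongrightarrow> N"
    unfolding inv_fourier_gauss_autocorrelation[OF F s_pos, symmetric] tendsto_of_real_iff .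
  have 2: "(\<lambda>n. LINT x|lborel. gauss (s n *\<^sub>R x) * (norm (inv_fourier F x))\<^sup>2)
      \<longlonglongrightarrow> (LINT x|lborel. (norm (inv_fourier F x))\<^sup>2)"
  proof (rule integral_dominated_convergence[where w = "\<lambda>x. (norm (inv_fourier F x))\<^sup>2"])
    show "AE x in lborel. (\<lambda>n. gauss (s n *\<^sub>R x) * (norm (inv_fourier F x))\<^sup>2)
        \<longlonglongrightarrow> (norm (inv_fourier F x))\<^sup>2"
      using tendsto_mult[OF gauss_tendsto tendsto_const] unfolding s_def by (intro AE_I2) fastforce
    show "AE x in lborel. norm (gauss (s n *\<^sub>R x) * (norm (inv_fourier F x))\<^sup>2) \<le> (norm (inv_fourier F x))\<^sup>2" for n
      by (intro AE_I2) (simp add: abs_mult abs_of_nonneg[OF less_imp_le[OF gauss_pos]] gauss_le_1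
          mult_left_le_one_le less_imp_le[OF gauss_pos])
    show "integrable lborel (\<lambda>x. (norm (inv_fourier F x))\<^sup>2)"
      by (rule inv_fourier_integrable_sq[OF F])
  qed measurable
  show ?thesis
    using LIMSEQ_unique[OF 2 1] by (simp add: N_def)
qed

section \<open>Plancherel's identity without continuity\<close>

lemma bounded_support_diff:
  assumes "bounded_support F" "bounded_support G"
  shows "bounded_support (\<lambda>x. F x - G x)"
proof -
  obtain B1 R1 B2 R2 where "\<And>x. norm (F x) \<le> B1" "\<And>x. norm x > R1 \<Longrightarrow> F x = 0"
    "\<And>x. norm (G x) \<le> B2" "\<And>x. norm x > R2 \<Longrightarrow> G x = 0"
    using assms unfolding bounded_support_def by metis
  then have "\<forall>x. norm (F x - G x) \<le> B1 + B2" "\<forall>x. norm x > max R1 R2 \<longrightarrow> F x - G x = 0"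
    by (auto intro!: order_trans[OF norm_triangle_ineq4] add_mono)
  moreover have "(\<lambda>x. F x - G x) \<in> borel_measurable borel"
    using assms by (intro borel_measurable_diff bounded_support_measurable)
  ultimately show ?thesis
    unfolding bounded_support_def by blast
qed

lemma inv_fourier_integrand_integrable:
  assumes "bounded_support F"
  shows "integrable lborel (\<lambda>\<xi>. F \<xi> * cis (2 * pi * (\<xi> \<bullet> x)))"
proof (rule Bochner_Integration.integrable_bound)
  show "integrable lborel F"
    using assms by (rule bounded_support_integrable)
qed (use bounded_support_measurable[OF assms] in \<open>auto simp: norm_mult\<close>)

lemma inv_fourier_diff:
  assumes "bounded_support F" "bounded_support G"
  shows "inv_fourier (\<lambda>x. F x - G x) x = inv_fourier F x - inv_fourier G x"
  unfolding inv_fourier_def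
  by (subst Bochner_Integration.integral_diff[symmetric])
     (simp_all add: assms inv_fourier_integrand_integrable left_diff_distrib)

text \<open>A weighted form of (b + d)^2 \<le> 2 b^2 + 2 d^2 whose main constant can be taken
  arbitrarily close to 1. It replaces the triangle inequality of the L^2 norm.\<close>

lemma norm_sq_le_eps:
  fixes a b :: "'a::real_normed_vector"
  assumes "e > 0"
  shows "(norm a)\<^sup>2 \<le> (1 + e) * (norm b)\<^sup>2 + (1 + 1 / e) * (norm (a - b))\<^sup>2"
proof -
  have "0 \<le> (sqrt e * norm b - norm (a - b) / sqrt e)\<^sup>2"
    by simp
  also have "\<dots> = e * (norm b)\<^sup>2 - 2 * (norm b * norm (a - b)) + (norm (a - b))\<^sup>2 / e"
    using assms by (simp add: power2_diff power_mult_distrib power_divide)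
  finally have 1: "2 * (norm b * norm (a - b)) \<le> e * (norm b)\<^sup>2 + (norm (a - b))\<^sup>2 / e"
    by simp
  have "norm a \<le> norm b + norm (a - b)"
    using norm_triangle_sub by blast
  then have "(norm a)\<^sup>2 \<le> (norm b + norm (a - b))\<^sup>2"
    by (intro power_mono) auto
  then show ?thesis
    using 1 by (simp add: power2_sum algebra_simps)
qed

text \<open>A measurable function is an almost everywhere limit of continuous ones. Truncating these
  in value and in space gives a common bounded majorant, so that dominated convergence upgrades the
  limit to mean square.\<close>

lemma bounded_support_approx:
  fixes F :: "'a::euclidean_space \<Rightarrow> complex"
  assumes F: "bounded_support F"
  obtains g where "\<And>n. bounded_support (g n)" "\<And>n. continuous_on UNIV (g n)"
    "(\<lambda>n. LINT x|lborel. (norm (g n x))\<^sup>2) \<longlonglongrightarrow> (LINT x|lborel. (norm (F x))\<^sup>2)"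
    "(\<lambda>n. LINT x|lborel. (norm (g n x - F x))\<^sup>2) \<longlonglongrightarrow> 0"
proof -
  note [measurable] = bounded_support_measurable[OF F]
  obtain B0 R where B0: "\<And>x. norm (F x) \<le> B0" and R: "\<And>x. norm x > R \<Longrightarrow> F x = 0"
    using F unfolding bounded_support_def by metis
  \<comment> \<open>The maximum with 1 keeps the clamping radius positive.\<close>
  define B where "B = max B0 1"
  have B: "norm (F x) \<le> B" "B > 0" for x
    using B0[of x] by (auto simp: B_def)
  have "F \<in> borel_measurable lebesgue"
    by (rule measurable_completion) simp
  then have "F measurable_on UNIV"
    by (rule lebesgue_measurable_imp_measurable_on) simp
  then obtain N f where N: "negligible N" and f: "\<And>n. continuous_on UNIV (f n)"
    and lim: "\<And>x. x \<notin> N \<Longrightarrow> (\<lambda>n. f n x) \<longlonglongrightarrow> F x"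
    unfolding measurable_on_def by auto
  \<comment> \<open>\<open>clamp\<close> is the radial retraction onto the disc of radius B and
    fixes all values of F; \<open>cutoff\<close> is 1 on the ball of radius R and 0 outside radius R
    + 1.\<close>
  define clamp where "clamp z = of_real (B / max B (norm z)) * z" for z :: complex
  define cutoff where "cutoff x = max 0 (min 1 (R + 1 - norm x))" for x :: 'a
  have clamp_le: "norm (clamp z) \<le> B" for z
    using B(2) by (auto simp: clamp_def norm_mult norm_divide divide_simps max_def intro: mult_left_mono)
  have clamp_id: "clamp z = z" if "norm z \<le> B" for z
    using that B(2) by (simp add: clamp_def max_absorb1)
  have clamp_cont: "continuous_on UNIV clamp"
    unfolding clamp_def using B(2) by (intro continuous_intros) auto
  have cutoff_cont: "continuous_on UNIV cutoff"
    unfolding cutoff_def by (intro continuous_intros)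
  define g where "g n x = of_real (cutoff x) * clamp (f n x)" for n x
  have gB: "norm (g n x) \<le> B" for n x
  proof -
    have "\<bar>cutoff x\<bar> * norm (clamp (f n x)) \<le> 1 * B"
      using clamp_le by (intro mult_mono) (auto simp: cutoff_def)
    then show ?thesis
      by (simp add: g_def norm_mult)
  qed
  have g0: "g n x = 0" if "norm x > \<bar>R\<bar> + 1" for n x
    using that by (simp add: g_def cutoff_def)
  have F0: "F x = 0" if "norm x > \<bar>R\<bar> + 1" for x
    using that R[of x] by simp
  have g_cont: "continuous_on UNIV (g n)" for n
    unfolding g_def
    by (intro continuous_intros cutoff_cont continuous_on_compose2[OF clamp_cont f]) auto
  then have g_meas [measurable]: "g n \<in> borel_measurable borel" for n
    by (rule borel_measurable_continuous_onI)
  have g_lim: "(\<lambda>n. g n x) \<longlonglongrightarrow> F x" if "x \<notin> N" for x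
  proof -
    have "(\<lambda>n. clamp (f n x)) \<longlonglongrightarrow> clamp (F x)"
      using clamp_cont by (intro isCont_tendsto_compose[OF _ lim[OF that]]) (simp add: continuous_on_eq_continuous_at)
    then have "(\<lambda>n. g n x) \<longlonglongrightarrow> of_real (cutoff x) * clamp (F x)"
      unfolding g_def by (intro tendsto_intros)
    moreover have "of_real (cutoff x) * clamp (F x) = F x"
      using clamp_id[OF B(1)[of x]] R[of x] by (cases "norm x > R") (auto simp: cutoff_def)
    ultimately show ?thesis
      by simp
  qed
  have AE: "AE x in lborel. x \<notin> N"
    using AE_not_in[of N lebesgue] N by (simp add: negligible_iff_null_sets AE_completion_iff)
  define w where "w x = (if x \<in> cball (0::'a) (\<bar>R\<bar> + 1) then (2 * B)\<^sup>2 else 0)" for x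
  have w: "integrable lborel w"
    unfolding w_def by (rule integrable_bounded_cball[where B = "(2 * B)\<^sup>2" and R = "\<bar>R\<bar> + 1"]) auto
  have dom: "(norm (g n x))\<^sup>2 \<le> w x" "(norm (g n x - F x))\<^sup>2 \<le> w x" for n x
  proof -
    have "norm (g n x - F x) \<le> 2 * B"
      using norm_triangle_ineq4[of "g n x" "F x"] gB[of n x] B(1)[of x] by linarith
    moreover have "norm (g n x) \<le> 2 * B"
      using gB[of n x] B(2) by linarith
    ultimately have "(norm (g n x))\<^sup>2 \<le> (2 * B)\<^sup>2" "(norm (g n x - F x))\<^sup>2 \<le> (2 * B)\<^sup>2"
      by - (rule power_mono[OF _ norm_ge_zero], assumption)+
    then show "(norm (g n x))\<^sup>2 \<le> w x" "(norm (g n x - F x))\<^sup>2 \<le> w x"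
      using g0[of x n] F0[of x] by (auto simp: w_def)
  qed
  show thesis
  proof (rule that[of g])
    show "bounded_support (g n)" for n
      unfolding bounded_support_def using gB g0 g_meas by blast
    show "(\<lambda>n. LINT x|lborel. (norm (g n x))\<^sup>2) \<longlonglongrightarrow> (LINT x|lborel. (norm (F x))\<^sup>2)"
    proof (rule integral_dominated_convergence[OF _ _ w])
      show "AE x in lborel. (\<lambda>n. (norm (g n x))\<^sup>2) \<longlonglongrightarrow> (norm (F x))\<^sup>2"
        using AE by eventually_elim (intro tendsto_intros g_lim)
      show "AE x in lborel. norm ((norm (g n x))\<^sup>2) \<le> w x" for n
        using dom by simp
    qed measurable
    have "(\<lambda>n. LINT x|lborel. (norm (g n x - F x))\<^sup>2) \<longlonglongrightarrow> (LINT x|(lborel :: 'a measure). 0)"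
    proof (rule integral_dominated_convergence[OF _ _ w])
      show "AE x in lborel. (\<lambda>n. (norm (g n x - F x))\<^sup>2) \<longlonglongrightarrow> 0"
        using AE
      proof eventually_elim
        case (elim x)
        then have "(\<lambda>n. (norm (g n x - F x))\<^sup>2) \<longlonglongrightarrow> (norm (F x - F x))\<^sup>2"
          by (intro tendsto_intros g_lim)
        then show ?case by simp
      qed
      show "AE x in lborel. norm ((norm (g n x - F x))\<^sup>2) \<le> w x" for n
        using dom by simp
    qed measurable
    then show "(\<lambda>n. LINT x|lborel. (norm (g n x - F x))\<^sup>2) \<longlonglongrightarrow> 0"
      by simp
  qed (rule g_cont)
qed

text \<open>Bessel's inequality is one half. For the other, the identity for continuous approximants
  is combined with Bessel's inequality for their differences from F.\<close>

theorem inv_fourier_plancherel: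
  fixes F :: "'a::euclidean_space \<Rightarrow> complex"
  assumes F: "bounded_support F"
  shows "(LINT x|lborel. (norm (inv_fourier F x))\<^sup>2) = (LINT \<xi>|lborel. (norm (F \<xi>))\<^sup>2)"
proof (rule antisym[OF inv_fourier_bessel[OF F]])
  obtain g where g: "\<And>n. bounded_support (g n)" "\<And>n. continuous_on UNIV (g n)"
    and lim: "(\<lambda>n. LINT x|lborel. (norm (g n x))\<^sup>2) \<longlonglongrightarrow> (LINT x|lborel. (norm (F x))\<^sup>2)"
      "(\<lambda>n. LINT x|lborel. (norm (g n x - F x))\<^sup>2) \<longlonglongrightarrow> 0"
    using bounded_support_approx[OF F] by blast
  define a where "a = (LINT x|lborel. (norm (F x))\<^sup>2)"
  define b where "b = (LINT x|lborel. (norm (inv_fourier F x))\<^sup>2)"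
  have b0: "b \<ge> 0"
    unfolding b_def by simp
  have eps: "a \<le> (1 + e) * b" if e: "e > 0" for e
  proof (rule LIMSEQ_le[OF lim(1)[folded a_def]])
    have "(\<lambda>n. (1 + e) * b + (1 + 1 / e) * (LINT x|lborel. (norm (g n x - F x))\<^sup>2))
        \<longlonglongrightarrow> (1 + e) * b + (1 + 1 / e) * 0"
      by (intro tendsto_intros lim)
    then show "(\<lambda>n. (1 + e) * b + (1 + 1 / e) * (LINT x|lborel. (norm (g n x - F x))\<^sup>2)) \<longlonglongrightarrow> (1 + e) * b"
      by simp
    have "(LINT x|lborel. (norm (g n x))\<^sup>2)
        \<le> (1 + e) * b + (1 + 1 / e) * (LINT x|lborel. (norm (g n x - F x))\<^sup>2)" for n
    proof -
      have d: "bounded_support (\<lambda>x. g n x - F x)"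
        by (rule bounded_support_diff[OF g(1) F])
      note int = inv_fourier_integrable_sq[OF g(1)] inv_fourier_integrable_sq[OF F]
        inv_fourier_integrable_sq[OF d]
      have "(LINT x|lborel. (norm (g n x))\<^sup>2) = (LINT x|lborel. (norm (inv_fourier (g n) x))\<^sup>2)"
        by (rule inv_fourier_plancherel_continuous[OF g, symmetric])
      also have "\<dots> \<le> (LINT x|lborel. (1 + e) * (norm (inv_fourier F x))\<^sup>2 +
          (1 + 1 / e) * (norm (inv_fourier (\<lambda>x. g n x - F x) x))\<^sup>2)"
        using norm_sq_le_eps[OF e] int
        by (intro integral_mono) (auto simp: inv_fourier_diff[OF g(1) F])
      also have "\<dots> = (1 + e) * b + (1 + 1 / e) * (LINT x|lborel. (norm (inv_fourier (\<lambda>x. g n x - F x) x))\<^sup>2)"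
        using int by (simp add: b_def)
      also have "\<dots> \<le> (1 + e) * b + (1 + 1 / e) * (LINT x|lborel. (norm (g n x - F x))\<^sup>2)"
        using inv_fourier_bessel[OF d] e by (intro add_left_mono mult_left_mono) auto
      finally show ?thesis .
    qed
    then show "\<exists>N. \<forall>n\<ge>N. (LINT x|lborel. (norm (g n x))\<^sup>2)
        \<le> (1 + e) * b + (1 + 1 / e) * (LINT x|lborel. (norm (g n x - F x))\<^sup>2)"
      by blast
  qed
  have "a \<le> b"
  proof (rule field_le_epsilon)
    fix e :: real assume "e > 0"
    \<comment> \<open>Dividing by b + 1 rather than b covers the case b = 0.\<close>
    then have "a \<le> (1 + e / (b + 1)) * b"
      using b0 by (intro eps) auto
    also have "\<dots> = b + e * (b / (b + 1))"
      by (simp add: field_simps)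
    also have "\<dots> \<le> b + e * 1"
      using b0 \<open>e > 0\<close> by (intro add_left_mono mult_left_mono) (auto simp: divide_le_eq)
    finally show "a \<le> b + e" by simp
  qed
  then show "(LINT \<xi>|lborel. (norm (F \<xi>))\<^sup>2) \<le> (LINT x|lborel. (norm (inv_fourier F x))\<^sup>2)"
    by (simp add: a_def b_def)
qed

section \<open>The Fourier transform as a mean square limit of truncated integrals\<close>

lemma exp_eq_cis: "exp (- 2 * of_real pi * \<i> * of_real a) = cis (2 * pi * (- a))"
  by (simp add: cis_conv_exp mult_ac)

text \<open>
  Expanding the square, the mixed term is \<open>\<integral> \<bar>g\<bar>\<^sup>2\<close> because the two transforms are adjoint, and
  Bessel's inequality bounds the last term by the same quantity.
\<close>

lemma inv_fourier_truncation_error: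
  fixes F :: "'a::euclidean_space \<Rightarrow> complex"
  assumes F: "bounded_support F" and g: "bounded_support g"
    and eq: "\<And>x. g x = 0 \<or> g x = inv_fourier F x"
  shows "(\<integral>\<^sup>+\<xi>. ennreal ((norm (F \<xi> - inv_fourier g (- \<xi>)))\<^sup>2) \<partial>lborel)
    \<le> ennreal ((LINT \<xi>|lborel. (norm (F \<xi>))\<^sup>2) - (LINT x|lborel. (norm (g x))\<^sup>2))"
proof -
  note [measurable] = bounded_support_measurable[OF F] bounded_support_measurable[OF g]
    inv_fourier_measurable[OF F] inv_fourier_measurable[OF g]
  define G where "G \<xi> = inv_fourier g (- \<xi>)" for \<xi>
  have [measurable]: "G \<in> borel_measurable borel"
    unfolding G_def by measurable
  have G_int: "integrable lborel (\<lambda>\<xi>. (norm (G \<xi>))\<^sup>2)"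
    using lborel_integrable_affine[OF _ inv_fourier_integrable_sq[OF g], of "- 1" 0] by (simp add: G_def)
  have G_le: "(LINT \<xi>|lborel. (norm (G \<xi>))\<^sup>2) \<le> (LINT x|lborel. (norm (g x))\<^sup>2)"
    using inv_fourier_bessel[OF g] lborel_integral_affine[of "- 1" "\<lambda>\<xi>. (norm (inv_fourier g \<xi>))\<^sup>2" 0]
    by (simp add: G_def)
  have G_bound: "norm (G \<xi>) \<le> (LINT \<xi>|lborel. norm (g \<xi>))" for \<xi>
    unfolding G_def by (rule norm_inv_fourier_le)
  have FG_int: "integrable lborel (\<lambda>\<xi>. F \<xi> * cnj (G \<xi>))"
  proof (rule Bochner_Integration.integrable_bound)
    show "integrable lborel (\<lambda>\<xi>. F \<xi> * of_real (LINT \<xi>|lborel. norm (g \<xi>)))"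
      using bounded_support_integrable[OF F] by simp
    show "AE \<xi> in lborel. norm (F \<xi> * cnj (G \<xi>)) \<le> norm (F \<xi> * of_real (LINT \<xi>|lborel. norm (g \<xi>)))"
      using G_bound by (intro AE_I2) (auto simp: norm_mult intro!: mult_left_mono intro: order_trans abs_ge_self)
  qed measurable
  have "(LINT \<xi>|lborel. F \<xi> * cnj (G \<xi>)) =
      (LINT \<xi>|lborel. (LINT x|lborel. F \<xi> * (cnj (g x) * cis (2 * pi * (\<xi> \<bullet> x)))))"
    unfolding G_def inv_fourier_def Bochner_Integration.integral_cnj[symmetric] integral_mult_right_zero[symmetric]
    by (simp add: cis_cnj inner_commute del: Bochner_Integration.integral_cnj integral_mult_right_zero)
  also have "\<dots> = (LINT x|lborel. (LINT \<xi>|lborel. F \<xi> * (cnj (g x) * cis (2 * pi * (\<xi> \<bullet> x)))))"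
  proof (rule lborel_pair.Fubini_integral)
    show "integrable (lborel \<Otimes>\<^sub>M lborel) (\<lambda>(x, \<xi>). F \<xi> * (cnj (g x) * cis (2 * pi * (\<xi> \<bullet> x))))"
      by (rule integrable_lborel_pair_bound[OF integrable_norm[OF bounded_support_integrable[OF g]]
            integrable_norm[OF bounded_support_integrable[OF F]]])
         (measurable, simp add: norm_mult)
  qed
  also have "\<dots> = (LINT x|lborel. cnj (g x) * inv_fourier F x)"
    unfolding inv_fourier_def
    by (subst integral_mult_right_zero[symmetric]) (simp only: mult_ac)
  also have "\<dots> = (LINT x|lborel. of_real ((norm (g x))\<^sup>2))"
  proof (intro Bochner_Integration.integral_cong refl)
    show "cnj (g x) * inv_fourier F x = of_real ((norm (g x))\<^sup>2)" for x
      using eq[of x] by (simp only: complex_norm_square) (auto simp: mult_ac)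
  qed
  also have "\<dots> = of_real (LINT x|lborel. (norm (g x))\<^sup>2)"
    by (rule integral_complex_of_real)
  finally have FG: "(LINT \<xi>|lborel. Re (F \<xi> * cnj (G \<xi>))) = (LINT x|lborel. (norm (g x))\<^sup>2)"
    by (simp only: integral_Re[OF FG_int] Re_complex_of_real)
  define r where "r \<xi> = Re (F \<xi> * cnj (G \<xi>))" for \<xi>
  have r_int: "integrable lborel r"
    unfolding r_def by (rule integrable_Re[OF FG_int])
  have expand: "(norm (F \<xi> - G \<xi>))\<^sup>2 = (norm (F \<xi>))\<^sup>2 - 2 * r \<xi> + (norm (G \<xi>))\<^sup>2" for \<xi>
    by (simp add: r_def cmod_power2 power2_diff)
  have int: "integrable lborel (\<lambda>\<xi>. (norm (F \<xi> - G \<xi>))\<^sup>2)"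
    unfolding expand using bounded_support_integrable_sq[OF F] r_int G_int by auto
  have "(LINT \<xi>|lborel. (norm (F \<xi> - G \<xi>))\<^sup>2) =
      (LINT \<xi>|lborel. (norm (F \<xi>))\<^sup>2) - 2 * (LINT \<xi>|lborel. r \<xi>) + (LINT \<xi>|lborel. (norm (G \<xi>))\<^sup>2)"
    unfolding expand using bounded_support_integrable_sq[OF F] r_int G_int by simp
  then have "(LINT \<xi>|lborel. (norm (F \<xi> - G \<xi>))\<^sup>2)
      \<le> (LINT \<xi>|lborel. (norm (F \<xi>))\<^sup>2) - (LINT x|lborel. (norm (g x))\<^sup>2)"
    unfolding FG[folded r_def] using G_le by linarith
  then show ?thesis
    unfolding G_def[symmetric] by (subst nn_integral_eq_integral[OF int]) (auto intro: ennreal_leI)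
qed

text \<open>By Plancherel's identity the truncation error is at most the squared norm of f minus
  that of its restriction to the ball, the tail of a convergent integral.\<close>

lemma is_fourier_inv_fourier:
  fixes F :: "real ^ 'm::finite \<Rightarrow> complex"
  assumes F: "bounded_support F"
  shows "is_fourier (inv_fourier F) F"
proof -
  note [measurable] = bounded_support_measurable[OF F] inv_fourier_measurable[OF F]
  define f where "f = inv_fourier F"
  define g where "g R x = (if x \<in> cball 0 R then f x else 0)" for R x
  have [measurable]: "f \<in> borel_measurable borel"
    unfolding f_def by measurable
  have f_int: "integrable lborel (\<lambda>x. (norm (f x))\<^sup>2)"
    unfolding f_def by (rule inv_fourier_integrable_sq[OF F])
  have g_meas [measurable]: "g R \<in> borel_measurable borel" for R
    unfolding g_def mem_cball_0 by measurable
  have g: "bounded_support (g R)" for R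
    unfolding bounded_support_def
  proof (intro conjI exI allI impI)
    show "norm (g R x) \<le> (LINT \<xi>|lborel. norm (F \<xi>))" for x
      using norm_inv_fourier_le[of F x] order_trans[OF norm_ge_zero] by (auto simp: g_def f_def)
    show "g R x = 0" if "R < norm x" for x
      using that by (simp add: g_def)
  qed simp
  \<comment> \<open>The forward integral is the inverse transform at the reflected frequency, so
    \<open>inv_fourier\<close> serves both directions.\<close>
  have ft: "fourier_integral (g R) \<xi> = inv_fourier (g R) (- \<xi>)" for R \<xi>
    unfolding fourier_integral_def inv_fourier_def exp_eq_cis
    by (subst integral_completion) (simp_all add: inner_commute)
  have bound: "(\<integral>\<^sup>+\<xi>. ennreal ((norm (F \<xi> - fourier_integral (g R) \<xi>))\<^sup>2) \<partial>lebesgue)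
      \<le> ennreal ((LINT x|lborel. (norm (f x))\<^sup>2) - (LINT x|lborel. (norm (g R x))\<^sup>2))" for R
    unfolding ft nn_integral_completion
    using inv_fourier_truncation_error[OF F g, of R] inv_fourier_plancherel[OF F]
    by (simp add: f_def g_def split: if_splits)
  have "((\<lambda>R. LINT x|lborel. (norm (g R x))\<^sup>2) \<longlongrightarrow> (LINT x|lborel. (norm (f x))\<^sup>2)) at_top"
  proof (rule integral_dominated_convergence_at_top[where w = "\<lambda>x. (norm (f x))\<^sup>2"])
    show "\<forall>\<^sub>F R in at_top. AE x in lborel. norm ((norm (g R x))\<^sup>2) \<le> (norm (f x))\<^sup>2"
      by (intro always_eventually allI AE_I2) (simp add: g_def)
    show "AE x in lborel. ((\<lambda>R. (norm (g R x))\<^sup>2) \<longlongrightarrow> (norm (f x))\<^sup>2) at_top"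
    proof (intro AE_I2 tendsto_eventually)
      fix x
      show "\<forall>\<^sub>F R in at_top. (norm (g R x))\<^sup>2 = (norm (f x))\<^sup>2"
        using eventually_ge_at_top[of "norm x"] by eventually_elim (simp add: g_def)
    qed
  qed (use f_int in measurable)
  then have "((\<lambda>R. (LINT x|lborel. (norm (f x))\<^sup>2) - (LINT x|lborel. (norm (g R x))\<^sup>2)) \<longlongrightarrow>
      (LINT x|lborel. (norm (f x))\<^sup>2) - (LINT x|lborel. (norm (f x))\<^sup>2)) at_top"
    by (intro tendsto_intros)
  then have lim: "((\<lambda>R. ennreal ((LINT x|lborel. (norm (f x))\<^sup>2) - (LINT x|lborel. (norm (g R x))\<^sup>2))) \<longlongrightarrow> 0) at_top"
    using tendsto_ennrealI by fastforce
  have "((\<lambda>R. \<integral>\<^sup>+\<xi>. ennreal ((norm (F \<xi> - fourier_integral (g R) \<xi>))\<^sup>2) \<partial>lebesgue) \<longlongrightarrow> 0) at_top"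
    by (rule tendsto_sandwich[OF _ _ tendsto_const lim]) (use bound in \<open>auto intro!: always_eventually\<close>)
  moreover have "square_integrable F"
    using bounded_support_integrable_sq[OF F]
    by (auto simp: square_integrable_def integrable_completion intro!: measurable_completion)
  moreover have "square_integrable f"
    using f_int by (auto simp: square_integrable_def integrable_completion intro!: measurable_completion)
  ultimately show ?thesis
    unfolding is_fourier_def f_def[symmetric] g_def by blast
qed

lemma is_fourier_cong_AE:
  assumes "is_fourier f F" and "AE \<xi> in lebesgue. F \<xi> = G \<xi>" and G: "G \<in> borel_measurable lebesgue"
  shows "is_fourier f G"
proof -
  have F: "F \<in> borel_measurable lebesgue"
    using assms(1) by (simp add: is_fourier_def square_integrable_def)
  have "integrable lebesgue (\<lambda>x. (norm (F x))\<^sup>2) \<longleftrightarrow> integrable lebesgue (\<lambda>x. (norm (G x))\<^sup>2)"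
    using assms(2) F G by (intro integrable_cong_AE borel_measurable_power borel_measurable_norm) auto
  then have "square_integrable G"
    using assms(1) G by (simp add: is_fourier_def square_integrable_def)
  moreover have "(\<integral>\<^sup>+\<xi>. ennreal ((norm (F \<xi> - K \<xi>))\<^sup>2) \<partial>lebesgue) =
      (\<integral>\<^sup>+\<xi>. ennreal ((norm (G \<xi> - K \<xi>))\<^sup>2) \<partial>lebesgue)" for K
    using assms(2) by (intro nn_integral_cong_AE) auto
  ultimately show ?thesis
    using assms(1) by (simp add: is_fourier_def)
qed

theorem is_fourier_synthesis:
  fixes F :: "real ^ 'm::finite \<Rightarrow> complex"
  assumes F: "F \<in> borel_measurable lebesgue" and B: "\<And>\<xi>. norm (F \<xi>) \<le> B"
    and R: "\<And>\<xi>. norm \<xi> > R \<Longrightarrow> F \<xi> = 0"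
  shows "is_fourier (\<lambda>x. LINT \<xi>|lebesgue. F \<xi> * cis (2 * pi * (\<xi> \<bullet> x))) F"
proof -
  have "(\<lambda>\<xi>. Re (F \<xi>)) \<in> borel_measurable lebesgue" "(\<lambda>\<xi>. Im (F \<xi>)) \<in> borel_measurable lebesgue"
    using F by measurable
  then obtain p q where [measurable]: "p \<in> borel_measurable borel" "q \<in> borel_measurable borel"
    and pq: "AE \<xi> in lborel. Re (F \<xi>) = p \<xi>" "AE \<xi> in lborel. Im (F \<xi>) = q \<xi>"
    by (auto dest!: completion_ex_borel_measurable_real)
  \<comment> \<open>The Borel representative may violate the bound B or leave the ball on a null
    set; it is set to 0 there.\<close>
  define G where "G \<xi> = (if norm (Complex (p \<xi>) (q \<xi>)) \<le> B \<and> norm \<xi> \<le> R then Complex (p \<xi>) (q \<xi>) else 0)" for \<xi>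
  have G_meas [measurable]: "G \<in> borel_measurable borel"
    unfolding G_def Complex_eq by measurable
  have "norm (G \<xi>) \<le> B" for \<xi>
    using order_trans[OF norm_ge_zero B] by (simp add: G_def)
  moreover have "G \<xi> = 0" if "R < norm \<xi>" for \<xi>
    using that by (simp add: G_def)
  ultimately have G: "bounded_support G"
    unfolding bounded_support_def using G_meas by blast
  have "AE \<xi> in lborel. G \<xi> = F \<xi>"
    using pq
  proof eventually_elim
    case (elim \<xi>)
    then have "F \<xi> = Complex (p \<xi>) (q \<xi>)"
      by (simp add: complex_eq_iff)
    then show ?case
      using B[of \<xi>] R[of \<xi>] by (auto simp: G_def not_le)
  qed
  then have AE: "AE \<xi> in lebesgue. G \<xi> = F \<xi>"
    by (rule AE_completion)
  have "(LINT \<xi>|lebesgue. F \<xi> * cis (2 * pi * (\<xi> \<bullet> x))) = inv_fourier G x" for x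
  proof -
    have "(\<lambda>\<xi>. cis (2 * pi * (\<xi> \<bullet> x))) \<in> borel_measurable lebesgue" "G \<in> borel_measurable lebesgue"
      by (rule measurable_completion, measurable)+
    then have "(LINT \<xi>|lebesgue. F \<xi> * cis (2 * pi * (\<xi> \<bullet> x))) = (LINT \<xi>|lebesgue. G \<xi> * cis (2 * pi * (\<xi> \<bullet> x)))"
      using AE F by (intro integral_cong_AE borel_measurable_times) auto
    then show ?thesis
      unfolding inv_fourier_def by (subst (asm) (2) integral_completion) auto
  qed
  then show ?thesis
    using is_fourier_cong_AE[OF is_fourier_inv_fourier[OF G] AE F] by simp
qed

section \<open>The dispersion relation\<close>

text \<open>The root is the first point where \<open>G x\<close> is nonnegative. Comparing it with a
  threshold only involves countably many values of \<open>G x\<close>, which gives measurability.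
  That it depends on x through the function \<open>G x\<close> alone later transfers the symmetry of
  \<mu> to \<sigma>.\<close>

lemma measurable_root:
  fixes G :: "'a \<Rightarrow> real \<Rightarrow> real"
  assumes meas: "\<And>s. s \<in> {p..q} \<Longrightarrow> (\<lambda>x. G x s) \<in> borel_measurable M"
    and cont: "\<And>x. continuous_on {p..q} (G x)"
    and le: "p \<le> q" and neg: "\<And>x. G x p \<le> 0" and pos: "\<And>x. 0 \<le> G x q"
  obtains \<sigma> where "\<sigma> \<in> borel_measurable M" "\<And>x. \<sigma> x \<in> {p..q}" "\<And>x. G x (\<sigma> x) = 0"
    "\<And>x y. G x = G y \<Longrightarrow> \<sigma> x = \<sigma> y"
proof -
  define S where "S x = {s \<in> {p..q}. 0 \<le> G x s}" for x
  define \<sigma> where "\<sigma> x = Inf (S x)" for x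
  have S_closed: "closed (S x)" for x
    unfolding S_def by (intro continuous_closed_preimage_constant continuous_on_closed_Collect_le cont
        continuous_on_const closed_atLeastAtMost)
  have S_bdd: "bdd_below (S x)" for x
    unfolding S_def by (auto intro: bdd_belowI[of _ p])
  have \<sigma>_S: "\<sigma> x \<in> S x" for x
    unfolding \<sigma>_def using pos le by (intro closed_contains_Inf S_bdd S_closed) (auto simp: S_def)
  then have \<sigma>: "\<sigma> x \<in> {p..q}" "0 \<le> G x (\<sigma> x)" for x
    by (auto simp: S_def)
  have \<sigma>_le: "\<sigma> x \<le> s" if "s \<in> {p..q}" "0 \<le> G x s" for x s
    unfolding \<sigma>_def using that by (intro cInf_lower S_bdd) (auto simp: S_def)
  have root: "G x (\<sigma> x) = 0" for x
  proof -
    \<comment> \<open>The intermediate value theorem gives a zero not beyond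
      \<open>\<sigma> x\<close>, and minimality of \<open>\<sigma> x\<close> identifies the
      two.\<close>
    obtain s where "p \<le> s" "s \<le> \<sigma> x" "G x s = 0"
      using IVT'[of "G x" p 0 "\<sigma> x"] neg \<sigma>[of x] continuous_on_subset[OF cont, of "{p..\<sigma> x}" x] by auto
    moreover from this have "s = \<sigma> x"
      using \<sigma>_le[of s x] \<sigma>[of x] by auto
    ultimately show ?thesis by simp
  qed
  have "{x \<in> space M. \<sigma> x \<le> a} \<in> sets M" for a
  proof -
    consider "a < p" | "q \<le> a" | "p \<le> a" "a < q" by linarith
    then show ?thesis
    proof cases
      case 1
      then have "\<not> \<sigma> x \<le> a" for x
        using \<sigma>(1)[of x] by auto
      then have "{x \<in> space M. \<sigma> x \<le> a} = {}"
        by blast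
      then show ?thesis by (simp only: sets.empty_sets)
    next
      case 2
      then have "\<sigma> x \<le> a" for x
        using \<sigma>(1)[of x] by auto
      then have "{x \<in> space M. \<sigma> x \<le> a} = space M"
        by blast
      then show ?thesis by simp
    next
      case 3
      define \<tau> where "\<tau> j k = p + (real j / real (Suc k)) * (a - p)" for j k :: nat
      have \<tau>: "\<tau> j k \<in> {p..a}" if "j \<le> Suc k" for j k
      proof -
        have "real j / real (Suc k) \<le> 1"
          using that by (simp add: divide_le_eq)
        then have "(real j / real (Suc k)) * (a - p) \<le> 1 * (a - p)"
          using 3 by (intro mult_right_mono) auto
        then show ?thesis
          using 3 by (simp add: \<tau>_def)
      qed
      \<comment> \<open>Measurability of \<open>G\<close> is assumed only for parameters in
        \<open>{p..q}\<close>; the value 0 off the grid makes the countable family measurable for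
        all indices.\<close>
      define H where "H j k x = (if j \<le> Suc k then G x (\<tau> j k) else 0)" for j k x
      have [measurable]: "H j k \<in> borel_measurable M" for j k
      proof (cases "j \<le> Suc k")
        case True
        then show ?thesis
          using meas[of "\<tau> j k"] \<tau>[OF True] 3 by (auto simp: H_def[abs_def])
      next
        case False
        then show ?thesis
          by (simp add: H_def[abs_def])
      qed
      \<comment> \<open>A point of [p, a] with \<open>G x\<close> nonnegative exists exactly when
        the values on the grids get above every negative bound. One direction approximates
        \<open>\<sigma> x\<close> by grid points; the other uses that the maximum over [p, a] is
        attained.\<close>
      have "\<sigma> x \<le> a \<longleftrightarrow> (\<forall>n::nat. \<exists>j k. j \<le> Suc k \<and> G x (\<tau> j k) > - (1 / real (Suc n)))" for x
      proof
        assume a: "\<sigma> x \<le> a"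
        define t where "t = (\<sigma> x - p) / (a - p)"
        have t: "0 \<le> t" "t \<le> 1" and t_eq: "\<sigma> x = p + t * (a - p)"
          using \<sigma>[of x] a 3 by (auto simp: t_def divide_simps)
        \<comment> \<open>Rounding down yields a grid parameter within one mesh width of t.\<close>
        define J where "J k = nat \<lfloor>real (Suc k) * t\<rfloor>" for k
        have J: "J k \<le> Suc k" "\<bar>real (J k) / real (Suc k) - t\<bar> \<le> 1 / real (Suc k)" for k
        proof -
          have 1: "real (J k) \<le> real (Suc k) * t" "real (Suc k) * t \<le> real (J k) + 1"
            using t by (auto simp: J_def)
          have "real (Suc k) * t \<le> real (Suc k) * 1"
            using t by (intro mult_left_mono) auto
          with 1(1) have "real (J k) \<le> real (Suc k)"
            by (metis mult.right_neutral order_trans)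
          then show "J k \<le> Suc k"
            by (simp only: of_nat_le_iff)
          have "real (J k) / real (Suc k) - t = (real (J k) - real (Suc k) * t) / real (Suc k)"
            by (simp add: diff_divide_distrib)
          then show "\<bar>real (J k) / real (Suc k) - t\<bar> \<le> 1 / real (Suc k)"
            using 1 by (simp add: abs_divide divide_right_mono)
        qed
        have "(\<lambda>k. real (J k) / real (Suc k) - t) \<longlonglongrightarrow> 0"
          by (rule Lim_null_comparison[OF _ LIMSEQ_inverse_real_of_nat])
             (use J in \<open>auto simp: inverse_eq_divide intro!: always_eventually\<close>)
        then have "(\<lambda>k. real (J k) / real (Suc k)) \<longlonglongrightarrow> t"
          by (simp add: LIM_zero_iff)
        then have "(\<lambda>k. \<tau> (J k) k) \<longlonglongrightarrow> \<sigma> x"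
          unfolding \<tau>_def t_eq by (intro tendsto_intros)
        then have "(\<lambda>k. G x (\<tau> (J k) k)) \<longlonglongrightarrow> G x (\<sigma> x)"
        proof (rule continuous_on_tendsto_compose[OF cont _ \<sigma>(1)])
          show "\<forall>\<^sub>F k in sequentially. \<tau> (J k) k \<in> {p..q}"
            using \<tau>[OF J(1)] 3 by (intro always_eventually allI) fastforce
        qed
        then have ev: "\<forall>\<^sub>F k in sequentially. G x (\<tau> (J k) k) > - (1 / real (Suc n))" for n
          by (rule order_tendstoD) (simp add: root)
        show "\<forall>n::nat. \<exists>j k. j \<le> Suc k \<and> G x (\<tau> j k) > - (1 / real (Suc n))"
        proof
          fix n
          obtain k where "G x (\<tau> (J k) k) > - (1 / real (Suc n))"
            using eventually_happens'[OF sequentially_bot ev[of n]] by blast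
          then show "\<exists>j k. j \<le> Suc k \<and> G x (\<tau> j k) > - (1 / real (Suc n))"
            using J(1)[of k] by blast
        qed
      next
        assume *: "\<forall>n::nat. \<exists>j k. j \<le> Suc k \<and> G x (\<tau> j k) > - (1 / real (Suc n))"
        have "continuous_on {p..a} (G x)"
          using 3 by (intro continuous_on_subset[OF cont]) auto
        then obtain s where s: "s \<in> {p..a}" "\<And>s'. s' \<in> {p..a} \<Longrightarrow> G x s' \<le> G x s"
          using continuous_attains_sup[of "{p..a}" "G x"] 3 by auto
        have "0 \<le> G x s"
        proof (rule ccontr)
          assume "\<not> 0 \<le> G x s"
          then obtain n where "1 / real (Suc n) < - G x s"
            using reals_Archimedean[of "- G x s"] by (auto simp: inverse_eq_divide)
          moreover obtain j k where "j \<le> Suc k" "G x (\<tau> j k) > - (1 / real (Suc n))"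
            using * by blast
          ultimately show False
            using s(2)[OF \<tau>, of j k] by linarith
        qed
        then show "\<sigma> x \<le> a"
          using \<sigma>_le[of s x] s(1) 3 by auto
      qed
      then have "{x \<in> space M. \<sigma> x \<le> a} =
          {x \<in> space M. \<forall>n::nat. \<exists>j k. j \<le> Suc k \<and> G x (\<tau> j k) > - (1 / real (Suc n))}"
        by (simp only:)
      also have "\<dots> = {x \<in> space M. \<forall>n::nat. \<exists>j k. j \<le> Suc k \<and> H j k x > - (1 / real (Suc n))}"
        unfolding H_def by (simp cong: conj_cong)
      also have "\<dots> \<in> sets M"
        by measurable
      finally show ?thesis .
    qed
  qed
  then have "\<sigma> \<in> borel_measurable M"
    by (intro borel_measurableI_le)
  moreover have "\<sigma> x = \<sigma> y" if "G x = G y" for x y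
    using that by (simp add: \<sigma>_def S_def)
  ultimately show thesis
    using that \<sigma> root by blast
qed

text \<open>A square root of 1 - s that is continuous on the whole real line, so that m = k * rt s
  satisfies m^2 = k^2 + \<lambda> for \<lambda> = - s k^2. It is real up to s = 1 and imaginary
  beyond.\<close>

definition rt :: "real \<Rightarrow> complex"
  where "rt s = Complex (sqrt (max 0 (1 - s))) (sqrt (max 0 (s - 1)))"

lemma rt_power2 [simp]: "(rt s)\<^sup>2 = of_real (1 - s)"
  by (auto simp: rt_def complex_eq_iff power2_eq_square max_def)

lemma rt_eq_0_iff [simp]: "rt s = 0 \<longleftrightarrow> s = 1"
  by (auto simp: rt_def complex_eq_iff max_def)

lemma cnj_rt: "cnj (rt s) = (if s \<le> 1 then rt s else - rt s)"
  by (auto simp: rt_def complex_eq_iff max_def)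

lemma continuous_rt: "continuous_on A rt"
  unfolding rt_def Complex_eq by (intro continuous_intros)

text \<open>
  The fundamental solutions of \<open>(D\<^sup>2 - k\<^sup>2) (D\<^sup>2 - m\<^sup>2) w = 0\<close> with initial data \<open>(0, 0, 1, 0)\<close> and
  \<open>(0, 0, 0, 1)\<close>; the first argument is the order of differentiation in \<open>y\<close>.
\<close>

definition cfun :: "nat \<Rightarrow> complex \<Rightarrow> complex \<Rightarrow> complex \<Rightarrow> complex"
  where "cfun n k m y = ((k ^ n * exp (k * y) + (- k) ^ n * exp (- k * y)) / 2
    - (m ^ n * exp (m * y) + (- m) ^ n * exp (- m * y)) / 2) / (k\<^sup>2 - m\<^sup>2)"

definition sfun :: "nat \<Rightarrow> complex \<Rightarrow> complex \<Rightarrow> complex \<Rightarrow> complex"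
  where "sfun n k m y = ((k ^ n * exp (k * y) - (- k) ^ n * exp (- k * y)) / (2 * k)
    - (m ^ n * exp (m * y) - (- m) ^ n * exp (- m * y)) / (2 * m)) / (k\<^sup>2 - m\<^sup>2)"

lemma sfun_Suc:
  assumes "k \<noteq> 0" "m \<noteq> 0"
  shows "sfun (Suc n) k m y = cfun n k m y"
  using assms by (simp add: sfun_def cfun_def add_divide_distrib diff_divide_distrib)

text \<open>The combination that vanishes to first order at \<open>y = 0\<close> and carries no tangential stress at \<open>y = l\<close>.\<close>

definition wcoeff1 :: "complex \<Rightarrow> complex \<Rightarrow> complex \<Rightarrow> complex"
  where "wcoeff1 k m l = sfun 2 k m l + k\<^sup>2 * sfun 0 k m l"

definition wcoeff2 :: "complex \<Rightarrow> complex \<Rightarrow> complex \<Rightarrow> complex"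
  where "wcoeff2 k m l = - (cfun 2 k m l + k\<^sup>2 * cfun 0 k m l)"

definition wfun :: "nat \<Rightarrow> complex \<Rightarrow> complex \<Rightarrow> complex \<Rightarrow> complex \<Rightarrow> complex"
  where "wfun n k m l y = wcoeff1 k m l * cfun n k m y + wcoeff2 k m l * sfun n k m y"

lemma wfun_bottom:
  assumes "k \<noteq> 0" "m \<noteq> 0"
  shows "wfun 0 k m l 0 = 0" "wfun 1 k m l 0 = 0"
  using assms by (simp_all add: wfun_def sfun_Suc[OF assms, of 0, simplified]) (simp_all add: cfun_def sfun_def)

text \<open>The two coefficients are chosen as cofactors, so the terms cancel in pairs. The
  expression is, up to the factor 2 pi i \<xi>_j, the tangential stress of the mode at the
  surface.\<close>

lemma wfun_top: "wfun 2 k m l l + k\<^sup>2 * wfun 0 k m l l = 0"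
  by (simp add: wfun_def wcoeff1_def wcoeff2_def algebra_simps)

lemma cfun_minus [simp]: "cfun n k (- m) y = cfun n k m y"
  by (simp add: cfun_def add.commute)

lemma sfun_minus [simp]: "sfun n k (- m) y = sfun n k m y"
proof -
  have "(a - b) / (2 * - m) = (b - a) / (2 * m)" for a b
    by (metis minus_diff_eq minus_divide_divide mult_minus_right)
  then show ?thesis
    by (simp add: sfun_def)
qed

lemma cnj_cfun: "cnj (cfun n k m y) = cfun n (cnj k) (cnj m) (cnj y)"
  by (simp add: cfun_def exp_cnj)

lemma cnj_sfun: "cnj (sfun n k m y) = sfun n (cnj k) (cnj m) (cnj y)"
  by (simp add: sfun_def exp_cnj)

text \<open>Conjugation fixes m or changes its sign, and the fundamental solutions are even in
  m.\<close>

lemma wfun_real: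
  "wfun n (of_real k) (of_real k * rt s) (of_real l) (of_real y) \<in> \<real>"
proof -
  have "cnj (wfun n (of_real k) (of_real k * rt s) (of_real l) (of_real y)) =
      wfun n (of_real k) (of_real k * rt s) (of_real l) (of_real y)"
    by (simp add: wfun_def wcoeff1_def wcoeff2_def cnj_cfun cnj_sfun cnj_rt)
  then show ?thesis
    by (simp add: Reals_cnj_iff)
qed

section \<open>Limits at small frequency\<close>

lemma exp_remainder_tendsto:
  "((\<lambda>z::complex. (exp z - 1 - z - z\<^sup>2 / 2 - z ^ 3 / 6) / z ^ 3) \<longlongrightarrow> 0) (at 0)"
proof (rule Lim_null_comparison)
  show "\<forall>\<^sub>F z::complex in at 0. norm ((exp z - 1 - z - z\<^sup>2 / 2 - z ^ 3 / 6) / z ^ 3) \<le> exp \<bar>Re z\<bar> * norm z / 6"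
  proof (rule eventually_mono[OF eventually_neq_at_within[of 0]])
    fix z :: complex assume z: "z \<noteq> 0"
    have "(\<Sum>i\<le>3. z ^ i / fact i) = 1 + z + z\<^sup>2 / 2 + z ^ 3 / 6"
      by (simp add: numeral_eq_Suc)
    then have "norm (exp z - 1 - z - z\<^sup>2 / 2 - z ^ 3 / 6) \<le> exp \<bar>Re z\<bar> * norm z ^ Suc 3 / fact 3"
      using Taylor_exp[of z 3] by (simp add: algebra_simps)
    also have "\<dots> = (exp \<bar>Re z\<bar> * norm z / 6) * norm z ^ 3"
      by (simp add: fact_numeral eval_nat_numeral)
    finally show "norm ((exp z - 1 - z - z\<^sup>2 / 2 - z ^ 3 / 6) / z ^ 3) \<le> exp \<bar>Re z\<bar> * norm z / 6"
      using z by (simp only: norm_divide norm_power divide_le_eq) simp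
  qed
  show "((\<lambda>z::complex. exp \<bar>Re z\<bar> * norm z / 6) \<longlongrightarrow> 0) (at 0)"
    by (rule tendsto_eq_intros refl | simp)+
qed

text \<open>These quotients carry the removable singularities of the fundamental solutions. Writing
  exp z as its cubic Taylor polynomial plus z^3 r(z) with r tending to 0, the odd and even parts
  give all three limits.\<close>

lemma
  shows sinh_cubic_tendsto: "((\<lambda>z::complex. (sinh z - z) / z ^ 3) \<longlongrightarrow> 1 / 6) (at 0)"
    and cosh_quadratic_tendsto: "((\<lambda>z::complex. (cosh z - 1) / z\<^sup>2) \<longlongrightarrow> 1 / 2) (at 0)"
    and sinh_linear_tendsto: "((\<lambda>z::complex. sinh z / z) \<longlongrightarrow> 1) (at 0)"
proof -
  define r where "r z = (exp z - 1 - z - z\<^sup>2 / 2 - z ^ 3 / 6) / z ^ 3" for z :: complex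
  have r: "(r \<longlongrightarrow> 0) (at 0)"
    unfolding r_def by (rule exp_remainder_tendsto)
  have "filterlim (\<lambda>z::complex. - z) (at 0) (at 0)"
    by (auto simp: filterlim_at intro!: tendsto_eq_intros eventually_mono[OF eventually_neq_at_within[of 0]])
  then have r': "((\<lambda>z. r (- z)) \<longlongrightarrow> 0) (at 0)"
    by (rule filterlim_compose[OF r])
  have exp_eq: "exp z = 1 + z + z\<^sup>2 / 2 + z ^ 3 / 6 + z ^ 3 * r z" if "z \<noteq> 0" for z
    using that by (simp add: r_def)
  have eq: "exp z = 1 + z + z\<^sup>2 / 2 + z ^ 3 / 6 + z ^ 3 * r z"
    "exp (- z) = 1 - z + z\<^sup>2 / 2 - z ^ 3 / 6 - z ^ 3 * r (- z)" if "z \<noteq> 0" for z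
    using that exp_eq[of z] exp_eq[of "- z"] by simp_all
  have "((\<lambda>z. 1 / 6 + (r z + r (- z)) / 2) \<longlongrightarrow> 1 / 6) (at 0)"
    by (rule tendsto_eq_intros refl r r' | simp)+
  then show 3: "((\<lambda>z::complex. (sinh z - z) / z ^ 3) \<longlongrightarrow> 1 / 6) (at 0)"
  proof (rule Lim_transform_eventually)
    show "\<forall>\<^sub>F z in at 0. 1 / 6 + (r z + r (- z)) / 2 = (sinh z - z) / z ^ 3"
      by (rule eventually_mono[OF eventually_neq_at_within[of 0]])
         (simp add: sinh_field_def eq field_simps)
  qed
  have "((\<lambda>z. 1 / 2 + z * (r z - r (- z)) / 2) \<longlongrightarrow> 1 / 2) (at 0)"
    by (rule tendsto_eq_intros refl r r' | simp)+
  then show "((\<lambda>z::complex. (cosh z - 1) / z\<^sup>2) \<longlongrightarrow> 1 / 2) (at 0)"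
  proof (rule Lim_transform_eventually)
    show "\<forall>\<^sub>F z in at 0. 1 / 2 + z * (r z - r (- z)) / 2 = (cosh z - 1) / z\<^sup>2"
      by (rule eventually_mono[OF eventually_neq_at_within[of 0]])
         (simp add: cosh_field_def eq field_simps power2_eq_square power3_eq_cube)
  qed
  have "((\<lambda>z::complex. 1 + z\<^sup>2 * ((sinh z - z) / z ^ 3)) \<longlongrightarrow> 1) (at 0)"
    by (rule tendsto_eq_intros refl 3 | simp)+
  then show "((\<lambda>z::complex. sinh z / z) \<longlongrightarrow> 1) (at 0)"
  proof (rule Lim_transform_eventually)
    show "\<forall>\<^sub>F z::complex in at 0. 1 + z\<^sup>2 * ((sinh z - z) / z ^ 3) = sinh z / z"
      by (rule eventually_mono[OF eventually_neq_at_within[of 0]])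
         (simp add: field_simps power2_eq_square power3_eq_cube)
  qed
qed

text \<open>The weights 1 / s and - (1 - s) / s add up to 1, so two functions with the common limit
  a combine to the limit a even when s does not converge. Keeping s in \<open>{p..q}\<close> with p
  > 0 bounds the weights.\<close>

lemma tendsto_weighted_difference:
  fixes f g :: "'a \<Rightarrow> complex"
  assumes f: "(f \<longlongrightarrow> a) F" and g: "(g \<longlongrightarrow> a) F"
    and s: "\<forall>\<^sub>F x in F. s x \<in> {p..q}" and p: "p > 0"
  shows "((\<lambda>x. (f x - of_real (1 - s x) * g x) / of_real (s x)) \<longlongrightarrow> a) F"
proof (rule Lim_transform)
  show "((\<lambda>x. (f x - of_real (1 - s x) * g x) / of_real (s x) - a) \<longlongrightarrow> 0) F"
  proof (rule Lim_null_comparison)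
    show "\<forall>\<^sub>F x in F. norm ((f x - of_real (1 - s x) * g x) / of_real (s x) - a)
        \<le> (norm (f x - a) + (1 + q) * norm (g x - a)) / p"
      using s
    proof eventually_elim
      case (elim x)
      have "(f x - of_real (1 - s x) * g x) / of_real (s x) - a =
          ((f x - a) - of_real (1 - s x) * (g x - a)) / of_real (s x)"
      proof -
        have S: "of_real (s x) \<noteq> (0::complex)"
          using elim p by auto
        have "f x - of_real (1 - s x) * g x - of_real (s x) * a = (f x - a) - of_real (1 - s x) * (g x - a)"
          by (simp add: algebra_simps)
        then show ?thesis
          using S by (metis diff_divide_distrib nonzero_mult_div_cancel_left)
      qed
      then have "norm ((f x - of_real (1 - s x) * g x) / of_real (s x) - a) =
          norm ((f x - a) - of_real (1 - s x) * (g x - a)) / s x"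
        using elim p by (simp add: norm_divide)
      also have "\<dots> \<le> (norm (f x - a) + \<bar>1 - s x\<bar> * norm (g x - a)) / s x"
      proof (rule divide_right_mono)
        show "norm ((f x - a) - of_real (1 - s x) * (g x - a)) \<le> norm (f x - a) + \<bar>1 - s x\<bar> * norm (g x - a)"
          using norm_triangle_ineq4[of "f x - a" "of_real (1 - s x) * (g x - a)"] unfolding norm_mult norm_of_real .
        show "0 \<le> s x"
          using elim p by simp
      qed
      also have "\<dots> \<le> (norm (f x - a) + (1 + q) * norm (g x - a)) / p"
      proof (rule frac_le)
        have "\<bar>1 - s x\<bar> \<le> 1 + q"
          using elim p by auto
        then show "norm (f x - a) + \<bar>1 - s x\<bar> * norm (g x - a) \<le> norm (f x - a) + (1 + q) * norm (g x - a)"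
          by (intro add_left_mono mult_right_mono) auto
        show "0 \<le> norm (f x - a) + (1 + q) * norm (g x - a)"
          using elim p by simp
      qed (use elim p in auto)
      finally show ?case .
    qed
    have "((\<lambda>x. (norm (f x - a) + (1 + q) * norm (g x - a)) / p) \<longlongrightarrow> (norm (a - a) + (1 + q) * norm (a - a)) / p) F"
      using p by (intro tendsto_intros f g) auto
    then show "((\<lambda>x. (norm (f x - a) + (1 + q) * norm (g x - a)) / p) \<longlongrightarrow> 0) F"
      by simp
  qed
  show "((\<lambda>x. a) \<longlongrightarrow> a) F"
    by simp
qed

text \<open>With m = k r the denominator k^2 - m^2 equals k^2 (1 - r^2). Cancelling powers of k
  turns \<open>cfun\<close> and \<open>sfun\<close> into weighted differences of quotients such as
  sinh z / z, with r^2 in the role of 1 - s.\<close>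

context
  fixes k r l :: complex
  assumes nz: "k \<noteq> 0" "r \<noteq> 0" "l \<noteq> 0" "1 - r\<^sup>2 \<noteq> 0"
begin

lemma cfun_0_eq: "cfun 0 k (k * r) l =
  l\<^sup>2 * (((cosh (k * l) - 1) / (k * l)\<^sup>2 - r\<^sup>2 * ((cosh (k * r * l) - 1) / (k * r * l)\<^sup>2)) / (1 - r\<^sup>2))"
proof -
  have "k\<^sup>2 - (k * r)\<^sup>2 = k\<^sup>2 * (1 - r\<^sup>2)"
    by (simp add: algebra_simps power_mult_distrib)
  then show ?thesis
    using nz by (simp add: cfun_def cosh_field_def power_mult_distrib diff_divide_distrib[symmetric])
qed

lemma cfun_1_eq: "cfun 1 k (k * r) l =
  l * ((sinh (k * l) / (k * l) - r\<^sup>2 * (sinh (k * r * l) / (k * r * l))) / (1 - r\<^sup>2))"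
proof -
  define A where "A = sinh (k * l)"
  define B where "B = sinh (k * r * l)"
  define R where "R = 1 - r\<^sup>2"
  have d: "k\<^sup>2 - (k * r)\<^sup>2 = k\<^sup>2 * R"
    by (simp add: R_def algebra_simps power_mult_distrib)
  have "cfun 1 k (k * r) l = (k * A - k * r * B) / (k\<^sup>2 - (k * r)\<^sup>2)"
    by (simp add: A_def B_def cfun_def sinh_field_def diff_divide_distrib right_diff_distrib)
  also have "\<dots> = (k * (A - r * B)) / (k * (k * R))"
    unfolding d by (simp add: right_diff_distrib power2_eq_square mult.assoc)
  finally have 1: "cfun 1 k (k * r) l = (A - r * B) / (k * R)"
    using nz by simp
  have "r\<^sup>2 * (B / (k * r * l)) = r * B / (k * l)"
    using nz by (simp add: power2_eq_square)
  then have "A / (k * l) - r\<^sup>2 * (B / (k * r * l)) = (A - r * B) / (k * l)"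
    by (simp add: diff_divide_distrib)
  then show ?thesis
    unfolding A_def[symmetric] B_def[symmetric] R_def[symmetric]
    unfolding 1 using nz by simp
qed

lemma cfun_2_eq: "cfun 2 k (k * r) l = (cosh (k * l) - r\<^sup>2 * cosh (k * r * l)) / (1 - r\<^sup>2)"
proof -
  define A where "A = cosh (k * l)"
  define B where "B = cosh (k * r * l)"
  define R where "R = 1 - r\<^sup>2"
  have d: "k\<^sup>2 - (k * r)\<^sup>2 = k\<^sup>2 * R"
    by (simp add: R_def algebra_simps power_mult_distrib)
  have "cfun 2 k (k * r) l = (k\<^sup>2 * A - (k * r)\<^sup>2 * B) / (k\<^sup>2 - (k * r)\<^sup>2)"
    by (simp add: A_def B_def cfun_def cosh_field_def diff_divide_distrib add_divide_distrib distrib_left)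
  also have "\<dots> = (k\<^sup>2 * (A - r\<^sup>2 * B)) / (k\<^sup>2 * R)"
    unfolding d by (simp add: right_diff_distrib power_mult_distrib mult.assoc)
  finally show ?thesis
    unfolding A_def[symmetric] B_def[symmetric] R_def[symmetric] using nz by simp
qed

text \<open>Subtracting k^2 times the numerator of \<open>cfun 1\<close> leaves a multiple of the
  denominator. In the resulting form every term carries a factor k^2, so the limit 0 is
  visible.\<close>

lemma cfun_3_eq: "cfun 3 k (k * r) l = k\<^sup>2 * cfun 1 k (k * r) l + (k * r)\<^sup>2 * l * (sinh (k * r * l) / (k * r * l))"
proof -
  have d: "k\<^sup>2 - (k * r)\<^sup>2 \<noteq> 0"
    using nz by (simp add: power_mult_distrib)
  have "(k * r)\<^sup>2 * l * (sinh (k * r * l) / (k * r * l)) = k * r * sinh (k * r * l)"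
    using nz by (simp add: power2_eq_square)
  moreover have "k ^ 3 * sinh (k * l) - (k * r) ^ 3 * sinh (k * r * l) =
      k\<^sup>2 * (k * sinh (k * l) - k * r * sinh (k * r * l)) + (k\<^sup>2 - (k * r)\<^sup>2) * (k * r * sinh (k * r * l))"
    by (simp add: algebra_simps power2_eq_square power3_eq_cube)
  moreover have "cfun 3 k (k * r) l = (k ^ 3 * sinh (k * l) - (k * r) ^ 3 * sinh (k * r * l)) / (k\<^sup>2 - (k * r)\<^sup>2)"
    "cfun 1 k (k * r) l = (k * sinh (k * l) - k * r * sinh (k * r * l)) / (k\<^sup>2 - (k * r)\<^sup>2)"
    by (simp_all add: cfun_def sinh_field_def diff_divide_distrib right_diff_distrib)
  ultimately show ?thesis
    using d by (simp add: add_divide_distrib)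
qed

lemma sfun_0_eq: "sfun 0 k (k * r) l =
  l ^ 3 * (((sinh (k * l) - k * l) / (k * l) ^ 3 - r\<^sup>2 * ((sinh (k * r * l) - k * r * l) / (k * r * l) ^ 3)) / (1 - r\<^sup>2))"
proof -
  have d: "k\<^sup>2 - (k * r)\<^sup>2 = k\<^sup>2 * (1 - r\<^sup>2)"
    by (simp add: algebra_simps power_mult_distrib)
  define A where "A = sinh (k * l)"
  define B where "B = sinh (k * r * l)"
  define R where "R = 1 - r\<^sup>2"
  have R: "R \<noteq> 0"
    using nz by (simp add: R_def)
  have 1: "sfun 0 k (k * r) l = (A / k - B / (k * r)) / (k\<^sup>2 * R)"
    unfolding d[folded R_def, symmetric] by (simp add: A_def B_def sfun_def sinh_field_def)
  have "A / k - B / (k * r) = (A - B / r) / k"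
    by (simp add: diff_divide_distrib mult.commute)
  then have "sfun 0 k (k * r) l = (A - B / r) / (k ^ 3 * R)"
    unfolding 1 by (simp add: power2_eq_square power3_eq_cube)
  \<comment> \<open>The linear terms of the two hyperbolic sines cancel, so k l may be subtracted
    from both to form the cubic quotients.\<close>
  moreover have "(A - k * l) / (k * l) ^ 3 - (B / r - k * l) / (k * l) ^ 3 = (A - B / r) / (k * l) ^ 3"
    by (simp add: diff_divide_distrib[symmetric])
  moreover have "r\<^sup>2 * ((B - k * r * l) / (k * r * l) ^ 3) = (B / r - k * l) / (k * l) ^ 3"
  proof -
    have "B - k * r * l = r * (B / r - k * l)" "(k * r * l) ^ 3 = r ^ 3 * (k * l) ^ 3"
      using nz by (simp_all add: right_diff_distrib power_mult_distrib)
    then show ?thesis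
      using nz(2) by (simp add: power2_eq_square power3_eq_cube)
  qed
  ultimately show ?thesis
    unfolding A_def[symmetric] B_def[symmetric] R_def[symmetric]
    using nz by (simp add: power_mult_distrib)
qed

end

text \<open>The normal stress p - 2 d_N u_N at the surface for the mode with p = w''' - m^2 w' and
  u_N = k^2 w.\<close>

definition traction :: "complex \<Rightarrow> complex \<Rightarrow> complex \<Rightarrow> complex"
  where "traction k m l = wfun 3 k m l l - (m\<^sup>2 + 2 * k\<^sup>2) * wfun 1 k m l l"

text \<open>The filter and the function s are general for two uses: a product with
  \<open>principal {p..q}\<close> makes the limit uniform in s, and a constant s gives the limit as
  (k, \<mu>) tends to (0, g).\<close>

lemma
  fixes k s :: "'a \<Rightarrow> real" and l p q :: real
  assumes k: "(k \<longlongrightarrow> 0) F" "\<forall>\<^sub>F x in F. k x \<noteq> 0"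
    and s: "\<forall>\<^sub>F x in F. s x \<in> {p..q}" and p: "p > 0" "1 \<notin> {p..q}" and l: "l > 0"
  shows wfun_top_tendsto: "((\<lambda>x. wfun 0 (of_real (k x)) (of_real (k x) * rt (s x)) (of_real l) (of_real l))
      \<longlongrightarrow> of_real (l ^ 3 / 3)) F" (is ?thesis1)
    and traction_tendsto: "((\<lambda>x. traction (of_real (k x)) (of_real (k x) * rt (s x)) (of_real l)) \<longlongrightarrow> - 1) F"
      (is ?thesis2)
proof -
  define K where "K x = complex_of_real (k x)" for x
  define r where "r x = rt (s x)" for x
  define L where "L = complex_of_real l"
  have L: "L \<noteq> 0"
    using l by (simp add: L_def)
  have r2: "(r x)\<^sup>2 = of_real (1 - s x)" "1 - (r x)\<^sup>2 = of_real (s x)" for x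
    by (simp_all add: r_def)
  have nz: "\<forall>\<^sub>F x in F. K x \<noteq> 0 \<and> r x \<noteq> 0 \<and> L \<noteq> 0 \<and> 1 - (r x)\<^sup>2 \<noteq> 0"
    using k(2) s
  proof eventually_elim
    case (elim x)
    then show ?case
      using p L unfolding r2 by (auto simp: K_def r_def)
  qed
  have K0: "(K \<longlongrightarrow> 0) F"
    using tendsto_of_real[OF k(1)] by (simp add: K_def[abs_def])
  \<comment> \<open>\<open>rt\<close> is bounded on the range of s, so m tends to 0 with k although
    s need not converge.\<close>
  have Kr0: "((\<lambda>x. K x * r x) \<longlongrightarrow> 0) F"
  proof (rule Lim_null_comparison)
    show "\<forall>\<^sub>F x in F. norm (K x * r x) \<le> norm (K x) * sqrt (1 + q)"
      using s
    proof eventually_elim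
      case (elim x)
      have "(norm (r x))\<^sup>2 = \<bar>1 - s x\<bar>"
        unfolding norm_power[symmetric] r2 by (simp only: norm_of_real)
      then have "(norm (r x))\<^sup>2 \<le> 1 + q"
        using elim p by auto
      then have "norm (r x) \<le> sqrt (1 + q)"
        by (rule real_le_rsqrt)
      then show ?case
        by (simp add: norm_mult mult_left_mono)
    qed
    show "((\<lambda>x. norm (K x) * sqrt (1 + q)) \<longlongrightarrow> 0) F"
      using tendsto_mult_left_zero[OF tendsto_norm_zero[OF K0]] .
  qed
  have kl: "filterlim (\<lambda>x. K x * L) (at 0) F"
    unfolding filterlim_at
    using tendsto_mult_left_zero[OF K0, of L] eventually_mono[OF nz] by auto
  have krl: "filterlim (\<lambda>x. K x * r x * L) (at 0) F"
    unfolding filterlim_at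
    using tendsto_mult_left_zero[OF Kr0, of L] eventually_mono[OF nz] by auto
  note weighted = tendsto_weighted_difference[OF _ _ s p(1), folded r2]
  note kl_comp = filterlim_compose[OF _ kl] and krl_comp = filterlim_compose[OF _ krl]
  have cosh_lim: "((\<lambda>x. cosh (K x * L)) \<longlongrightarrow> 1) F" "((\<lambda>x. cosh (K x * r x * L)) \<longlongrightarrow> 1) F"
    using isCont_tendsto_compose[OF isCont_cosh tendsto_mult_left_zero[OF K0, of L]]
      isCont_tendsto_compose[OF isCont_cosh tendsto_mult_left_zero[OF Kr0, of L]] by simp_all
  have c0: "((\<lambda>x. cfun 0 (K x) (K x * r x) L) \<longlongrightarrow> L\<^sup>2 * (1 / 2)) F"
    by (rule Lim_transform_eventually[OF tendsto_mult[OF tendsto_const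
            weighted[OF kl_comp[OF cosh_quadratic_tendsto] krl_comp[OF cosh_quadratic_tendsto]]]])
       (use nz in \<open>rule eventually_mono, simp only: cfun_0_eq simp_thms\<close>)
  have c1: "((\<lambda>x. cfun 1 (K x) (K x * r x) L) \<longlongrightarrow> L * 1) F"
    by (rule Lim_transform_eventually[OF tendsto_mult[OF tendsto_const
            weighted[OF kl_comp[OF sinh_linear_tendsto] krl_comp[OF sinh_linear_tendsto]]]])
       (use nz in \<open>rule eventually_mono, simp only: cfun_1_eq simp_thms\<close>)
  have c2: "((\<lambda>x. cfun 2 (K x) (K x * r x) L) \<longlongrightarrow> 1) F"
    by (rule Lim_transform_eventually[OF weighted[OF cosh_lim]])
       (use nz in \<open>rule eventually_mono, simp only: cfun_2_eq simp_thms\<close>)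
  have s0: "((\<lambda>x. sfun 0 (K x) (K x * r x) L) \<longlongrightarrow> L ^ 3 * (1 / 6)) F"
    by (rule Lim_transform_eventually[OF tendsto_mult[OF tendsto_const
            weighted[OF kl_comp[OF sinh_cubic_tendsto] krl_comp[OF sinh_cubic_tendsto]]]])
       (use nz in \<open>rule eventually_mono, simp only: sfun_0_eq simp_thms\<close>)
  have "((\<lambda>x. (K x)\<^sup>2 * cfun 1 (K x) (K x * r x) L + (K x * r x)\<^sup>2 * L * (sinh (K x * r x * L) / (K x * r x * L)))
      \<longlongrightarrow> 0\<^sup>2 * (L * 1) + 0\<^sup>2 * L * 1) F"
    by (intro tendsto_intros K0 Kr0 c1 krl_comp[OF sinh_linear_tendsto])
  then have c3: "((\<lambda>x. cfun 3 (K x) (K x * r x) L) \<longlongrightarrow> 0) F"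
    by (rule Lim_transform_eventually[THEN tendsto_eq_rhs])
       (use nz in \<open>rule eventually_mono, simp only: cfun_3_eq simp_thms\<close>, simp)
  have s_Suc: "((\<lambda>x. sfun (Suc n) (K x) (K x * r x) L) \<longlongrightarrow> a) F"
    if "((\<lambda>x. cfun n (K x) (K x * r x) L) \<longlongrightarrow> a) F" for n a
    by (rule Lim_transform_eventually[OF that])
       (use nz in \<open>rule eventually_mono, simp add: sfun_Suc\<close>)
  note s1 = s_Suc[OF c0, folded One_nat_def] and s2 = s_Suc[OF c1, unfolded Suc_1]
    and s3 = s_Suc[OF c2, simplified eval_nat_numeral(3)[symmetric]]
  have "((\<lambda>x. wcoeff1 (K x) (K x * r x) L) \<longlongrightarrow> L * 1 + 0\<^sup>2 * (L ^ 3 * (1 / 6))) F"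
    unfolding wcoeff1_def by (intro tendsto_intros s2 s0 K0)
  then have w1: "((\<lambda>x. wcoeff1 (K x) (K x * r x) L) \<longlongrightarrow> L) F"
    by simp
  have "((\<lambda>x. wcoeff2 (K x) (K x * r x) L) \<longlongrightarrow> - (1 + 0\<^sup>2 * (L\<^sup>2 * (1 / 2)))) F"
    unfolding wcoeff2_def by (intro tendsto_intros c2 c0 K0)
  then have w2: "((\<lambda>x. wcoeff2 (K x) (K x * r x) L) \<longlongrightarrow> - 1) F"
    by simp
  have "((\<lambda>x. wfun 0 (K x) (K x * r x) L L) \<longlongrightarrow> L * (L\<^sup>2 * (1 / 2)) + - 1 * (L ^ 3 * (1 / 6))) F"
    unfolding wfun_def by (intro tendsto_intros w1 w2 c0 s0)
  moreover have "L * (L\<^sup>2 * (1 / 2)) + - 1 * (L ^ 3 * (1 / 6)) = of_real (l ^ 3 / 3)"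
    by (simp add: L_def power2_eq_square power3_eq_cube)
  ultimately show ?thesis1
    unfolding K_def r_def L_def by metis
  have "((\<lambda>x. traction (K x) (K x * r x) L) \<longlongrightarrow> (L * 0 + - 1 * 1) -
      (0\<^sup>2 + 2 * 0\<^sup>2) * (L * (L * 1) + - 1 * (L\<^sup>2 * (1 / 2)))) F"
    unfolding traction_def wfun_def by (intro tendsto_intros w1 w2 c1 c3 s1 s3 K0 Kr0)
  then show ?thesis2
    unfolding K_def r_def L_def by simp
qed

text \<open>
  The symbol of the normal stress balance on the surface for \<open>\<lambda> = - s k\<^sup>2\<close>; a zero \<open>s\<close> gives an
  exponentially decaying mode.
\<close>

definition dispersion :: "real \<Rightarrow> real \<Rightarrow> real \<Rightarrow> real \<Rightarrow> real"
  where "dispersion l k s \<mu> =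
    s * Re (traction (of_real k) (of_real k * rt s) (of_real l)) +
    \<mu> * Re (wfun 0 (of_real k) (of_real k * rt s) (of_real l) (of_real l))"

text \<open>In the limit the dispersion function is - s + g l^3 / 3, which is positive to the left
  of its root and negative to the right; the signs at p and q persist for small k and \<mu> near
  g.\<close>

lemma dispersion_sign:
  fixes l g :: real
  assumes l: "l > 0" and g: "g > 0" "g \<noteq> 3 / l ^ 3"
  obtains p q d where "0 < p" "p < q" "1 \<notin> {p..q}" "0 < d"
    "\<And>k s. 0 < k \<Longrightarrow> k < d \<Longrightarrow> s \<in> {p..q} \<Longrightarrow>
      wfun 0 (of_real k) (of_real k * rt s) (of_real l) (of_real l) \<noteq> 0"
    "\<And>k \<mu>. 0 < k \<Longrightarrow> k < d \<Longrightarrow> \<bar>\<mu> - g\<bar> < d \<Longrightarrow> dispersion l k p \<mu> > 0"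
    "\<And>k \<mu>. 0 < k \<Longrightarrow> k < d \<Longrightarrow> \<bar>\<mu> - g\<bar> < d \<Longrightarrow> dispersion l k q \<mu> < 0"
proof -
  \<comment> \<open>This is the limiting root; \<open>g \<noteq> 3 / l ^ 3\<close> is the statement
    that it is not 1.\<close>
  define a where "a = g * l ^ 3 / 3"
  have a: "a > 0" "a \<noteq> 1"
    using l g by (auto simp: a_def divide_simps)
  \<comment> \<open>On the side facing 1 the interval ends at the midpoint between a and 1.\<close>
  obtain p q where pq: "0 < p" "p < a" "a < q" "1 \<notin> {p..q}"
  proof (cases "a < 1")
    case True
    then show ?thesis
      using that[of "a / 2" "(1 + a) / 2"] a by auto
  next
    case False
    then show ?thesis
      using that[of "(1 + a) / 2" "a + 1"] a by auto
  qed
  \<comment> \<open>The principal filter in the second factor makes the nonvanishing hold for all s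
    in \<open>{p..q}\<close> with one bound on k.\<close>
  define F where "F = (at_right (0::real)) \<times>\<^sub>F principal {p..q}"
  have Fk: "(fst \<longlongrightarrow> 0) F" "\<forall>\<^sub>F x in F. fst x \<noteq> 0" and Fs: "\<forall>\<^sub>F x in F. snd x \<in> {p..q}"
  proof -
    have "filterlim fst (at_right (0::real)) F"
      unfolding F_def by (rule filterlim_fst)
    then show "(fst \<longlongrightarrow> 0) F" "\<forall>\<^sub>F x in F. fst x \<noteq> 0"
      by (auto simp: filterlim_at elim: eventually_mono)
    have "filterlim snd (principal {p..q}) F"
      unfolding F_def by (rule filterlim_snd)
    then show "\<forall>\<^sub>F x in F. snd x \<in> {p..q}"
      by (simp add: filterlim_principal)
  qed
  define w where "w k s = wfun 0 (of_real k) (of_real k * rt s) (of_real l) (of_real l)" for k s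
  have "((\<lambda>x. w (fst x) (snd x)) \<longlongrightarrow> of_real (l ^ 3 / 3)) F"
    unfolding w_def by (rule wfun_top_tendsto[OF Fk Fs pq(1,4) l])
  then have "\<forall>\<^sub>F x in F. w (fst x) (snd x) \<noteq> 0"
    by (rule tendsto_imp_eventually_ne) (use l in simp)
  then obtain P where P: "\<forall>\<^sub>F k in at_right 0. P k" and Pw: "\<And>k s. P k \<Longrightarrow> s \<in> {p..q} \<Longrightarrow> w k s \<noteq> 0"
    unfolding F_def eventually_prod_filter by (auto simp: eventually_principal)
  have lim: "((\<lambda>x. dispersion l (fst x) s (snd x)) \<longlongrightarrow> s * Re (- 1) + g * Re (of_real (l ^ 3 / 3)))
      (at_right 0 \<times>\<^sub>F nhds g)" if s: "s \<in> {p..q}" for s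
  proof -
    have k: "(fst \<longlongrightarrow> 0) (at_right (0::real) \<times>\<^sub>F nhds g)" "\<forall>\<^sub>F x in at_right (0::real) \<times>\<^sub>F nhds g. fst x \<noteq> 0"
      using filterlim_fst[of "at_right (0::real)" "nhds g"]
      by (auto simp: filterlim_at elim: eventually_mono)
    have g: "(snd \<longlongrightarrow> g) (at_right (0::real) \<times>\<^sub>F nhds g)"
      by (rule filterlim_snd)
    have s': "\<forall>\<^sub>F x in at_right (0::real) \<times>\<^sub>F nhds g. (\<lambda>_. s) x \<in> {p..q}"
      using s by simp
    show ?thesis
      unfolding dispersion_def
      by (intro tendsto_intros g traction_tendsto[OF k s' pq(1,4) l] wfun_top_tendsto[OF k s' pq(1,4) l])
  qed
  have ex: "\<exists>d>0. \<forall>k \<mu>. 0 < k \<longrightarrow> k < d \<longrightarrow> \<bar>\<mu> - g\<bar> < d \<longrightarrow> Q k \<mu>"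
    if Q: "\<forall>\<^sub>F x in at_right (0::real) \<times>\<^sub>F nhds g. Q (fst x) (snd x)" for Q
  proof -
    obtain A B where A: "\<forall>\<^sub>F k in at_right 0. A k" and B: "\<forall>\<^sub>F \<mu> in nhds g. B \<mu>"
      and AB: "\<And>k \<mu>. A k \<Longrightarrow> B \<mu> \<Longrightarrow> Q k \<mu>"
      using Q unfolding eventually_prod_filter by auto
    obtain d1 where d1: "d1 > 0" "\<And>k. 0 < k \<Longrightarrow> k < d1 \<Longrightarrow> A k"
      using A unfolding eventually_at_right_field by auto
    obtain d2 where d2: "d2 > 0" "\<And>\<mu>. \<bar>\<mu> - g\<bar> < d2 \<Longrightarrow> B \<mu>"
      using B unfolding eventually_nhds_metric dist_real_def by auto
    show ?thesis
      using d1 d2 AB by (intro exI[of _ "min d1 d2"]) auto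
  qed
  have "\<forall>\<^sub>F x in at_right (0::real) \<times>\<^sub>F nhds g. dispersion l (fst x) p (snd x) > 0"
    by (rule order_tendstoD(1)[OF lim]) (use pq in \<open>auto simp: a_def\<close>)
  from ex[OF this] obtain d1 where d1: "d1 > 0"
    "\<And>k \<mu>. 0 < k \<Longrightarrow> k < d1 \<Longrightarrow> \<bar>\<mu> - g\<bar> < d1 \<Longrightarrow> dispersion l k p \<mu> > 0" by blast
  have "\<forall>\<^sub>F x in at_right (0::real) \<times>\<^sub>F nhds g. dispersion l (fst x) q (snd x) < 0"
    by (rule order_tendstoD(2)[OF lim]) (use pq in \<open>auto simp: a_def\<close>)
  from ex[OF this] obtain d2 where d2: "d2 > 0"
    "\<And>k \<mu>. 0 < k \<Longrightarrow> k < d2 \<Longrightarrow> \<bar>\<mu> - g\<bar> < d2 \<Longrightarrow> dispersion l k q \<mu> < 0" by blast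
  obtain d3 where d3: "d3 > 0" "\<And>k. 0 < k \<Longrightarrow> k < d3 \<Longrightarrow> P k"
    using P unfolding eventually_at_right_field by auto
  show thesis
    by (rule that[of p q "min d1 (min d2 d3)"]) (use pq d1 d2 d3 Pw in \<open>auto simp: w_def\<close>)
qed

text \<open>At s = 0 the denominator k^2 - m^2 vanishes, at s = 1 the root m does; elsewhere the
  explicit formula is continuous.\<close>

lemma wfun_continuous_in_s:
  assumes "k \<noteq> 0" "0 \<notin> A" "1 \<notin> A"
  shows "continuous_on A (\<lambda>s. wfun n (of_real k) (of_real k * rt s) l y)"
  unfolding wfun_def wcoeff1_def wcoeff2_def cfun_def sfun_def
  using assms by (intro continuous_intros continuous_rt) (auto simp: power_mult_distrib)

lemma dispersion_continuous:
  assumes "k \<noteq> 0" "0 \<notin> A" "1 \<notin> A"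
  shows "continuous_on A (\<lambda>s. dispersion l k s \<mu>)"
  unfolding dispersion_def traction_def
  by (intro continuous_intros wfun_continuous_in_s assms continuous_rt)

lemma rt_measurable [measurable]: "rt \<in> borel_measurable borel"
  by (intro borel_measurable_continuous_onI continuous_rt)

lemma wfun_measurable [measurable]:
  assumes [measurable]: "k \<in> borel_measurable M" "m \<in> borel_measurable M"
  shows "(\<lambda>x. wfun n (k x) (m x) l y) \<in> borel_measurable M"
  unfolding wfun_def wcoeff1_def wcoeff2_def cfun_def sfun_def by measurable

lemma dispersion_measurable [measurable]:
  assumes [measurable]: "k \<in> borel_measurable M" "\<mu> \<in> borel_measurable M"
  shows "(\<lambda>x. dispersion l (k x) s (\<mu> x)) \<in> borel_measurable M"
  unfolding dispersion_def traction_def by measurable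

section \<open>Superposition of exponentials\<close>

lemma integrable_lebesgue_bounded_cball:
  fixes F :: "'a::euclidean_space \<Rightarrow> 'b::{banach, second_countable_topology}"
  assumes "F \<in> borel_measurable lebesgue" "\<And>x. norm (F x) \<le> B" "\<And>x. norm x > R \<Longrightarrow> F x = 0"
  shows "integrable lebesgue F"
proof (rule integrableI_bounded_set)
  show "emeasure lebesgue (cball (0::'a) R) < \<infinity>"
    using emeasure_bounded_finite[OF bounded_cball, of "0::'a" R] by simp
  show "AE x in lebesgue. x \<in> cball 0 R \<longrightarrow> norm (F x) \<le> B"
    using assms by auto
  show "AE x in lebesgue. x \<notin> cball 0 R \<longrightarrow> F x = 0"
    using assms(3) by auto
qed (use assms in auto)

lemma norm_exp_minus_linear_le:
  fixes z :: complex
  shows "norm (exp z - 1 - z) \<le> exp (norm z) * (norm z)\<^sup>2"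
  using Taylor_exp_field[of z 1] by (simp add: power2_eq_square algebra_simps)

text \<open>The amplitude lives on a ball where \<theta> is bounded, so the second-order Taylor
  bound for exp integrates to an error of size s^2. Leaving the multiplier \<theta> free covers
  derivatives in t, x and y together.\<close>

lemma exp_integral_has_vector_derivative:
  fixes c \<theta> :: "'a::euclidean_space \<Rightarrow> complex"
  assumes [measurable]: "c \<in> borel_measurable lebesgue" "\<theta> \<in> borel_measurable lebesgue"
    and B: "\<And>\<xi>. norm (c \<xi>) \<le> B" and R: "\<And>\<xi>. norm \<xi> > R \<Longrightarrow> c \<xi> = 0"
    and A: "\<And>\<xi>. norm \<xi> \<le> R \<Longrightarrow> norm (\<theta> \<xi>) \<le> A"
  shows "((\<lambda>s. LINT \<xi>|lebesgue. c \<xi> * exp (of_real s * \<theta> \<xi>)) has_vector_derivative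
    (LINT \<xi>|lebesgue. c \<xi> * \<theta> \<xi>)) (at 0 within S)"
proof -
  have B0: "B \<ge> 0"
    using order_trans[OF norm_ge_zero B] .
  \<comment> \<open>One majorant for all integrands of the form c \<theta>^n f(norm \<theta>) with f
    nonnegative and increasing: the amplitude itself, its derivative and the Taylor
    remainder.\<close>
  have A': "norm (c \<xi>) * norm (\<theta> \<xi>) ^ n * f (norm (\<theta> \<xi>)) \<le> (if norm \<xi> \<le> R then B * \<bar>A\<bar> ^ n * f \<bar>A\<bar> else 0)"
    if f: "\<And>x y. 0 \<le> x \<Longrightarrow> x \<le> y \<Longrightarrow> 0 \<le> f x \<and> f x \<le> f y" for \<xi> n and f :: "real \<Rightarrow> real"
  proof (cases "norm \<xi> \<le> R")
    case True
    then have "norm (\<theta> \<xi>) \<le> \<bar>A\<bar>"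
      using A[of \<xi>] by linarith
    then show ?thesis
      using True B[of \<xi>] B0 f[of "norm (\<theta> \<xi>)" "\<bar>A\<bar>"] by (simp add: mult_mono power_mono)
  qed (use R in auto)
  define W where "W \<xi> = (if norm \<xi> \<le> R then B * \<bar>A\<bar>\<^sup>2 * exp \<bar>A\<bar> else 0)" for \<xi> :: 'a
  have [measurable]: "(\<lambda>\<xi>::'a. norm \<xi> \<le> R) \<in> measurable lebesgue (count_space UNIV)"
    by (intro measurable_completion) measurable
  have W_int: "integrable lebesgue W"
    unfolding W_def
    by (rule integrable_lebesgue_bounded_cball[where B = "B * \<bar>A\<bar>\<^sup>2 * exp \<bar>A\<bar>" and R = R]) (use B0 in auto)
  have int: "integrable lebesgue (\<lambda>\<xi>. c \<xi> * exp (of_real s * \<theta> \<xi>))" for s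
  proof (rule integrable_lebesgue_bounded_cball[where B = "B * exp (\<bar>s\<bar> * \<bar>A\<bar>)" and R = R])
    show "norm (c \<xi> * exp (of_real s * \<theta> \<xi>)) \<le> B * exp (\<bar>s\<bar> * \<bar>A\<bar>)" for \<xi>
    proof -
      have "norm (c \<xi> * exp (of_real s * \<theta> \<xi>)) \<le> norm (c \<xi>) * norm (\<theta> \<xi>) ^ 0 * exp (\<bar>s\<bar> * norm (\<theta> \<xi>))"
        using norm_exp[of "of_real s * \<theta> \<xi>"] by (simp add: norm_mult mult_left_mono)
      also have "\<dots> \<le> (if norm \<xi> \<le> R then B * \<bar>A\<bar> ^ 0 * exp (\<bar>s\<bar> * \<bar>A\<bar>) else 0)"
        by (rule A'[where f = "\<lambda>x. exp (\<bar>s\<bar> * x)"]) (auto intro: mult_left_mono)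
      also have "\<dots> \<le> B * exp (\<bar>s\<bar> * \<bar>A\<bar>)"
        using B0 by simp
      finally show ?thesis .
    qed
    show "c \<xi> * exp (of_real s * \<theta> \<xi>) = 0" if "R < norm \<xi>" for \<xi>
      using R[OF that] by simp
  qed measurable
  have int': "integrable lebesgue (\<lambda>\<xi>. c \<xi> * \<theta> \<xi>)"
  proof (rule integrable_lebesgue_bounded_cball[where B = "B * \<bar>A\<bar>" and R = R])
    show "norm (c \<xi> * \<theta> \<xi>) \<le> B * \<bar>A\<bar>" for \<xi>
    proof -
      have "norm (c \<xi>) * norm (\<theta> \<xi>) ^ 1 * 1 \<le> (if norm \<xi> \<le> R then B * \<bar>A\<bar> ^ 1 * 1 else 0)"
        by (rule A'[where f = "\<lambda>_. 1"]) simp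
      also have "\<dots> \<le> B * \<bar>A\<bar>"
        using B0 by simp
      finally show ?thesis
        by (simp add: norm_mult)
    qed
    show "c \<xi> * \<theta> \<xi> = 0" if "R < norm \<xi>" for \<xi>
      using R[OF that] by simp
  qed measurable
  define E where "E s = (LINT \<xi>|lebesgue. c \<xi> * exp (of_real s * \<theta> \<xi>))" for s
  define D where "D = (LINT \<xi>|lebesgue. c \<xi> * \<theta> \<xi>)"
  define M where "M = (LINT \<xi>|lebesgue. W \<xi>)"
  \<comment> \<open>For \<open>\<bar>s\<bar> \<le> 1\<close> the exponential in the remainder is
    bounded independently of s.\<close>
  have bound: "norm (E s - E 0 - s *\<^sub>R D) \<le> s\<^sup>2 * M" if s: "s \<noteq> 0" "\<bar>s\<bar> \<le> 1" for s
  proof -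
    have pt: "(c \<xi> * exp (of_real s * \<theta> \<xi>) - c \<xi> * exp (of_real 0 * \<theta> \<xi>)) - s *\<^sub>R (c \<xi> * \<theta> \<xi>) =
        c \<xi> * (exp (of_real s * \<theta> \<xi>) - 1 - of_real s * \<theta> \<xi>)" for \<xi>
      by (simp add: scaleR_conv_of_real algebra_simps)
    have "(E s - E 0) - s *\<^sub>R D = (LINT \<xi>|lebesgue. c \<xi> * (exp (of_real s * \<theta> \<xi>) - 1 - of_real s * \<theta> \<xi>))"
    proof -
      have "(E s - E 0) - s *\<^sub>R D = (LINT \<xi>|lebesgue. (c \<xi> * exp (of_real s * \<theta> \<xi>) - c \<xi> * exp (of_real 0 * \<theta> \<xi>)) -
          s *\<^sub>R (c \<xi> * \<theta> \<xi>))"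
        unfolding E_def D_def using int[of s] int[of 0] int' by simp
      then show ?thesis
        by (simp only: pt)
    qed
    also have "norm \<dots> \<le> (LINT \<xi>|lebesgue. s\<^sup>2 * W \<xi>)"
    proof (rule Bochner_Integration.integral_norm_bound_integral)
      show "integrable lebesgue (\<lambda>\<xi>. s\<^sup>2 * W \<xi>)"
        using W_int by simp
      have "integrable lebesgue (\<lambda>\<xi>. (c \<xi> * exp (of_real s * \<theta> \<xi>) - c \<xi> * exp (of_real 0 * \<theta> \<xi>)) -
          s *\<^sub>R (c \<xi> * \<theta> \<xi>))"
        using int[of s] int[of 0] int' by simp
      then show "integrable lebesgue (\<lambda>\<xi>. c \<xi> * (exp (of_real s * \<theta> \<xi>) - 1 - of_real s * \<theta> \<xi>))"
        by (simp only: pt)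
      show "norm (c \<xi> * (exp (of_real s * \<theta> \<xi>) - 1 - of_real s * \<theta> \<xi>)) \<le> s\<^sup>2 * W \<xi>" for \<xi>
      proof -
        have "norm (exp (of_real s * \<theta> \<xi>) - 1 - of_real s * \<theta> \<xi>) \<le> exp (\<bar>s\<bar> * norm (\<theta> \<xi>)) * (\<bar>s\<bar> * norm (\<theta> \<xi>))\<^sup>2"
          using norm_exp_minus_linear_le[of "of_real s * \<theta> \<xi>"] by (simp add: norm_mult)
        also have "\<dots> \<le> exp (1 * norm (\<theta> \<xi>)) * (\<bar>s\<bar> * norm (\<theta> \<xi>))\<^sup>2"
          using s by (intro mult_right_mono) (simp_all add: mult_left_le_one_le)
        finally have "norm (c \<xi> * (exp (of_real s * \<theta> \<xi>) - 1 - of_real s * \<theta> \<xi>)) \<le>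
            norm (c \<xi>) * (exp (norm (\<theta> \<xi>)) * (\<bar>s\<bar> * norm (\<theta> \<xi>))\<^sup>2)"
          by (simp add: norm_mult mult_left_mono)
        also have "\<dots> = s\<^sup>2 * (norm (c \<xi>) * norm (\<theta> \<xi>) ^ 2 * exp (norm (\<theta> \<xi>)))"
          by (simp add: power_mult_distrib)
        also have "\<dots> \<le> s\<^sup>2 * W \<xi>"
          unfolding W_def by (rule mult_left_mono[OF A'[where f = exp and n = 2]]) auto
        finally show ?thesis .
      qed
    qed
    finally have "norm ((E s - E 0) - s *\<^sub>R D) \<le> s\<^sup>2 * M"
      by (simp add: M_def)
    then show ?thesis .
  qed
  have "(E has_vector_derivative D) (at 0)"
    unfolding has_vector_derivative_def
  proof (rule has_derivativeI[OF bounded_linear_scaleR_left], rule Lim_null_comparison)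
    show "\<forall>\<^sub>F s in at 0. norm ((E s - E 0 - (s - 0) *\<^sub>R D) /\<^sub>R norm (s - 0)) \<le> \<bar>s\<bar> * M"
      unfolding eventually_at
    proof (rule exI[of _ 1], intro conjI ballI impI)
      fix s :: real
      assume s: "s \<noteq> 0 \<and> dist s 0 < 1"
      have eq: "s\<^sup>2 * M = \<bar>s\<bar> * M * \<bar>s\<bar>"
        by (simp add: power2_eq_square)
      have "norm (E s - E 0 - s *\<^sub>R D) \<le> s\<^sup>2 * M"
        using bound[of s] s by (simp add: dist_real_def)
      then have "norm (E s - E 0 - s *\<^sub>R D) \<le> \<bar>s\<bar> * M * \<bar>s\<bar>"
        unfolding eq .
      then show "norm ((E s - E 0 - (s - 0) *\<^sub>R D) /\<^sub>R norm (s - 0)) \<le> \<bar>s\<bar> * M"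
        using s by (simp add: divide_le_eq divide_inverse[symmetric] mult.commute[of "inverse \<bar>s\<bar>"])
    qed simp
    show "((\<lambda>s. \<bar>s\<bar> * M) \<longlongrightarrow> 0) (at (0::real))"
      by (rule tendsto_eq_intros refl | simp)+
  qed
  then show ?thesis
    unfolding E_def D_def by (rule has_vector_derivative_at_within)
qed

lemma lebesgue_measurableI:
  "f \<in> borel_measurable borel \<Longrightarrow> f \<in> borel_measurable lebesgue"
  by (rule measurable_completion) simp

text \<open>\<open>\<rho> n\<close> are the vertical exponents and \<omega> is the real growth rate
  shared by all of them at a given frequency. A is one bound for everything on the ball of radius R,
  which will carry the amplitudes.\<close>

locale wave_packet =
  fixes \<rho> :: "nat \<Rightarrow> real ^ 'm::finite \<Rightarrow> complex" and \<omega> :: "real ^ 'm \<Rightarrow> real" and R A :: real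
  assumes \<rho>_measurable [measurable]: "\<rho> n \<in> borel_measurable lebesgue"
    and \<omega>_measurable [measurable]: "\<omega> \<in> borel_measurable lebesgue"
    and \<rho>_bound: "norm \<xi> \<le> R \<Longrightarrow> norm (\<rho> n \<xi>) \<le> A"
    and \<omega>_bound: "norm \<xi> \<le> R \<Longrightarrow> \<bar>\<omega> \<xi>\<bar> \<le> A"
begin

definition phase :: "nat \<Rightarrow> real \<Rightarrow> 'm point \<Rightarrow> real ^ 'm \<Rightarrow> complex"
  where "phase n t z \<xi> = \<rho> n \<xi> * of_real (snd z) + of_real (\<omega> \<xi> * t) + \<i> * of_real (2 * pi * (\<xi> \<bullet> fst z))"

definition wave :: "nat \<Rightarrow> (real ^ 'm \<Rightarrow> complex) \<Rightarrow> real \<Rightarrow> 'm point \<Rightarrow> complex"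
  where "wave n c t z = (LINT \<xi>|lebesgue. c \<xi> * exp (phase n t z \<xi>))"

text \<open>Four exponentials per frequency, because the equation for the vertical profile has order
  four.\<close>

definition field :: "(nat \<Rightarrow> real ^ 'm \<Rightarrow> complex) \<Rightarrow> real \<Rightarrow> 'm point \<Rightarrow> complex"
  where "field b t z = (\<Sum>n<4. wave n (b n) t z)"

definition profile :: "(nat \<Rightarrow> real ^ 'm \<Rightarrow> complex) \<Rightarrow> real \<Rightarrow> real ^ 'm \<Rightarrow> complex"
  where "profile b y \<xi> = (\<Sum>n<4. b n \<xi> * exp (\<rho> n \<xi> * of_real y))"

text \<open>The class is stable under the multipliers of d_t, d_x and d_y, so every derivative of a
  field is a field again.\<close>

definition admissible :: "(real ^ 'm \<Rightarrow> complex) \<Rightarrow> bool"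
  where "admissible c \<longleftrightarrow> c \<in> borel_measurable lebesgue \<and> (\<exists>B. \<forall>\<xi>. norm (c \<xi>) \<le> B) \<and>
    (\<forall>\<xi>. norm \<xi> > R \<longrightarrow> c \<xi> = 0)"

text \<open>The factor brought down from the n-th exponential by differentiating in direction
  i.\<close>

definition dmult :: "'m option \<Rightarrow> nat \<Rightarrow> real ^ 'm \<Rightarrow> complex"
  where "dmult i n \<xi> = (case i of None \<Rightarrow> \<rho> n \<xi> | Some j \<Rightarrow> 2 * pi * \<i> * of_real (\<xi> $ j))"

lemma admissibleD:
  assumes "admissible c"
  obtains B where "c \<in> borel_measurable lebesgue" "B \<ge> 0" "\<And>\<xi>. norm (c \<xi>) \<le> B" "\<And>\<xi>. norm \<xi> > R \<Longrightarrow> c \<xi> = 0"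
proof -
  obtain B where B: "c \<in> borel_measurable lebesgue" "\<And>\<xi>. norm (c \<xi>) \<le> B" "\<And>\<xi>. norm \<xi> > R \<Longrightarrow> c \<xi> = 0"
    using assms unfolding admissible_def by blast
  show thesis
    by (rule that[OF B(1) order_trans[OF norm_ge_zero B(2)] B(2,3)])
qed

lemma admissible_mult:
  assumes c: "admissible c" and [measurable]: "g \<in> borel_measurable lebesgue"
    and g: "\<And>\<xi>. norm \<xi> \<le> R \<Longrightarrow> norm (g \<xi>) \<le> C"
  shows "admissible (\<lambda>\<xi>. g \<xi> * c \<xi>)"
proof -
  obtain B where [measurable]: "c \<in> borel_measurable lebesgue" and B: "B \<ge> 0" "\<And>\<xi>. norm (c \<xi>) \<le> B"
    "\<And>\<xi>. norm \<xi> > R \<Longrightarrow> c \<xi> = 0"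
    using c by (elim admissibleD) blast
  have "norm (g \<xi> * c \<xi>) \<le> \<bar>C\<bar> * B" for \<xi>
  proof (cases "norm \<xi> \<le> R")
    case True
    then show ?thesis
      using g[OF True] B by (auto simp: norm_mult intro!: mult_mono)
  qed (use B in auto)
  moreover have "(\<lambda>\<xi>. g \<xi> * c \<xi>) \<in> borel_measurable lebesgue"
    by measurable
  ultimately show ?thesis
    unfolding admissible_def using B(3) by (metis mult_zero_right)
qed

lemma admissible_add:
  assumes "admissible c" "admissible d"
  shows "admissible (\<lambda>\<xi>. c \<xi> + d \<xi>)"
proof -
  obtain B1 where 1: "c \<in> borel_measurable lebesgue" "\<And>\<xi>. norm (c \<xi>) \<le> B1" "\<And>\<xi>. norm \<xi> > R \<Longrightarrow> c \<xi> = 0"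
    using assms(1) by (elim admissibleD) blast
  obtain B2 where 2: "d \<in> borel_measurable lebesgue" "\<And>\<xi>. norm (d \<xi>) \<le> B2" "\<And>\<xi>. norm \<xi> > R \<Longrightarrow> d \<xi> = 0"
    using assms(2) by (elim admissibleD) blast
  have "norm (c \<xi> + d \<xi>) \<le> B1 + B2" for \<xi>
    using 1(2) 2(2) by (intro order_trans[OF norm_triangle_ineq] add_mono)
  moreover have "(\<lambda>\<xi>. c \<xi> + d \<xi>) \<in> borel_measurable lebesgue"
    using 1(1) 2(1) by (rule borel_measurable_add)
  ultimately show ?thesis
    unfolding admissible_def using 1(3) 2(3) by (metis add_0)
qed

lemma admissible_0 [simp]: "admissible (\<lambda>\<xi>. 0)"
  by (auto simp: admissible_def)

lemma admissible_sum:
  assumes "\<And>i. i \<in> I \<Longrightarrow> admissible (c i)"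
  shows "admissible (\<lambda>\<xi>. \<Sum>i\<in>I. c i \<xi>)"
  using assms by (induction I rule: infinite_finite_induct) (auto intro: admissible_add)

lemma component_measurable [measurable]: "(\<lambda>\<xi>::real ^ 'm. \<xi> $ j) \<in> borel_measurable lebesgue"
  by (intro lebesgue_measurableI borel_measurable_continuous_onI continuous_intros)

lemma inner_measurable [measurable]: "(\<lambda>\<xi>::real ^ 'm. \<xi> \<bullet> x) \<in> borel_measurable lebesgue"
  by (intro lebesgue_measurableI borel_measurable_continuous_onI continuous_intros)

lemma phase_measurable [measurable]: "phase n t z \<in> borel_measurable lebesgue"
  unfolding phase_def[abs_def] by measurable

lemma dmult_measurable [measurable]: "dmult i n \<in> borel_measurable lebesgue"
  unfolding dmult_def[abs_def] by (cases i) (simp_all, measurable)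

lemma dmult_bound:
  assumes "norm \<xi> \<le> R"
  shows "norm (dmult i n \<xi>) \<le> \<bar>A\<bar> + 2 * pi * R"
proof (cases i)
  case None
  have "0 \<le> 2 * pi * R"
    using order_trans[OF norm_ge_zero assms] by simp
  moreover have "norm (dmult i n \<xi>) \<le> A"
    using \<rho>_bound[OF assms] None by (simp add: dmult_def)
  ultimately show ?thesis
    by linarith
next
  case (Some j)
  then have "norm (dmult i n \<xi>) = 2 * pi * \<bar>\<xi> $ j\<bar>"
    by (simp add: dmult_def norm_mult)
  also have "\<dots> \<le> 2 * pi * R"
    using component_le_norm_cart[of \<xi> j] assms by (intro mult_left_mono) auto
  finally show ?thesis by simp
qed

lemma admissible_dmult: "admissible c \<Longrightarrow> admissible (\<lambda>\<xi>. dmult i n \<xi> * c \<xi>)"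
  by (rule admissible_mult[OF _ dmult_measurable dmult_bound])

lemma admissible_\<omega>: "admissible c \<Longrightarrow> admissible (\<lambda>\<xi>. of_real (\<omega> \<xi>) * c \<xi>)"
  using \<omega>_bound by (intro admissible_mult[where C = A]) auto

lemma norm_exp_phase_le:
  assumes "norm \<xi> \<le> R"
  shows "norm (exp (phase n t z \<xi>)) \<le> exp (\<bar>A\<bar> * (\<bar>snd z\<bar> + \<bar>t\<bar>))"
proof -
  have "Re (phase n t z \<xi>) = Re (\<rho> n \<xi>) * snd z + \<omega> \<xi> * t"
    by (simp add: phase_def)
  also have "\<dots> \<le> \<bar>Re (\<rho> n \<xi>)\<bar> * \<bar>snd z\<bar> + \<bar>\<omega> \<xi>\<bar> * \<bar>t\<bar>"
    using abs_ge_self[of "Re (\<rho> n \<xi>) * snd z"] abs_ge_self[of "\<omega> \<xi> * t"]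
    unfolding abs_mult by (rule add_mono)
  also have "\<dots> \<le> \<bar>A\<bar> * \<bar>snd z\<bar> + \<bar>A\<bar> * \<bar>t\<bar>"
    using \<rho>_bound[OF assms, of n] \<omega>_bound[OF assms] abs_Re_le_cmod[of "\<rho> n \<xi>"]
    by (intro add_mono mult_right_mono) auto
  finally show ?thesis
    by (simp add: distrib_left)
qed

lemma admissible_exp_phase:
  "admissible c \<Longrightarrow> admissible (\<lambda>\<xi>. exp (phase n t z \<xi>) * c \<xi>)"
  by (rule admissible_mult[where g = "\<lambda>\<xi>. exp (phase n t z \<xi>)", OF _ _ norm_exp_phase_le], assumption, measurable)

lemma admissible_integrable: "admissible c \<Longrightarrow> integrable lebesgue c"
  by (elim admissibleD) (rule integrable_lebesgue_bounded_cball)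

lemma wave_integrable: "admissible c \<Longrightarrow> integrable lebesgue (\<lambda>\<xi>. c \<xi> * exp (phase n t z \<xi>))"
  using admissible_integrable[OF admissible_exp_phase, of c n t z] by (simp add: mult.commute)

text \<open>Along a straight line in t, x or y the phase is affine in the parameter, and its slope
  \<theta> becomes a multiplier of the amplitude.\<close>

lemma wave_derivative:
  assumes c: "admissible c" and [measurable]: "\<theta> \<in> borel_measurable lebesgue"
    and A: "\<And>\<xi>. norm \<xi> \<le> R \<Longrightarrow> norm (\<theta> \<xi>) \<le> C"
    and eq: "\<And>s \<xi>. phase n (T s) (Z s) \<xi> = phase n t z \<xi> + of_real s * \<theta> \<xi>"
  shows "((\<lambda>s. wave n c (T s) (Z s)) has_vector_derivative wave n (\<lambda>\<xi>. \<theta> \<xi> * c \<xi>) t z) (at 0 within S)"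
proof -
  define d where "d \<xi> = exp (phase n t z \<xi>) * c \<xi>" for \<xi>
  have "admissible d"
    unfolding d_def[abs_def] by (rule admissible_exp_phase[OF c])
  then obtain B where d: "d \<in> borel_measurable lebesgue" "\<And>\<xi>. norm (d \<xi>) \<le> B" "\<And>\<xi>. norm \<xi> > R \<Longrightarrow> d \<xi> = 0"
    by (elim admissibleD) blast
  have 1: "wave n c (T s) (Z s) = (LINT \<xi>|lebesgue. d \<xi> * exp (of_real s * \<theta> \<xi>))" for s
    unfolding wave_def eq[of s] exp_add d_def
    by (intro Bochner_Integration.integral_cong refl) (simp only: mult_ac)
  have 2: "wave n (\<lambda>\<xi>. \<theta> \<xi> * c \<xi>) t z = (LINT \<xi>|lebesgue. d \<xi> * \<theta> \<xi>)"
    unfolding wave_def d_def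
    by (intro Bochner_Integration.integral_cong refl) (simp only: mult_ac)
  show ?thesis
    unfolding 1 2 by (rule exp_integral_has_vector_derivative[OF d(1) assms(2) d(2,3) A])
qed

text \<open>A convergent sequence of points is bounded, which bounds the exponentials on the ball
  and supplies the majorant for dominated convergence.\<close>

lemma wave_continuous:
  assumes c: "admissible c"
  shows "continuous_on S (\<lambda>(t, z). wave n c t z)"
  unfolding continuous_on_sequentially
proof (intro allI ballI impI, elim conjE)
  fix X :: "nat \<Rightarrow> real \<times> 'm point" and x
  assume lim: "X \<longlonglongrightarrow> x"
  obtain B where [measurable]: "c \<in> borel_measurable lebesgue" and B: "B \<ge> 0" "\<And>\<xi>. norm (c \<xi>) \<le> B"
    "\<And>\<xi>. norm \<xi> > R \<Longrightarrow> c \<xi> = 0"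
    using c by (elim admissibleD) blast
  have "Bseq X"
    by (rule convergent_imp_Bseq[OF convergentI[OF lim]])
  then obtain M where M: "\<And>k. norm (X k) \<le> M"
    unfolding Bseq_def by auto
  define W where "W = B * exp (\<bar>A\<bar> * (M + M))"
  have [measurable]: "(\<lambda>\<xi>::real ^ 'm. norm \<xi> \<le> R) \<in> measurable lebesgue (count_space UNIV)"
    by (intro measurable_completion) measurable
  show "((\<lambda>(t, z). wave n c t z) \<circ> X) \<longlonglongrightarrow> (case x of (t, z) \<Rightarrow> wave n c t z)"
    unfolding comp_def split_beta wave_def
  proof (rule integral_dominated_convergence[where w = "\<lambda>\<xi>. if norm \<xi> \<le> R then W else 0"])
    show "integrable lebesgue (\<lambda>\<xi>::real ^ 'm. if norm \<xi> \<le> R then W else 0)"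
      by (rule integrable_lebesgue_bounded_cball[where B = "\<bar>W\<bar>" and R = R]) auto
    show "AE \<xi> in lebesgue. (\<lambda>k. c \<xi> * exp (phase n (fst (X k)) (snd (X k)) \<xi>))
        \<longlonglongrightarrow> c \<xi> * exp (phase n (fst x) (snd x) \<xi>)"
      unfolding phase_def by (intro AE_I2 tendsto_intros lim)
    show "AE \<xi> in lebesgue. norm (c \<xi> * exp (phase n (fst (X k)) (snd (X k)) \<xi>)) \<le> (if norm \<xi> \<le> R then W else 0)" for k
    proof (intro AE_I2)
      fix \<xi> :: "real ^ 'm"
      show "norm (c \<xi> * exp (phase n (fst (X k)) (snd (X k)) \<xi>)) \<le> (if norm \<xi> \<le> R then W else 0)"
      proof (cases "norm \<xi> \<le> R")
        case True
        have "\<bar>fst (X k)\<bar> \<le> M" "\<bar>snd (snd (X k))\<bar> \<le> M"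
          using M[of k] norm_fst_le[of "fst (X k)" "snd (X k)"] norm_snd_le[of "snd (X k)" "fst (X k)"]
            norm_snd_le[of "snd (snd (X k))" "fst (snd (X k))"] by auto
        then have "exp (\<bar>A\<bar> * (\<bar>snd (snd (X k))\<bar> + \<bar>fst (X k)\<bar>)) \<le> exp (\<bar>A\<bar> * (M + M))"
          by (simp add: mult_left_mono)
        then show ?thesis
          using True B norm_exp_phase_le[OF True, of n "fst (X k)" "snd (X k)"]
          by (auto simp: W_def norm_mult intro!: mult_mono)
      qed (use B in auto)
    qed
  qed measurable
qed

lemma field_continuous:
  assumes "\<And>n. admissible (b n)"
  shows "continuous_on S (\<lambda>(t, z). field b t z)"
  unfolding field_def split_beta
  by (intro continuous_on_sum wave_continuous[unfolded split_beta] assms)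

lemma field_edir_derivative:
  assumes "\<And>n. admissible (b n)"
  shows "((\<lambda>s. field b t (z + s *\<^sub>R edir i)) has_vector_derivative field (\<lambda>n \<xi>. dmult i n \<xi> * b n \<xi>) t z) (at 0 within S)"
  unfolding field_def
proof (rule has_vector_derivative_sum)
  have 1: "phase n t (z + s *\<^sub>R edir i) \<xi> = phase n t z \<xi> + of_real s * dmult i n \<xi>" for n s \<xi>
    by (cases i) (simp_all add: phase_def dmult_def algebra_simps inner_add_right inner_axis)
  show "((\<lambda>s. wave n (b n) t (z + s *\<^sub>R edir i)) has_vector_derivative
      wave n (\<lambda>\<xi>. dmult i n \<xi> * b n \<xi>) t z) (at 0 within S)" for n
    by (rule wave_derivative[where T = "\<lambda>_. t" and Z = "\<lambda>s. z + s *\<^sub>R edir i",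
          OF assms dmult_measurable dmult_bound 1])
qed

lemma field_time_derivative:
  assumes "\<And>n. admissible (b n)"
  shows "((\<lambda>s. field b s z) has_vector_derivative field (\<lambda>n \<xi>. of_real (\<omega> \<xi>) * b n \<xi>) t z) (at t within S)"
proof -
  have "((\<lambda>s. field b (t + s) z) has_vector_derivative field (\<lambda>n \<xi>. of_real (\<omega> \<xi>) * b n \<xi>) t z) (at 0)"
    unfolding field_def
  proof (rule has_vector_derivative_sum)
    have 1: "phase n (t + s) z \<xi> = phase n t z \<xi> + of_real s * of_real (\<omega> \<xi>)" for n s \<xi>
      by (simp add: phase_def algebra_simps)
    have 2: "norm (complex_of_real (\<omega> \<xi>)) \<le> A" if "norm \<xi> \<le> R" for \<xi>
      using \<omega>_bound[OF that] by simp
    have 3: "(\<lambda>\<xi>. complex_of_real (\<omega> \<xi>)) \<in> borel_measurable lebesgue"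
      by measurable
    show "((\<lambda>s. wave n (b n) (t + s) z) has_vector_derivative wave n (\<lambda>\<xi>. of_real (\<omega> \<xi>) * b n \<xi>) t z) (at 0)" for n
      by (rule wave_derivative[where T = "\<lambda>s. t + s" and Z = "\<lambda>_. z", OF assms 3 2 1])
  qed
  \<comment> \<open>The derivative was computed at parameter 0 and is transported to time t by a
    shift.\<close>
  moreover have "((\<lambda>s. s - t) has_vector_derivative 1) (at t)"
    by (rule derivative_eq_intros refl | simp)+
  ultimately have "((\<lambda>s. field b (t + s) z) \<circ> (\<lambda>s. s - t) has_vector_derivative
      1 *\<^sub>R field (\<lambda>n \<xi>. of_real (\<omega> \<xi>) * b n \<xi>) t z) (at t)"
    by (intro vector_diff_chain_at) simp_all
  then show ?thesis
    by (simp add: comp_def has_vector_derivative_at_within)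
qed


lemma wave_add:
  assumes "admissible c" "admissible d"
  shows "wave n (\<lambda>\<xi>. c \<xi> + d \<xi>) t z = wave n c t z + wave n d t z"
  unfolding wave_def by (simp add: distrib_right wave_integrable assms)

lemma wave_sum:
  assumes "\<And>i. i \<in> I \<Longrightarrow> admissible (c i)"
  shows "wave n (\<lambda>\<xi>. \<Sum>i\<in>I. c i \<xi>) t z = (\<Sum>i\<in>I. wave n (c i) t z)"
  unfolding wave_def by (simp add: sum_distrib_right wave_integrable assms)

lemma field_add:
  assumes "\<And>n. admissible (b n)" "\<And>n. admissible (c n)"
  shows "field (\<lambda>n \<xi>. b n \<xi> + c n \<xi>) t z = field b t z + field c t z"
  unfolding field_def by (simp add: wave_add assms sum.distrib)

lemma field_sum:
  assumes "\<And>i n. admissible (b i n)"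
  shows "field (\<lambda>n \<xi>. \<Sum>i\<in>I. b i n \<xi>) t z = (\<Sum>i\<in>I. field (b i) t z)"
  unfolding field_def by (simp add: wave_sum assms sum.swap[of _ I])

lemma field_cong: "(\<And>n \<xi>. b n \<xi> = c n \<xi>) \<Longrightarrow> field b t z = field c t z"
  by (rule arg_cong[where f = "\<lambda>b. field b t z"]) blast

text \<open>Isolating the factor that depends on x exhibits the remaining integrand as the
  horizontal Fourier transform of the field.\<close>

lemma field_eq_profile:
  assumes "\<And>n. admissible (b n)"
  shows "field b t (x, y) =
    (LINT \<xi>|lebesgue. (profile b y \<xi> * exp (of_real (\<omega> \<xi> * t))) * cis (2 * pi * (\<xi> \<bullet> x)))"
proof -
  have "field b t (x, y) = (LINT \<xi>|lebesgue. (\<Sum>n<4. b n \<xi> * exp (phase n t (x, y) \<xi>)))"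
    unfolding field_def wave_def by (simp add: wave_integrable assms)
  also have "\<dots> = (LINT \<xi>|lebesgue. (profile b y \<xi> * exp (of_real (\<omega> \<xi> * t))) * cis (2 * pi * (\<xi> \<bullet> x)))"
    unfolding profile_def sum_distrib_right phase_def exp_add cis_conv_exp
    by (intro Bochner_Integration.integral_cong sum.cong refl) (simp only: fst_conv snd_conv mult_ac)
  finally show ?thesis .
qed

text \<open>Boundary conditions hold only after the four modes are added, so profiles are compared
  here, whereas \<open>field_cong\<close> compares mode by mode. The two heights may differ because
  the surface function is stored at height 0.\<close>

lemma field_eqI:
  assumes "\<And>n. admissible (b n)" "\<And>n. admissible (c n)"
    and "\<And>\<xi>. profile b y \<xi> = profile c y' \<xi>"
  shows "field b t (x, y) = field c t (x, y')"
  unfolding field_eq_profile[OF assms(1)] field_eq_profile[OF assms(2)] assms(3) ..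

lemma field_eq_0:
  assumes "\<And>n. admissible (b n)" "\<And>\<xi>. profile b y \<xi> = 0"
  shows "field b t (x, y) = 0"
  unfolding field_eq_profile[OF assms(1)] assms(2) by simp

lemma admissible_profile:
  assumes "\<And>n. admissible (b n)"
  shows "admissible (\<lambda>\<xi>. profile b y \<xi> * exp (of_real (\<omega> \<xi> * t)))"
proof -
  have "profile b y \<xi> * exp (of_real (\<omega> \<xi> * t)) = (\<Sum>n<4. exp (phase n t (0, y) \<xi>) * b n \<xi>)" for \<xi>
    unfolding profile_def sum_distrib_right by (intro sum.cong refl) (simp add: phase_def exp_add)
  then show ?thesis
    by (simp only:) (intro admissible_sum admissible_exp_phase assms)
qed

lemma is_fourier_field:
  assumes "\<And>n. admissible (b n)"
  shows "is_fourier (\<lambda>x. field b t (x, y)) (\<lambda>\<xi>. profile b y \<xi> * exp (of_real (\<omega> \<xi> * t)))"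
proof -
  define F where "F \<xi> = profile b y \<xi> * exp (of_real (\<omega> \<xi> * t))" for \<xi>
  have "admissible F"
    unfolding F_def[abs_def] by (rule admissible_profile[OF assms])
  then obtain B where "F \<in> borel_measurable lebesgue" "\<And>\<xi>. norm (F \<xi>) \<le> B" "\<And>\<xi>. norm \<xi> > R \<Longrightarrow> F \<xi> = 0"
    by (elim admissibleD) blast
  then have "is_fourier (\<lambda>x. LINT \<xi>|lebesgue. F \<xi> * cis (2 * pi * (\<xi> \<bullet> x))) F"
    by (rule is_fourier_synthesis)
  then show ?thesis
    unfolding field_eq_profile[OF assms] F_def .
qed

end

section \<open>Fields as classical functions on the slab, with one-sided derivatives\<close>

lemma at_within_connected_neq_bot:
  fixes S :: "real set"
  assumes "connected S" "x \<in> S" "y \<in> S" "x \<noteq> y"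
  shows "at x within S \<noteq> bot"
  using connected_imp_perfect[OF assms(1,2)] assms(2-4) by (auto simp: trivial_limit_within)

text \<open>This makes \<open>vector_derivative\<close> well determined also at the bottom and the
  top, where increments are one-sided.\<close>

lemma line_in_neq_bot:
  assumes "l > 0" "z \<in> slab l"
  shows "at 0 within line_in l i z \<noteq> bot"
proof (cases i)
  case None
  have y: "0 \<le> snd z" "snd z \<le> l"
    using assms(2) by (auto simp: slab_def)
  have eq: "line_in l i z = {- snd z .. l - snd z}"
    using None by (auto simp: line_in_def slab_def mem_Times_iff)
  show ?thesis
  proof (cases "snd z = 0")
    case True
    then show ?thesis
      unfolding eq using assms(1) by (intro at_within_connected_neq_bot[where y = l]) auto
  next
    case False
    then show ?thesis
      unfolding eq using y by (intro at_within_connected_neq_bot[where y = "- snd z"]) auto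
  qed
next
  case (Some j)
  then have "line_in l i z = UNIV"
    using assms(2) by (auto simp: line_in_def slab_def mem_Times_iff)
  then show ?thesis
    by simp
qed

context wave_packet
begin

text \<open>Agreement with a field is asked for on the slab only. This allows iteration, since a
  first derivative is itself identified with a field only there.\<close>

lemma
  assumes "l > 0" and b: "\<And>n. admissible (b n)" and eq: "\<And>w. w \<in> slab l \<Longrightarrow> f w = field b t w"
    and z: "z \<in> slab l"
  shows has_pd_field: "has_pd l i f z"
    and pd_field: "pd l i f z = field (\<lambda>n \<xi>. dmult i n \<xi> * b n \<xi>) t z"
proof -
  have "((\<lambda>s. f (z + s *\<^sub>R edir i)) has_vector_derivative field (\<lambda>n \<xi>. dmult i n \<xi> * b n \<xi>) t z)
      (at 0 within line_in l i z)"
    using z by (intro has_vector_derivative_transform[OF _ _ field_edir_derivative[OF b]])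
      (auto simp: line_in_def eq)
  then show "has_pd l i f z" "pd l i f z = field (\<lambda>n \<xi>. dmult i n \<xi> * b n \<xi>) t z"
    unfolding has_pd_def pd_def
    by (auto intro: differentiableI_vector vector_derivative_within[OF line_in_neq_bot[OF assms(1) z]])
qed

lemma cont_field_field:
  assumes b: "\<And>n. admissible (b n)" and eq: "\<And>t z. t \<ge> 0 \<Longrightarrow> z \<in> slab l \<Longrightarrow> f t z = field b t z"
  shows "cont_field l f"
  unfolding cont_field_def
  by (rule continuous_on_eq[OF field_continuous[OF b]]) (auto simp: eq)

lemma space_C1_field:
  assumes "l > 0" and b: "\<And>n. admissible (b n)"
    and eq: "\<And>t z. t \<ge> 0 \<Longrightarrow> z \<in> slab l \<Longrightarrow> f t z = field b t z"
  shows "space_C1 l f"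
  unfolding space_C1_def
proof (intro conjI allI impI ballI)
  show "cont_field l f"
    by (rule cont_field_field[OF b eq])
  show "has_pd l i (f t) z" if "t \<ge> 0" "z \<in> slab l" for i t z
    by (rule has_pd_field[OF assms(1) b eq that(2)]) (use that in auto)
  show "cont_field l (\<lambda>t. pd l i (f t))" for i
    by (rule cont_field_field[OF admissible_dmult[OF b]], rule pd_field[OF assms(1) b eq]) auto
qed

lemma space_C2_field:
  assumes "l > 0" and b: "\<And>n. admissible (b n)"
    and eq: "\<And>t z. t \<ge> 0 \<Longrightarrow> z \<in> slab l \<Longrightarrow> f t z = field b t z"
  shows "space_C2 l f"
  unfolding space_C2_def
proof (intro conjI allI)
  show "space_C1 l f"
    by (rule space_C1_field[OF assms])
  show "space_C1 l (\<lambda>t. pd l i (f t))" for i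
    by (rule space_C1_field[OF assms(1) admissible_dmult[OF b]], rule pd_field[OF assms(1) b eq]) auto
qed

lemma laplacian_field:
  assumes "l > 0" and b: "\<And>n. admissible (b n)" and z: "z \<in> slab l"
  shows "laplacian l (field b t) z = field (\<lambda>n \<xi>. (\<Sum>i\<in>UNIV. (dmult i n \<xi>)\<^sup>2) * b n \<xi>) t z"
proof -
  have "pd l i (pd l i (field b t)) z = field (\<lambda>n \<xi>. dmult i n \<xi> * (dmult i n \<xi> * b n \<xi>)) t z" for i
    by (rule pd_field[OF assms(1) admissible_dmult[OF b] _ z], rule pd_field[OF assms(1) b]) auto
  then have "laplacian l (field b t) z = field (\<lambda>n \<xi>. \<Sum>i\<in>UNIV. dmult i n \<xi> * (dmult i n \<xi> * b n \<xi>)) t z"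
    unfolding laplacian_def by (subst field_sum[OF admissible_dmult[OF admissible_dmult[OF b]]]) simp
  also have "\<dots> = field (\<lambda>n \<xi>. (\<Sum>i\<in>UNIV. (dmult i n \<xi>)\<^sup>2) * b n \<xi>) t z"
    by (rule field_cong) (simp add: sum_distrib_right power2_eq_square mult.assoc)
  finally show ?thesis .
qed

lemma dt_field:
  assumes b: "\<And>n. admissible (b n)" and t: "t \<ge> 0"
  shows "dt (\<lambda>s. field b s z) t = field (\<lambda>n \<xi>. of_real (\<omega> \<xi>) * b n \<xi>) t z"
  unfolding dt_def
  by (rule vector_derivative_within[OF at_within_connected_neq_bot[where y = "t + 1"] field_time_derivative[OF b]])
     (use t in auto)

lemma field_time_differentiable:
  assumes b: "\<And>n. admissible (b n)"
  shows "(\<lambda>s. field b s z) differentiable (at t within S)"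
  using field_time_derivative[OF b] by (rule differentiableI_vector)

lemma time_C1_field:
  assumes b: "\<And>n. admissible (b n)"
  shows "time_C1 l (field b)"
  unfolding time_C1_def
proof (intro conjI allI impI ballI field_time_differentiable b)
  show "cont_field l (field b)"
    by (rule cont_field_field[OF b refl])
  show "cont_field l (\<lambda>t z. dt (\<lambda>s. field b s z) t)"
    by (rule cont_field_field[OF admissible_\<omega>[OF b]]) (rule dt_field[OF b])
qed

lemma surface_C1_field:
  assumes b: "\<And>n. admissible (b n)"
  shows "surface_C1 (\<lambda>t x. field b t (x, y))"
  unfolding surface_C1_def
proof (intro conjI allI impI field_time_differentiable b)
  have cont: "continuous_on ({0..} \<times> UNIV) (\<lambda>(t, x). field c t (x, y))" if "\<And>n. admissible (c n)" for c
  proof -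
    have "continuous_on ({0..} \<times> UNIV) (\<lambda>p. (\<lambda>(t, z). field c t z) (fst p, (snd p, y)))"
      by (rule continuous_on_compose2[OF field_continuous[OF that, where S = UNIV]]) (auto intro!: continuous_intros)
    then show ?thesis
      by (simp add: split_beta)
  qed
  show "continuous_on ({0..} \<times> UNIV) (\<lambda>(t, x). field b t (x, y))"
    by (rule cont[OF b])
  show "continuous_on ({0..} \<times> UNIV) (\<lambda>(t, x). dt (\<lambda>s. field b s (x, y)) t)"
    by (rule continuous_on_eq[OF cont[OF admissible_\<omega>[OF b]]]) (auto simp: dt_field[OF b])
qed

end

section \<open>Hermitian symmetry and real-valued fields\<close>

lemma lebesgue_integral_uminus:
  fixes f :: "'a::euclidean_space \<Rightarrow> complex"
  assumes "f \<in> borel_measurable lebesgue"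
  shows "(LINT x|lebesgue. f (- x)) = (LINT x|lebesgue. f x)"
proof -
  have T: "(0::'a) + (\<Sum>j\<in>Basis. (- 1 * (x \<bullet> j)) *\<^sub>R j) = - x" for x
    by (simp add: sum_negf euclidean_representation)
  have "(\<Prod>j\<in>(Basis::'a set). \<bar>- 1 :: real\<bar>) = 1"
    by simp
  then have "(lebesgue :: 'a measure) = distr lebesgue lebesgue uminus"
    using lebesgue_affine_euclidean[of "\<lambda>_::'a. - 1" 0] unfolding T by (simp add: density_1)
  moreover have "uminus \<in> measurable lebesgue (lebesgue :: 'a measure)"
    using lebesgue_affine_measurable[of "\<lambda>_::'a. - 1" 0] unfolding T by simp
  ultimately show ?thesis
    using integral_distr[of uminus lebesgue lebesgue f] assms by simp
qed

text \<open>Conjugation followed by the substitution of - \<xi> for \<xi> returns the same integral.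
  The symmetry is asked for almost everywhere because \<mu> is assumed even only in that
  sense.\<close>

lemma fourier_synthesis_real:
  fixes F :: "real ^ 'm::finite \<Rightarrow> complex"
  assumes [measurable]: "F \<in> borel_measurable lebesgue"
    and sym: "AE \<xi> in lebesgue. F (- \<xi>) = cnj (F \<xi>)"
  shows "(LINT \<xi>|lebesgue. F \<xi> * cis (2 * pi * (\<xi> \<bullet> x))) \<in> \<real>"
proof -
  have [measurable]: "(\<lambda>\<xi>. cis (2 * pi * (\<xi> \<bullet> x))) \<in> borel_measurable lebesgue"
    by (intro lebesgue_measurableI) measurable
  have "cnj (LINT \<xi>|lebesgue. F \<xi> * cis (2 * pi * (\<xi> \<bullet> x))) =
      (LINT \<xi>|lebesgue. cnj (F \<xi>) * cis (2 * pi * (- \<xi> \<bullet> x)))"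
    unfolding Bochner_Integration.integral_cnj[symmetric]
    by (simp add: cis_cnj del: Bochner_Integration.integral_cnj)
  also have "\<dots> = (LINT \<xi>|lebesgue. F (- \<xi>) * cis (2 * pi * (- \<xi> \<bullet> x)))"
  proof (rule integral_cong_AE)
    have "(\<lambda>\<xi>. cis (2 * pi * (- \<xi> \<bullet> x))) \<in> borel_measurable lebesgue"
      by (intro lebesgue_measurableI) measurable
    moreover have "uminus \<in> measurable lebesgue (lebesgue :: (real ^ 'm) measure)"
      using lebesgue_affine_measurable[of "\<lambda>_::real ^ 'm. - 1" 0]
      by (simp add: sum_negf euclidean_representation)
    then have "(\<lambda>\<xi>. F (- \<xi>)) \<in> borel_measurable lebesgue"
      by (rule measurable_compose) measurable
    ultimately show "(\<lambda>\<xi>. cnj (F \<xi>) * cis (2 * pi * (- \<xi> \<bullet> x))) \<in> borel_measurable lebesgue"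
      "(\<lambda>\<xi>. F (- \<xi>) * cis (2 * pi * (- \<xi> \<bullet> x))) \<in> borel_measurable lebesgue"
      by measurable
    show "AE \<xi> in lebesgue. cnj (F \<xi>) * cis (2 * pi * (- \<xi> \<bullet> x)) = F (- \<xi>) * cis (2 * pi * (- \<xi> \<bullet> x))"
      using sym by eventually_elim simp
  qed
  also have "\<dots> = (LINT \<xi>|lebesgue. F \<xi> * cis (2 * pi * (\<xi> \<bullet> x)))"
    by (rule lebesgue_integral_uminus[where f = "\<lambda>\<xi>. F \<xi> * cis (2 * pi * (\<xi> \<bullet> x))"]) measurable
  finally show ?thesis
    by (simp add: Reals_cnj_iff)
qed

section \<open>The slowly decaying solution\<close>

lemma sum_UNIV_option: "(\<Sum>i\<in>UNIV. f i) = f None + (\<Sum>j\<in>UNIV. f (Some j))"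
  for f :: "'m::finite option \<Rightarrow> 'b::comm_monoid_add"
  by (simp add: UNIV_option_conv sum.reindex)

text \<open>The assumptions are what \<open>dispersion_sign\<close> and
  \<open>measurable_root\<close> deliver. At the origin and outside the ball \<sigma> only has to
  stay in \<open>{p..q}\<close>, since the amplitude vanishes there.\<close>

locale eigenmode =
  fixes l p q \<delta> :: real and \<mu> \<sigma> :: "real ^ 'm::finite \<Rightarrow> real"
  assumes l: "l > 0" and p: "0 < p" and q: "p < q" and ne_1: "1 \<notin> {p..q}" and \<delta>: "\<delta> > 0"
    and \<sigma>_measurable [measurable]: "\<sigma> \<in> borel_measurable lebesgue"
    and \<sigma>_range: "\<sigma> \<xi> \<in> {p..q}"
    and wfun_nonzero: "0 < norm \<xi> \<Longrightarrow> norm \<xi> < \<delta> \<Longrightarrow>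
      wfun 0 (of_real (2 * pi * norm \<xi>)) (of_real (2 * pi * norm \<xi>) * rt (\<sigma> \<xi>)) (of_real l) (of_real l) \<noteq> 0"
    and dispersion_zero: "0 < norm \<xi> \<Longrightarrow> norm \<xi> < \<delta> \<Longrightarrow> dispersion l (2 * pi * norm \<xi>) (\<sigma> \<xi>) (\<mu> \<xi>) = 0"
begin

definition k :: "real ^ 'm \<Rightarrow> complex"
  where "k \<xi> = of_real (2 * pi * norm \<xi>)"

definition m :: "real ^ 'm \<Rightarrow> complex"
  where "m \<xi> = k \<xi> * rt (\<sigma> \<xi>)"

text \<open>The roots of (X^2 - k^2) (X^2 - m^2). Indices above 3 repeat the last root, so bounds
  hold for every n.\<close>

definition \<rho> :: "nat \<Rightarrow> real ^ 'm \<Rightarrow> complex"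
  where "\<rho> n \<xi> = (if n = 0 then k \<xi> else if n = 1 then - k \<xi> else if n = 2 then m \<xi> else - m \<xi>)"

definition \<omega> :: "real ^ 'm \<Rightarrow> real"
  where "\<omega> \<xi> = - \<sigma> \<xi> * (2 * pi * norm \<xi>)\<^sup>2"

definition \<alpha> :: "real ^ 'm \<Rightarrow> complex"
  where "\<alpha> \<xi> = wcoeff1 (k \<xi>) (m \<xi>) (of_real l)"

definition \<beta> :: "real ^ 'm \<Rightarrow> complex"
  where "\<beta> \<xi> = wcoeff2 (k \<xi>) (m \<xi>) (of_real l)"

text \<open>The coordinates of \<open>wfun\<close> in the four exponentials, read off from
  \<open>cfun\<close> and \<open>sfun\<close>.\<close>

definition mode_coeff :: "nat \<Rightarrow> real ^ 'm \<Rightarrow> complex"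
  where "mode_coeff n \<xi> = (if n = 0 then \<alpha> \<xi> / 2 + \<beta> \<xi> / (2 * k \<xi>) else if n = 1 then \<alpha> \<xi> / 2 - \<beta> \<xi> / (2 * k \<xi>)
    else if n = 2 then - (\<alpha> \<xi> / 2 + \<beta> \<xi> / (2 * m \<xi>)) else - (\<alpha> \<xi> / 2 - \<beta> \<xi> / (2 * m \<xi>)))
    / ((k \<xi>)\<^sup>2 - (m \<xi>)\<^sup>2)"

text \<open>Any positive amplitude will do; this one makes the coefficients bounded in \<open>\<xi>\<close>.\<close>

definition amplitude :: "real ^ 'm \<Rightarrow> real"
  where "amplitude \<xi> = (if 0 < norm \<xi> \<and> norm \<xi> < \<delta> then 1 / (1 + (\<Sum>n<4. norm (mode_coeff n \<xi>))) else 0)"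

definition c :: "nat \<Rightarrow> real ^ 'm \<Rightarrow> complex"
  where "c n \<xi> = of_real (amplitude \<xi>) * mode_coeff n \<xi>"

definition W :: "nat \<Rightarrow> real \<Rightarrow> real ^ 'm \<Rightarrow> complex"
  where "W j y \<xi> = wfun j (k \<xi>) (m \<xi>) (of_real l) (of_real y)"

lemma norm_measurable [measurable]: "(\<lambda>\<xi>::real ^ 'm. norm \<xi>) \<in> borel_measurable lebesgue"
  by (rule lebesgue_measurableI) measurable

lemma k_measurable [measurable]: "k \<in> borel_measurable lebesgue"
  unfolding k_def[abs_def] by measurable

lemma m_measurable [measurable]: "m \<in> borel_measurable lebesgue"
proof -
  have [measurable]: "(\<lambda>\<xi>. rt (\<sigma> \<xi>)) \<in> borel_measurable lebesgue"
    by (rule measurable_compose[OF \<sigma>_measurable rt_measurable])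
  show ?thesis
    unfolding m_def[abs_def] by measurable
qed

lemma mode_coeff_measurable [measurable]: "mode_coeff n \<in> borel_measurable lebesgue"
proof -
  have [measurable]: "\<alpha> \<in> borel_measurable lebesgue" "\<beta> \<in> borel_measurable lebesgue"
    unfolding \<alpha>_def[abs_def] \<beta>_def[abs_def] wcoeff1_def wcoeff2_def cfun_def sfun_def by measurable
  show ?thesis
    unfolding mode_coeff_def[abs_def] by measurable
qed

lemma amplitude_measurable [measurable]: "amplitude \<in> borel_measurable lebesgue"
  unfolding amplitude_def[abs_def] by measurable

lemma norm_rt_le: "norm (rt (\<sigma> \<xi>)) \<le> 1 + q"
proof -
  have "(norm (rt (\<sigma> \<xi>)))\<^sup>2 = \<bar>1 - \<sigma> \<xi>\<bar>"
    unfolding norm_power[symmetric] rt_power2 by (simp only: norm_of_real)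
  also have "\<dots> \<le> (1 + q) * 1"
    using \<sigma>_range[of \<xi>] p by auto
  also have "\<dots> \<le> (1 + q) * (1 + q)"
    using p q by (intro mult_left_mono) simp_all
  finally have "(norm (rt (\<sigma> \<xi>)))\<^sup>2 \<le> (1 + q)\<^sup>2"
    by (simp only: power2_eq_square)
  then show ?thesis
    by (rule power2_le_imp_le) (use p q in simp)
qed

text \<open>The first summand dominates k and m because \<open>rt\<close> is bounded by 1 + q on the
  range of \<sigma>; the second dominates \<omega>.\<close>

definition A :: real
  where "A = 2 * pi * \<delta> * (1 + q) + q * (2 * pi * \<delta>)\<^sup>2"

lemma A_bounds:
  assumes "norm \<xi> \<le> \<delta>"
  shows "norm (k \<xi>) \<le> A" "norm (m \<xi>) \<le> A" "\<bar>\<omega> \<xi>\<bar> \<le> A"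
proof -
  have k: "norm (k \<xi>) \<le> 2 * pi * \<delta>"
    using assms by (simp add: k_def norm_mult)
  have q0: "0 < q"
    using p q by simp
  have pos: "0 \<le> 2 * pi * \<delta>" "0 \<le> q * (2 * pi * \<delta>)\<^sup>2"
    using \<delta> q0 by simp_all
  have "norm (k \<xi>) \<le> 2 * pi * \<delta> * 1"
    using k by simp
  also have "\<dots> \<le> 2 * pi * \<delta> * (1 + q)"
    by (rule mult_left_mono[OF _ pos(1)]) (use q0 in simp)
  finally show "norm (k \<xi>) \<le> A"
    unfolding A_def using pos by linarith
  have "norm (m \<xi>) \<le> 2 * pi * \<delta> * (1 + q)"
    unfolding m_def norm_mult by (rule mult_mono[OF k norm_rt_le pos(1) norm_ge_zero])
  then show "norm (m \<xi>) \<le> A"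
    unfolding A_def using pos by linarith
  have "\<bar>\<omega> \<xi>\<bar> = \<bar>\<sigma> \<xi>\<bar> * (2 * pi * norm \<xi>)\<^sup>2"
    by (simp add: \<omega>_def abs_mult)
  also have "\<dots> \<le> q * (2 * pi * \<delta>)\<^sup>2"
  proof (rule mult_mono)
    show "\<bar>\<sigma> \<xi>\<bar> \<le> q"
      using \<sigma>_range[of \<xi>] p by auto
    show "(2 * pi * norm \<xi>)\<^sup>2 \<le> (2 * pi * \<delta>)\<^sup>2"
      using assms by (intro power_mono mult_left_mono) simp_all
  qed (use q0 in simp_all)
  also have "\<dots> \<le> A"
    unfolding A_def using mult_nonneg_nonneg[OF pos(1), of "1 + q"] q0 by linarith
  finally show "\<bar>\<omega> \<xi>\<bar> \<le> A" .
qed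

sublocale wave_packet \<rho> \<omega> \<delta> A
proof
  show "\<rho> n \<in> borel_measurable lebesgue" for n
    unfolding \<rho>_def[abs_def] by measurable
  show "\<omega> \<in> borel_measurable lebesgue"
    unfolding \<omega>_def[abs_def] by measurable
qed (use A_bounds in \<open>auto simp: \<rho>_def\<close>)

lemma m_power2: "(m \<xi>)\<^sup>2 = (k \<xi>)\<^sup>2 + of_real (\<omega> \<xi>)"
  by (simp add: m_def k_def \<omega>_def power_mult_distrib algebra_simps)

lemma \<rho>_power2: "(\<rho> n \<xi>)\<^sup>2 = (k \<xi>)\<^sup>2 \<or> (\<rho> n \<xi>)\<^sup>2 = (m \<xi>)\<^sup>2"
  by (simp add: \<rho>_def)

lemma nonzero:
  assumes "0 < norm \<xi>"
  shows "k \<xi> \<noteq> 0" "m \<xi> \<noteq> 0"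
  using assms \<sigma>_range[of \<xi>] ne_1 by (auto simp: k_def m_def)

lemma sum_mode_coeff:
  "(\<Sum>n<4. mode_coeff n \<xi> * \<rho> n \<xi> ^ j * exp (\<rho> n \<xi> * of_real y)) = W j y \<xi>"
proof -
  define a b kk mm Y where "a = \<alpha> \<xi>" and "b = \<beta> \<xi>" and "kk = k \<xi>" and "mm = m \<xi>" and "Y = complex_of_real y"
  define D where "D = kk\<^sup>2 - mm\<^sup>2"
  \<comment> \<open>The identity is linear in the inverses of kk, mm and D, so it also holds where
    one of them is 0.\<close>
  have expand: "(a / 2 + b / (2 * kk)) / D * E1 + (a / 2 - b / (2 * kk)) / D * E2 +
      - (a / 2 + b / (2 * mm)) / D * E3 + - (a / 2 - b / (2 * mm)) / D * E4 =
      a * (((E1 + E2) / 2 - (E3 + E4) / 2) / D) + b * (((E1 - E2) / (2 * kk) - (E3 - E4) / (2 * mm)) / D)"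
    for E1 E2 E3 E4
    by (simp add: add_divide_distrib diff_divide_distrib algebra_simps)
  have "{..<4::nat} = {0, 1, 2, 3}"
    by auto
  then have "(\<Sum>n<4. mode_coeff n \<xi> * \<rho> n \<xi> ^ j * exp (\<rho> n \<xi> * of_real y)) =
      (a / 2 + b / (2 * kk)) / D * (kk ^ j * exp (kk * Y)) +
      (a / 2 - b / (2 * kk)) / D * ((- kk) ^ j * exp (- kk * Y)) +
      - (a / 2 + b / (2 * mm)) / D * (mm ^ j * exp (mm * Y)) +
      - (a / 2 - b / (2 * mm)) / D * ((- mm) ^ j * exp (- mm * Y))"
    by (simp add: mode_coeff_def \<rho>_def a_def b_def kk_def mm_def Y_def D_def mult.assoc add.assoc)
  also have "\<dots> = a * cfun j kk mm Y + b * sfun j kk mm Y"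
    unfolding expand by (simp only: cfun_def sfun_def D_def)
  finally show ?thesis
    by (simp add: W_def wfun_def a_def b_def kk_def mm_def Y_def \<alpha>_def \<beta>_def)
qed

text \<open>A factor \<open>\<rho> n \<xi> ^ j\<close> on the amplitudes differentiates the profile
  j times in y.\<close>

lemma profile_c:
  assumes "\<And>n. b n \<xi> = g * \<rho> n \<xi> ^ j * c n \<xi>"
  shows "profile b y \<xi> = g * of_real (amplitude \<xi>) * W j y \<xi>"
proof -
  have "profile b y \<xi> = (\<Sum>n<4. g * of_real (amplitude \<xi>) * (mode_coeff n \<xi> * \<rho> n \<xi> ^ j * exp (\<rho> n \<xi> * of_real y)))"
    unfolding profile_def assms c_def by (simp only: mult_ac)
  then show ?thesis
    by (simp only: sum_distrib_left[symmetric] sum_mode_coeff)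
qed

lemma c_admissible: "admissible (c n)"
  unfolding admissible_def
proof (intro conjI exI allI impI)
  show "c n \<in> borel_measurable lebesgue"
    unfolding c_def[abs_def] by measurable
  show "norm (c n \<xi>) \<le> 1" for \<xi>
  proof -
    define s where "s = (\<Sum>n<4. norm (mode_coeff n \<xi>))"
    \<comment> \<open>The coefficients are constant from index 3 on, so any n can be moved into the
      range of the sum.\<close>
    define n' where "n' = min n 3"
    have "mode_coeff n \<xi> = mode_coeff n' \<xi>"
      by (auto simp: mode_coeff_def n'_def)
    also have "norm \<dots> \<le> s"
      unfolding s_def by (rule member_le_sum) (auto simp: n'_def)
    finally have le: "norm (mode_coeff n \<xi>) \<le> s" .
    then have "norm (mode_coeff n \<xi>) \<le> 1 + s" "0 < 1 + s"
      using norm_ge_zero[of "mode_coeff n \<xi>"] by linarith+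
    then show ?thesis
      by (simp add: c_def amplitude_def norm_mult norm_divide s_def[symmetric])
  qed
  show "c n \<xi> = 0" if "\<delta> < norm \<xi>" for \<xi>
    using that by (simp add: c_def amplitude_def)
qed

text \<open>
  The amplitudes of \<open>u\<close>, \<open>p\<close> and \<open>h\<close>. The surface \<open>h\<close> does not depend on \<open>y\<close>: it is stored in the single
  mode \<open>n = 0\<close> and read off at \<open>y = 0\<close>.
\<close>

definition bu :: "'m option \<Rightarrow> nat \<Rightarrow> real ^ 'm \<Rightarrow> complex"
  where "bu i n \<xi> = (case i of None \<Rightarrow> (k \<xi>)\<^sup>2 * c n \<xi> | Some j \<Rightarrow> dmult (Some j) n \<xi> * (dmult None n \<xi> * c n \<xi>))"

definition bp :: "nat \<Rightarrow> real ^ 'm \<Rightarrow> complex"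
  where "bp n \<xi> = ((\<rho> n \<xi>) ^ 3 - (m \<xi>)\<^sup>2 * \<rho> n \<xi>) * c n \<xi>"

definition bh :: "nat \<Rightarrow> real ^ 'm \<Rightarrow> complex"
  where "bh n \<xi> = (if n = 0 then of_real (- 1 / \<sigma> \<xi>) * profile c l \<xi> else 0)"

lemma bu_admissible: "admissible (bu i n)"
proof (cases i)
  case None
  have "admissible (\<lambda>\<xi>. (k \<xi>)\<^sup>2 * c n \<xi>)"
  proof (rule admissible_mult[OF c_admissible])
    show "norm ((k \<xi>)\<^sup>2) \<le> A\<^sup>2" if "norm \<xi> \<le> \<delta>" for \<xi>
      unfolding norm_power using A_bounds(1)[OF that] by (intro power_mono) auto
  qed measurable
  then show ?thesis
    using None by (simp add: bu_def[abs_def])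
next
  case (Some j)
  then show ?thesis
    by (simp add: bu_def[abs_def]) (intro admissible_dmult c_admissible)
qed

lemma bp_admissible: "admissible (bp n)"
  unfolding bp_def[abs_def]
proof (rule admissible_mult[OF c_admissible])
  show "norm ((\<rho> n \<xi>) ^ 3 - (m \<xi>)\<^sup>2 * \<rho> n \<xi>) \<le> A ^ 3 + A\<^sup>2 * A" if "norm \<xi> \<le> \<delta>" for \<xi>
  proof (rule order_trans[OF norm_triangle_ineq4], rule add_mono)
    show "norm (\<rho> n \<xi> ^ 3) \<le> A ^ 3"
      unfolding norm_power using \<rho>_bound[OF that] by (intro power_mono) auto
    have "0 \<le> A"
      using order_trans[OF norm_ge_zero A_bounds(1)[OF that]] .
    then show "norm ((m \<xi>)\<^sup>2 * \<rho> n \<xi>) \<le> A\<^sup>2 * A"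
      unfolding norm_mult norm_power using \<rho>_bound[OF that] A_bounds(2)[OF that]
      by (intro mult_mono power_mono) auto
  qed
qed measurable

lemma bh_admissible: "admissible (bh n)"
proof (cases "n = 0")
  case True
  have "admissible (\<lambda>\<xi>. profile c l \<xi>)"
    using admissible_profile[OF c_admissible, where y = l and t = 0] by simp
  then have "admissible (\<lambda>\<xi>. of_real (- 1 / \<sigma> \<xi>) * profile c l \<xi>)"
  proof (rule admissible_mult)
    show "norm (complex_of_real (- 1 / \<sigma> \<xi>)) \<le> 1 / p" for \<xi>
      using \<sigma>_range[of \<xi>] p by (simp add: norm_divide frac_le)
  qed measurable
  then show ?thesis
    using True by (simp add: bh_def[abs_def])
qed (simp add: bh_def[abs_def])

lemma amplitude_pos: "0 < norm \<xi> \<Longrightarrow> norm \<xi> < \<delta> \<Longrightarrow> amplitude \<xi> > 0"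
  by (auto simp: amplitude_def intro!: divide_pos_pos add_pos_nonneg sum_nonneg)

lemma profile_bu_Some: "profile (bu (Some j)) y \<xi> = 2 * pi * \<i> * of_real (\<xi> $ j) * of_real (amplitude \<xi>) * W 1 y \<xi>"
  by (rule profile_c) (simp add: bu_def dmult_def)

lemma profile_bu_None: "profile (bu None) y \<xi> = (k \<xi>)\<^sup>2 * of_real (amplitude \<xi>) * W 0 y \<xi>"
  by (rule profile_c) (simp add: bu_def)

lemma profile_bh: "profile bh 0 \<xi> = of_real (- 1 / \<sigma> \<xi>) * of_real (amplitude \<xi>) * W 0 l \<xi>"
proof -
  have "{..<4::nat} = {0, 1, 2, 3}"
    by auto
  then have "profile bh 0 \<xi> = of_real (- 1 / \<sigma> \<xi>) * profile c l \<xi>"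
    unfolding profile_def[of bh] by (simp add: bh_def)
  also have "profile c l \<xi> = 1 * of_real (amplitude \<xi>) * W 0 l \<xi>"
    by (rule profile_c) simp
  finally show ?thesis
    by (simp only: mult_1 mult.assoc)
qed

lemma W_real: "W j y \<xi> \<in> \<real>"
  unfolding W_def m_def k_def by (rule wfun_real)

lemma W_bottom: "0 < norm \<xi> \<Longrightarrow> W 0 0 \<xi> = 0" "0 < norm \<xi> \<Longrightarrow> W 1 0 \<xi> = 0"
  using wfun_bottom[OF nonzero] by (simp_all add: W_def)

text \<open>The dispersion relation equates real parts; all quantities involved are real, so the
  complex equation follows.\<close>

lemma normal_stress:
  assumes "0 < norm \<xi>" "norm \<xi> < \<delta>"
  shows "of_real (\<sigma> \<xi>) * (W 3 l \<xi> - ((m \<xi>)\<^sup>2 + 2 * (k \<xi>)\<^sup>2) * W 1 l \<xi>) + of_real (\<mu> \<xi>) * W 0 l \<xi> = 0"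
proof -
  define T where "T = W 3 l \<xi> - ((m \<xi>)\<^sup>2 + 2 * (k \<xi>)\<^sup>2) * W 1 l \<xi>"
  have "(m \<xi>)\<^sup>2 + 2 * (k \<xi>)\<^sup>2 \<in> \<real>"
    unfolding m_power2 by (simp add: k_def)
  then have "T \<in> \<real>"
    unfolding T_def by (intro Reals_diff Reals_mult W_real)
  then have T: "T = of_real (Re T)"
    by (simp add: of_real_Re)
  have "\<sigma> \<xi> * Re T + \<mu> \<xi> * Re (W 0 l \<xi>) = 0"
    using dispersion_zero[OF assms] by (simp add: dispersion_def traction_def T_def W_def m_def k_def)
  then have "complex_of_real (\<sigma> \<xi>) * of_real (Re T) + of_real (\<mu> \<xi>) * of_real (Re (W 0 l \<xi>)) = 0"
    by (metis of_real_0 of_real_add of_real_mult)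
  then show ?thesis
    unfolding T_def[symmetric] using T of_real_Re[OF W_real, of 0 l \<xi>] by simp
qed

text \<open>The normal stress \<open>p - 2 \<partial>\<^sub>N u\<^sub>N\<close>.\<close>

definition bk :: "nat \<Rightarrow> real ^ 'm \<Rightarrow> complex"
  where "bk n \<xi> = bp n \<xi> + (- 2) * (dmult None n \<xi> * bu None n \<xi>)"

lemma bk_admissible: "admissible (bk n)"
  unfolding bk_def[abs_def]
  by (intro admissible_add bp_admissible admissible_mult[where g = "\<lambda>_. - 2" and C = 2] admissible_dmult bu_admissible) auto

lemma profile_add: "profile (\<lambda>n \<xi>. b n \<xi> + d n \<xi>) y \<xi> = profile b y \<xi> + profile d y \<xi>"
  by (simp add: profile_def distrib_right sum.distrib)

text \<open>On the punctured ball this is \<open>normal_stress\<close> divided by \<sigma>;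
  elsewhere the amplitude makes both sides 0. It says that the normal stress at the surface is M
  applied to the surface function.\<close>

lemma profile_bk: "profile bk l \<xi> = of_real (\<mu> \<xi>) * profile bh 0 \<xi>"
proof -
  have "bk n \<xi> = 1 * \<rho> n \<xi> ^ 3 * c n \<xi> + (- ((m \<xi>)\<^sup>2 + 2 * (k \<xi>)\<^sup>2)) * \<rho> n \<xi> ^ 1 * c n \<xi>" for n \<xi>
    by (simp add: bk_def bp_def bu_def dmult_def algebra_simps)
  then have "profile bk l \<xi> = profile (\<lambda>n \<xi>. 1 * \<rho> n \<xi> ^ 3 * c n \<xi> + (- ((m \<xi>)\<^sup>2 + 2 * (k \<xi>)\<^sup>2)) * \<rho> n \<xi> ^ 1 * c n \<xi>) l \<xi>"
    by (simp only: profile_def)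
  also have "\<dots> = 1 * of_real (amplitude \<xi>) * W 3 l \<xi> +
      (- ((m \<xi>)\<^sup>2 + 2 * (k \<xi>)\<^sup>2)) * of_real (amplitude \<xi>) * W 1 l \<xi>"
    unfolding profile_add by (intro arg_cong2[where f = "(+)"] profile_c refl)
  finally have eq: "profile bk l \<xi> = of_real (amplitude \<xi>) * (W 3 l \<xi> - ((m \<xi>)\<^sup>2 + 2 * (k \<xi>)\<^sup>2) * W 1 l \<xi>)"
    by (simp add: algebra_simps)
  show ?thesis
  proof (cases "0 < norm \<xi> \<and> norm \<xi> < \<delta>")
    case True
    have \<sigma>: "complex_of_real (\<sigma> \<xi>) \<noteq> 0"
      using \<sigma>_range[of \<xi>] p by auto
    have "W 3 l \<xi> - ((m \<xi>)\<^sup>2 + 2 * (k \<xi>)\<^sup>2) * W 1 l \<xi> = - of_real (\<mu> \<xi>) * W 0 l \<xi> / of_real (\<sigma> \<xi>)"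
      using normal_stress[of \<xi>] True \<sigma> by (simp add: eq_divide_eq add_eq_0_iff mult.commute)
    then show ?thesis
      unfolding eq profile_bh by simp
  next
    case False
    then have "amplitude \<xi> = 0"
      unfolding amplitude_def by (rule if_not_P)
    then show ?thesis
      unfolding eq profile_bh by simp
  qed
qed

lemma sum_dmult_Some: "(\<Sum>j\<in>UNIV. (dmult (Some j) n \<xi>)\<^sup>2) = - (k \<xi>)\<^sup>2"
proof -
  have norm: "(norm \<xi>)\<^sup>2 = (\<Sum>j\<in>UNIV. (\<xi> $ j)\<^sup>2)"
    unfolding power2_norm_eq_inner inner_vec_def by (simp add: power2_eq_square)
  have "(dmult (Some j) n \<xi>)\<^sup>2 = of_real (- (2 * pi)\<^sup>2 * (\<xi> $ j)\<^sup>2)" for j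
    by (simp add: dmult_def power_mult_distrib)
  then have "(\<Sum>j\<in>UNIV. (dmult (Some j) n \<xi>)\<^sup>2) = of_real (- (2 * pi)\<^sup>2 * (norm \<xi>)\<^sup>2)"
    unfolding norm sum_distrib_left of_real_sum by simp
  then show ?thesis
    by (simp add: k_def power_mult_distrib)
qed

text \<open>The pressure is chosen so that the horizontal components hold as polynomial identities
  in the exponent. The vertical component then reduces to (\<rho>^2 - k^2) (\<rho>^2 - m^2) = 0,
  which determines the four exponents.\<close>

lemma momentum:
  "of_real (\<omega> \<xi>) * bu i n \<xi> + dmult i n \<xi> * bp n \<xi> = (\<Sum>j\<in>UNIV. (dmult j n \<xi>)\<^sup>2) * bu i n \<xi>"
proof -
  define r kk mm C where "r = \<rho> n \<xi>" and "kk = k \<xi>" and "mm = m \<xi>" and "C = c n \<xi>"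
  have lap: "(\<Sum>j\<in>UNIV. (dmult j n \<xi>)\<^sup>2) = r\<^sup>2 - kk\<^sup>2"
    unfolding sum_UNIV_option sum_dmult_Some by (simp add: dmult_def r_def kk_def)
  have \<omega>: "complex_of_real (\<omega> \<xi>) = mm\<^sup>2 - kk\<^sup>2"
    using m_power2[of \<xi>] by (simp add: mm_def kk_def)
  have bp: "bp n \<xi> = (r ^ 3 - mm\<^sup>2 * r) * C"
    by (simp add: bp_def r_def mm_def C_def)
  show ?thesis
  proof (cases i)
    case None
    have 0: "(r\<^sup>2 - kk\<^sup>2) * (r\<^sup>2 - mm\<^sup>2) = 0"
      using \<rho>_power2[of n \<xi>] by (auto simp: r_def kk_def mm_def)
    have "((mm\<^sup>2 - kk\<^sup>2) * kk\<^sup>2 + r * (r ^ 3 - mm\<^sup>2 * r)) - (r\<^sup>2 - kk\<^sup>2) * kk\<^sup>2 = (r\<^sup>2 - kk\<^sup>2) * (r\<^sup>2 - mm\<^sup>2)"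
      by (simp add: algebra_simps power2_eq_square power3_eq_cube)
    then have eq: "(mm\<^sup>2 - kk\<^sup>2) * kk\<^sup>2 + r * (r ^ 3 - mm\<^sup>2 * r) = (r\<^sup>2 - kk\<^sup>2) * kk\<^sup>2"
      unfolding 0 by (simp only: right_minus_eq)
    have "(mm\<^sup>2 - kk\<^sup>2) * (kk\<^sup>2 * C) + r * ((r ^ 3 - mm\<^sup>2 * r) * C) = (r\<^sup>2 - kk\<^sup>2) * (kk\<^sup>2 * C)"
      unfolding mult.assoc[symmetric] distrib_right[symmetric] eq ..
    moreover have "bu i n \<xi> = kk\<^sup>2 * C" "dmult i n \<xi> = r"
      using None by (simp_all add: bu_def dmult_def r_def kk_def C_def)
    ultimately show ?thesis
      unfolding lap \<omega> bp by simp
  next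
    case (Some j)
    define d where "d = dmult i n \<xi>"
    have "bu i n \<xi> = d * (r * C)"
      using Some by (simp add: bu_def dmult_def r_def C_def d_def)
    moreover have "(mm\<^sup>2 - kk\<^sup>2) * (d * (r * C)) + d * ((r ^ 3 - mm\<^sup>2 * r) * C) = (r\<^sup>2 - kk\<^sup>2) * (d * (r * C))"
      by (simp add: algebra_simps power2_eq_square power3_eq_cube)
    ultimately show ?thesis
      unfolding lap \<omega> bp d_def[symmetric] by simp
  qed
qed

text \<open>The horizontal velocity is the horizontal gradient of w'; its divergence - k^2 w'
  cancels the vertical derivative of k^2 w.\<close>

lemma incompressible: "(\<Sum>i\<in>UNIV. dmult i n \<xi> * bu i n \<xi>) = 0"
proof -
  have "(\<Sum>j\<in>UNIV. dmult (Some j) n \<xi> * bu (Some j) n \<xi>) =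
      (\<Sum>j\<in>UNIV. (dmult (Some j) n \<xi>)\<^sup>2) * (\<rho> n \<xi> * c n \<xi>)"
    unfolding sum_distrib_right by (simp add: bu_def dmult_def power2_eq_square mult_ac)
  then show ?thesis
    unfolding sum_UNIV_option sum_dmult_Some by (simp add: bu_def dmult_def)
qed

end

section \<open>The fields and the equations they satisfy\<close>

context eigenmode
begin

definition u :: "real \<Rightarrow> 'm point \<Rightarrow> complex ^ 'm option"
  where "u t z = (\<chi> i. field (bu i) t z)"

definition h :: "real \<Rightarrow> real ^ 'm \<Rightarrow> complex"
  where "h t x = field bh t (x, 0)"

definition U :: "real ^ 'm \<Rightarrow> real \<Rightarrow> real \<Rightarrow> complex ^ 'm option"
  where "U \<xi> y t = (\<chi> i. profile (bu i) y \<xi> * exp (of_real (\<omega> \<xi> * t)))"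

text \<open>The mode degenerates at \<open>\<xi> = 0\<close>, where any nonzero value serves.\<close>

definition H :: "real ^ 'm \<Rightarrow> real \<Rightarrow> complex"
  where "H \<xi> t = (if \<xi> = 0 then 1 else profile bh 0 \<xi> * exp (of_real (\<omega> \<xi> * t)))"

lemma u_component [simp]: "u t z $ i = field (bu i) t z"
  by (simp add: u_def)

lemma open_slab_subset: "z \<in> open_slab l \<Longrightarrow> z \<in> slab l"
  by (auto simp: open_slab_def slab_def)

lemma slab_top: "(x, l) \<in> slab l"
  using l by (simp add: slab_def)

lemma pd_u: "z \<in> slab l \<Longrightarrow> pd l i (\<lambda>w. u t w $ j) z = field (\<lambda>n \<xi>. dmult i n \<xi> * bu j n \<xi>) t z"
  by (rule pd_field[OF l bu_admissible]) auto

lemma momentum_equation: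
  assumes "t \<ge> 0" "z \<in> slab l"
  shows "dt (\<lambda>s. u s z $ i) t + pd l i (field bp t) z = laplacian l (\<lambda>w. u t w $ i) z"
proof -
  have "dt (\<lambda>s. u s z $ i) t + pd l i (field bp t) z =
      field (\<lambda>n \<xi>. of_real (\<omega> \<xi>) * bu i n \<xi>) t z + field (\<lambda>n \<xi>. dmult i n \<xi> * bp n \<xi>) t z"
    using dt_field[OF bu_admissible assms(1)] pd_field[OF l bp_admissible refl assms(2)] by simp
  also have "\<dots> = field (\<lambda>n \<xi>. of_real (\<omega> \<xi>) * bu i n \<xi> + dmult i n \<xi> * bp n \<xi>) t z"
    by (rule field_add[symmetric]) (intro admissible_\<omega> admissible_dmult bu_admissible bp_admissible)+
  also have "\<dots> = field (\<lambda>n \<xi>. (\<Sum>j\<in>UNIV. (dmult j n \<xi>)\<^sup>2) * bu i n \<xi>) t z"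
    by (rule field_cong) (rule momentum)
  also have "\<dots> = laplacian l (field (bu i) t) z"
    by (rule laplacian_field[OF l bu_admissible assms(2), symmetric])
  finally show ?thesis
    by simp
qed

lemma divergence_free:
  assumes "z \<in> slab l"
  shows "divergence l (u t) z = 0"
proof -
  have "divergence l (u t) z = field (\<lambda>n \<xi>. \<Sum>i\<in>UNIV. dmult i n \<xi> * bu i n \<xi>) t z"
    unfolding divergence_def pd_u[OF assms]
    by (rule field_sum[symmetric]) (intro admissible_dmult bu_admissible)
  then show ?thesis
    by (simp add: incompressible field_def wave_def)
qed

lemma kinematic_condition:
  assumes "t \<ge> 0"
  shows "dt (\<lambda>s. h s x) t = u t (x, l) $ None"
proof -
  have "dt (\<lambda>s. h s x) t = field (\<lambda>n \<xi>. of_real (\<omega> \<xi>) * bh n \<xi>) t (x, 0)"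
    unfolding h_def by (rule dt_field[OF bh_admissible assms])
  also have "\<dots> = field (bu None) t (x, l)"
  proof (rule field_eqI[OF admissible_\<omega>[OF bh_admissible] bu_admissible])
    fix \<xi>
    have "profile (\<lambda>n \<xi>. of_real (\<omega> \<xi>) * bh n \<xi>) 0 \<xi> = of_real (\<omega> \<xi>) * profile bh 0 \<xi>"
      by (simp add: profile_def sum_distrib_left mult.assoc)
    also have "\<dots> = (of_real (\<omega> \<xi>) * of_real (- 1 / \<sigma> \<xi>)) * of_real (amplitude \<xi>) * W 0 l \<xi>"
      by (simp only: profile_bh mult.assoc)
    \<comment> \<open>The surface amplitude - w(l) / \<sigma> was chosen for this cancellation
      against \<omega> = - \<sigma> k^2.\<close>
    also have "of_real (\<omega> \<xi>) * of_real (- 1 / \<sigma> \<xi>) = (k \<xi>)\<^sup>2"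
      using \<sigma>_range[of \<xi>] p by (simp add: \<omega>_def k_def)
    finally show "profile (\<lambda>n \<xi>. of_real (\<omega> \<xi>) * bh n \<xi>) 0 \<xi> = profile (bu None) l \<xi>"
      by (simp only: profile_bu_None)
  qed
  finally show ?thesis
    by simp
qed

lemma no_slip: "u t (x, 0) = 0"
proof -
  have "profile (bu i) 0 \<xi> = 0" for i \<xi>
  proof (cases "0 < norm \<xi> \<and> norm \<xi> < \<delta>")
    case True
    then show ?thesis
      using W_bottom[of \<xi>] by (cases i) (simp_all add: profile_bu_None profile_bu_Some)
  next
    case False
    then have "amplitude \<xi> = 0"
      unfolding amplitude_def by (rule if_not_P)
    then show ?thesis
      by (cases i) (simp_all add: profile_bu_None profile_bu_Some)
  qed
  then show ?thesis
    by (simp add: vec_eq_iff field_eq_0[OF bu_admissible])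
qed

text \<open>The profile of this sum is a multiple of w'' + k^2 w, which vanishes at the top by
  \<open>wfun_top\<close>.\<close>

lemma tangential_stress: "pd l (Some j) (\<lambda>w. u t w $ None) (x, l) + pd l None (\<lambda>w. u t w $ Some j) (x, l) = 0"
proof -
  have "pd l (Some j) (\<lambda>w. u t w $ None) (x, l) + pd l None (\<lambda>w. u t w $ Some j) (x, l) =
      field (\<lambda>n \<xi>. dmult (Some j) n \<xi> * bu None n \<xi> + dmult None n \<xi> * bu (Some j) n \<xi>) t (x, l)"
    unfolding pd_u[OF slab_top] by (rule field_add[symmetric]) (intro admissible_dmult bu_admissible)+
  also have "\<dots> = 0"
  proof (rule field_eq_0)
    show "admissible (\<lambda>\<xi>. dmult (Some j) n \<xi> * bu None n \<xi> + dmult None n \<xi> * bu (Some j) n \<xi>)" for n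
      by (intro admissible_add admissible_dmult bu_admissible)
    fix \<xi>
    define d where "d = 2 * pi * \<i> * of_real (\<xi> $ j)"
    have d: "dmult (Some j) n \<xi> = d" for n
      by (simp add: dmult_def d_def)
    have "profile (\<lambda>n \<xi>. dmult (Some j) n \<xi> * bu None n \<xi> + dmult None n \<xi> * bu (Some j) n \<xi>) l \<xi> =
        profile (\<lambda>n \<xi>. dmult (Some j) n \<xi> * bu None n \<xi>) l \<xi> + profile (\<lambda>n \<xi>. dmult None n \<xi> * bu (Some j) n \<xi>) l \<xi>"
      by (rule profile_add)
    also have "profile (\<lambda>n \<xi>. dmult (Some j) n \<xi> * bu None n \<xi>) l \<xi> = (d * (k \<xi>)\<^sup>2) * of_real (amplitude \<xi>) * W 0 l \<xi>"
      by (rule profile_c) (simp add: d bu_def)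
    also have "profile (\<lambda>n \<xi>. dmult None n \<xi> * bu (Some j) n \<xi>) l \<xi> = d * of_real (amplitude \<xi>) * W 2 l \<xi>"
      by (rule profile_c) (simp add: bu_def d, simp add: dmult_def power2_eq_square)
    also have "(d * (k \<xi>)\<^sup>2) * of_real (amplitude \<xi>) * W 0 l \<xi> + d * of_real (amplitude \<xi>) * W 2 l \<xi> =
        d * of_real (amplitude \<xi>) * (W 2 l \<xi> + (k \<xi>)\<^sup>2 * W 0 l \<xi>)"
      by (simp add: algebra_simps)
    also have "\<dots> = 0"
      using wfun_top[of "k \<xi>" "m \<xi>" "of_real l"] by (simp add: W_def)
    finally show "profile (\<lambda>n \<xi>. dmult (Some j) n \<xi> * bu None n \<xi> + dmult None n \<xi> * bu (Some j) n \<xi>) l \<xi> = 0" .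
  qed
  finally show ?thesis .
qed

lemma matrix_vector_mult_axis: "(M *v axis j 1) $ i = M $ i $ j"
  for M :: "complex ^ 'a::finite ^ 'b::finite"
  by (simp add: matrix_vector_mult_def axis_def if_distrib cong: if_cong)

lemma stress_condition:
  "(mat (field bp t (x, l)) - sym_grad l (u t) (x, l)) *v axis None 1 = field bk t (x, l) *s axis None 1"
proof -
  have "field bk t (x, l) = field bp t (x, l) + field (\<lambda>n \<xi>. (- 2) * (dmult None n \<xi> * bu None n \<xi>)) t (x, l)"
    unfolding bk_def[abs_def]
    by (rule field_add) (intro bp_admissible admissible_mult[where g = "\<lambda>_. - 2" and C = 2] admissible_dmult bu_admissible; simp)+
  also have "field (\<lambda>n \<xi>. (- 2) * (dmult None n \<xi> * bu None n \<xi>)) t (x, l) = (- 2) * pd l None (\<lambda>w. u t w $ None) (x, l)"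
    unfolding pd_u[OF slab_top] by (simp add: field_def wave_def sum_distrib_left sum_negf mult.assoc)
  finally have normal: "field bk t (x, l) = field bp t (x, l) - 2 * pd l None (\<lambda>w. u t w $ None) (x, l)"
    by simp
  have "((mat (field bp t (x, l)) - sym_grad l (u t) (x, l)) *v axis None 1) $ i = (field bk t (x, l) *s axis None 1) $ i" for i
    unfolding matrix_vector_mult_axis
    using tangential_stress[of _ t x]
    by (cases i) (simp_all add: mat_def sym_grad_def axis_def normal del: u_component)
  then show ?thesis
    by (intro vec_eq_iff[THEN iffD2] allI)
qed

lemma multiplier: "is_multiplier \<mu> (h t) (\<lambda>x. field bk t (x, l))"
proof -
  have "is_fourier (h t) (\<lambda>\<xi>. profile bh 0 \<xi> * exp (of_real (\<omega> \<xi> * t)))"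
    unfolding h_def[abs_def] by (rule is_fourier_field[OF bh_admissible])
  moreover have "is_fourier (\<lambda>x. field bk t (x, l)) (\<lambda>\<xi>. of_real (\<mu> \<xi>) * (profile bh 0 \<xi> * exp (of_real (\<omega> \<xi> * t))))"
    using is_fourier_field[where b = bk and t = t and y = l, OF bk_admissible] by (simp only: profile_bk mult.assoc)
  ultimately show ?thesis
    unfolding is_multiplier_def by blast
qed

lemma solution: "solution l \<mu> u (field bp) h"
  unfolding solution_def
proof (intro conjI allI impI ballI exI)
  show "space_C2 l (\<lambda>t z. u t z $ i)" for i
    by (rule space_C2_field[OF l bu_admissible]) simp
  show "time_C1 l (\<lambda>t z. u t z $ i)" for i
    using time_C1_field[OF bu_admissible] by simp
  show "space_C1 l (field bp)"
    by (rule space_C1_field[OF l bp_admissible refl])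
  show "surface_C1 h"
    using surface_C1_field[OF bh_admissible, where y = 0] by (simp add: h_def[abs_def])
qed (auto intro: momentum_equation divergence_free kinematic_condition no_slip multiplier stress_condition open_slab_subset simp del: u_component)

lemma horizontal_fourier: "horizontal_fourier l u h U H"
  unfolding horizontal_fourier_def
proof (intro conjI allI impI ballI)
  show "is_fourier (\<lambda>x. u t (x, y) $ i) (\<lambda>\<xi>. U \<xi> y t $ i)" for t y i
    using is_fourier_field[OF bu_admissible] by (simp add: U_def)
  show "is_fourier (h t) (\<lambda>\<xi>. H \<xi> t)" for t
  \<comment> \<open>\<open>H\<close> departs from the transform of the surface only at the frequency
    0, a null set.\<close>
  proof (rule is_fourier_cong_AE)
    show "is_fourier (h t) (\<lambda>\<xi>. profile bh 0 \<xi> * exp (of_real (\<omega> \<xi> * t)))"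
      unfolding h_def[abs_def] by (rule is_fourier_field[OF bh_admissible])
    have "AE \<xi> in lebesgue. \<xi> \<noteq> (0 :: real ^ 'm)"
      by (rule AE_completion[OF AE_lborel_singleton])
    then show "AE \<xi> in lebesgue. profile bh 0 \<xi> * exp (of_real (\<omega> \<xi> * t)) = H \<xi> t"
      by eventually_elim (simp add: H_def)
    have [measurable]: "(\<lambda>\<xi>. profile bh 0 \<xi> * exp (of_real (\<omega> \<xi> * t))) \<in> borel_measurable lebesgue"
      using admissible_profile[OF bh_admissible] by (simp add: admissible_def)
    have [measurable]: "(\<lambda>\<xi>::real ^ 'm. \<xi> = 0) \<in> measurable lebesgue (count_space UNIV)"
      by (intro measurable_completion) measurable
    show "(\<lambda>\<xi>. H \<xi> t) \<in> borel_measurable lebesgue"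
      unfolding H_def by measurable
  qed
  show "continuous_on ({0..l} \<times> {0..}) (\<lambda>(y, t). U \<xi> y t)" for \<xi>
    unfolding U_def split_beta profile_def by (intro continuous_intros)
  show "continuous_on {0..} (H \<xi>)" for \<xi>
    unfolding H_def[abs_def] by (cases "\<xi> = 0") (auto intro!: continuous_intros)
qed

lemma real_field:
  assumes "\<And>n. admissible (b n)" and "AE \<xi> in lebesgue. profile b y (- \<xi>) = cnj (profile b y \<xi>)"
    and "AE \<xi> in lebesgue. \<sigma> (- \<xi>) = \<sigma> \<xi>"
  shows "field b t (x, y) \<in> \<real>"
  unfolding field_eq_profile[OF assms(1)]
proof (rule fourier_synthesis_real)
  show "(\<lambda>\<xi>. profile b y \<xi> * exp (of_real (\<omega> \<xi> * t))) \<in> borel_measurable lebesgue"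
    using admissible_profile[OF assms(1)] by (simp add: admissible_def)
  show "AE \<xi> in lebesgue. profile b y (- \<xi>) * exp (of_real (\<omega> (- \<xi>) * t)) = cnj (profile b y \<xi> * exp (of_real (\<omega> \<xi> * t)))"
    using assms(2,3) by eventually_elim (simp add: \<omega>_def exp_cnj)
qed

text \<open>For even \<sigma> the profiles of the vertical velocity, the pressure and the surface
  are real and even, and those of the horizontal velocity are imaginary and odd through \<xi>_j; all
  of them are hermitian.\<close>

lemma real_fields:
  assumes "AE \<xi> in lebesgue. \<sigma> (- \<xi>) = \<sigma> \<xi>"
  shows "real_fields l u (field bp) h"
proof -
  have cnj_W: "cnj (W j y \<xi>) = W j y \<xi>" for j y \<xi>
    using W_real[of j y \<xi>] by (simp add: Reals_cnj_iff)
  have reflect: "k (- \<xi>) = k \<xi>" "W j y (- \<xi>) = W j y \<xi>" "amplitude (- \<xi>) = amplitude \<xi>"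
    if "\<sigma> (- \<xi>) = \<sigma> \<xi>" for \<xi> j y
  proof -
    have km: "k (- \<xi>) = k \<xi>" "m (- \<xi>) = m \<xi>"
      using that by (simp_all add: k_def m_def)
    then show "k (- \<xi>) = k \<xi>" "W j y (- \<xi>) = W j y \<xi>"
      by (simp_all add: W_def)
    have "mode_coeff n (- \<xi>) = mode_coeff n \<xi>" for n
      using km by (simp add: mode_coeff_def \<alpha>_def \<beta>_def)
    then show "amplitude (- \<xi>) = amplitude \<xi>"
      by (simp add: amplitude_def)
  qed
  have cnj_k: "cnj (k \<xi>) = k \<xi>" for \<xi>
    by (simp add: k_def)
  have bu: "AE \<xi> in lebesgue. profile (bu i) y (- \<xi>) = cnj (profile (bu i) y \<xi>)" for i y
    using assms
    by eventually_elim (cases i, simp_all add: profile_bu_None profile_bu_Some reflect cnj_W cnj_k)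
  have bh: "AE \<xi> in lebesgue. profile bh 0 (- \<xi>) = cnj (profile bh 0 \<xi>)"
    using assms by eventually_elim (simp add: profile_bh reflect cnj_W)
  have bp_eq: "profile bp y \<xi> = of_real (amplitude \<xi>) * (W 3 y \<xi> - ((k \<xi>)\<^sup>2 + of_real (\<omega> \<xi>)) * W 1 y \<xi>)" for y \<xi>
  proof -
    have "bp n \<xi> = 1 * \<rho> n \<xi> ^ 3 * c n \<xi> + (- (m \<xi>)\<^sup>2) * \<rho> n \<xi> ^ 1 * c n \<xi>" for n \<xi>
      by (simp add: bp_def algebra_simps)
    then have "profile bp y \<xi> = profile (\<lambda>n \<xi>. 1 * \<rho> n \<xi> ^ 3 * c n \<xi> + (- (m \<xi>)\<^sup>2) * \<rho> n \<xi> ^ 1 * c n \<xi>) y \<xi>"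
      by (simp only: profile_def)
    also have "\<dots> = 1 * of_real (amplitude \<xi>) * W 3 y \<xi> + (- (m \<xi>)\<^sup>2) * of_real (amplitude \<xi>) * W 1 y \<xi>"
      unfolding profile_add by (intro arg_cong2[where f = "(+)"] profile_c refl)
    finally show ?thesis
      unfolding m_power2 by (simp add: algebra_simps)
  qed
  have bp: "AE \<xi> in lebesgue. profile bp y (- \<xi>) = cnj (profile bp y \<xi>)" for y
    using assms by eventually_elim (simp add: bp_eq reflect cnj_W cnj_k \<omega>_def)
  show ?thesis
    unfolding real_fields_def
  proof (intro allI impI conjI ballI)
    fix t z i
    show "u t z $ i \<in> \<real>"
      using real_field[OF bu_admissible bu assms, where t = t and x = "fst z" and y = "snd z"] by simp
    show "field bp t z \<in> \<real>"
      using real_field[OF bp_admissible bp assms, where t = t and x = "fst z" and y = "snd z"] by simp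
    show "h t x \<in> \<real>" for x
      unfolding h_def by (rule real_field[OF bh_admissible bh assms])
  qed
qed

section \<open>The energy at a single frequency\<close>

lemma U_0: "U 0 y t = 0"
proof -
  have "bu i n 0 = 0" for i n
    by (cases i) (simp_all add: bu_def c_def amplitude_def)
  then show ?thesis
    by (simp add: U_def vec_eq_iff profile_def)
qed

lemma energy_evolution:
  assumes "\<xi> \<noteq> 0"
  shows "energy l \<mu> U H \<xi> t = exp (2 * \<omega> \<xi> * t) * energy l \<mu> U H \<xi> 0"
proof -
  have e: "(exp (\<omega> \<xi> * t))\<^sup>2 = exp (2 * \<omega> \<xi> * t)"
    by (simp add: exp_double[symmetric] mult.assoc)
  have "U \<xi> y t = exp (\<omega> \<xi> * t) *\<^sub>R U \<xi> y 0" for y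
    unfolding vec_eq_iff vector_scaleR_component U_def vec_lambda_beta exp_of_real
    by (simp add: scaleR_conv_of_real)
  then have "(norm (U \<xi> y t))\<^sup>2 = exp (2 * \<omega> \<xi> * t) * (norm (U \<xi> y 0))\<^sup>2" for y
    by (simp add: power_mult_distrib e)
  moreover have "H \<xi> t = exp (\<omega> \<xi> * t) *\<^sub>R H \<xi> 0"
    using assms unfolding H_def exp_of_real by (simp add: scaleR_conv_of_real)
  then have "(norm (H \<xi> t))\<^sup>2 = exp (2 * \<omega> \<xi> * t) * (norm (H \<xi> 0))\<^sup>2"
    by (simp add: power_mult_distrib e)
  ultimately show ?thesis
    by (simp add: energy_def distrib_left)
qed

text \<open>The surface term alone is positive, because the profile does not vanish at the top. This
  keeps the decay estimate from being satisfied trivially by a zero mode.\<close>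

lemma energy_positive:
  assumes "norm \<xi> < \<delta>" "\<mu> \<xi> > 0"
  shows "energy l \<mu> U H \<xi> 0 > 0"
proof -
  have "H \<xi> 0 \<noteq> 0"
  proof (cases "\<xi> = 0")
    case False
    then have "amplitude \<xi> > 0" "W 0 l \<xi> \<noteq> 0"
      using amplitude_pos[of \<xi>] wfun_nonzero[of \<xi>] assms by (auto simp: W_def m_def k_def)
    then show ?thesis
      using False \<sigma>_range[of \<xi>] p by (auto simp: H_def profile_bh)
  qed (simp add: H_def)
  then have "0 < \<mu> \<xi> / 2 * (norm (H \<xi> 0))\<^sup>2"
    using assms by simp
  moreover have "0 \<le> integral {0..l} (\<lambda>y. (norm (U \<xi> y 0))\<^sup>2)"
    by (rule Henstock_Kurzweil_Integration.integral_nonneg)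
       (auto simp: U_def profile_def intro!: integrable_continuous_interval continuous_intros)
  ultimately show ?thesis
    unfolding energy_def by simp
qed

lemma energy_lower_bound:
  assumes "norm \<xi> < \<delta>" "\<mu> \<xi> > 0" "t \<ge> 0"
  shows "energy l \<mu> U H \<xi> t \<ge> 1 * exp (- (8 * pi\<^sup>2 * q) * (norm \<xi>)\<^sup>2 * t) * energy l \<mu> U H \<xi> 0"
proof (cases "\<xi> = 0")
  case True
  \<comment> \<open>At the frequency 0 the energy is constant in time: U vanishes and H is
    1.\<close>
  then show ?thesis
    by (simp add: energy_def U_0 H_def)
next
  case False
  \<comment> \<open>The constant comes from 2 \<omega> = - 2 \<sigma> (2 pi norm \<xi>)^2 together
    with \<sigma> \<le> q.\<close>
  have "\<sigma> \<xi> * (8 * pi\<^sup>2 * (norm \<xi>)\<^sup>2 * t) \<le> q * (8 * pi\<^sup>2 * (norm \<xi>)\<^sup>2 * t)"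
    using \<sigma>_range[of \<xi>] assms(3) by (intro mult_right_mono) auto
  then have "- (8 * pi\<^sup>2 * q) * (norm \<xi>)\<^sup>2 * t \<le> 2 * \<omega> \<xi> * t"
    by (simp add: \<omega>_def power_mult_distrib mult_ac)
  then show ?thesis
    unfolding energy_evolution[OF False, of t]
    using energy_positive[OF assms(1,2)] by simp
qed

end

theorem theorem3p5:
  fixes l g \<theta> :: real and \<mu> :: "real ^ 'm::finite \<Rightarrow> real"
  assumes "l > 0"
    and "\<mu> \<in> borel_measurable lebesgue"
    and "\<theta> > 0"
    and "\<And>\<xi>. \<theta> \<le> \<mu> \<xi> \<and> \<mu> \<xi> \<le> 1 / \<theta> * (1 + norm \<xi>) ^ 3"
    and "0 < g" and "g \<noteq> 3 / l ^ 3"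
    and "((\<lambda>\<xi>. \<mu> \<xi> - g) \<longlongrightarrow> 0) (at 0)"
  shows "\<exists>b1 > 0. \<exists>b2 > 0. \<exists>\<delta> > 0. \<exists>u p h U H.
    solution l \<mu> u p h \<and>
    ((AE \<xi> in lebesgue. \<mu> (- \<xi>) = \<mu> \<xi>) \<longrightarrow> real_fields l u p h) \<and>
    horizontal_fourier l u h U H \<and>
    (\<forall>\<xi>. norm \<xi> < \<delta> \<longrightarrow> energy l \<mu> U H \<xi> 0 > 0 \<and>
      (\<forall>t\<ge>0. energy l \<mu> U H \<xi> t \<ge> b1 * exp (- b2 * (norm \<xi>)\<^sup>2 * t) * energy l \<mu> U H \<xi> 0))"
proof -
  obtain p q d where pq: "0 < p" "p < q" "1 \<notin> {p..q}" "0 < d"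
    and w: "\<And>k s. 0 < k \<Longrightarrow> k < d \<Longrightarrow> s \<in> {p..q} \<Longrightarrow>
      wfun 0 (of_real k) (of_real k * rt s) (of_real l) (of_real l) \<noteq> 0"
    and dp: "\<And>k \<mu>. 0 < k \<Longrightarrow> k < d \<Longrightarrow> \<bar>\<mu> - g\<bar> < d \<Longrightarrow> dispersion l k p \<mu> > 0"
    and dq: "\<And>k \<mu>. 0 < k \<Longrightarrow> k < d \<Longrightarrow> \<bar>\<mu> - g\<bar> < d \<Longrightarrow> dispersion l k q \<mu> < 0"
    by (rule dispersion_sign[OF assms(1,5,6)], rule that)
  obtain e where e: "e > 0" "\<And>\<xi>. \<xi> \<noteq> 0 \<Longrightarrow> norm \<xi> < e \<Longrightarrow> \<bar>\<mu> \<xi> - g\<bar> < d"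
    using tendstoD[OF assms(7) \<open>0 < d\<close>] unfolding eventually_at by auto
  \<comment> \<open>One radius secures both that k = 2 pi norm \<xi> is below d and that \<mu> is
    within d of g.\<close>
  define \<delta> where "\<delta> = min e (d / (2 * pi))"
  have \<delta>: "\<delta> > 0"
    using e pq by (simp add: \<delta>_def)
  have small: "0 < 2 * pi * norm \<xi>" "2 * pi * norm \<xi> < d" "\<bar>\<mu> \<xi> - g\<bar> < d"
    if "0 < norm \<xi>" "norm \<xi> < \<delta>" for \<xi>
  proof -
    have "norm \<xi> < e" "norm \<xi> < d / (2 * pi)"
      using that by (simp_all add: \<delta>_def)
    then show "2 * pi * norm \<xi> < d" "\<bar>\<mu> \<xi> - g\<bar> < d"
      using that e(2)[of \<xi>] by (simp_all add: less_divide_eq mult.commute)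
  qed (use that in simp)
  \<comment> \<open>The minus sign turns the change of sign into the direction required by
    \<open>measurable_root\<close>. Off the punctured ball the placeholder s - p meets the same
    requirements and has the root p.\<close>
  define G where "G \<xi> s = (if 0 < norm \<xi> \<and> norm \<xi> < \<delta> then - dispersion l (2 * pi * norm \<xi>) s (\<mu> \<xi>) else s - p)" for \<xi> s
  have [measurable]: "(\<lambda>\<xi>::real ^ 'm. norm \<xi>) \<in> borel_measurable lebesgue"
    by (rule lebesgue_measurableI) measurable
  note [measurable] = assms(2)
  have G_meas: "(\<lambda>\<xi>. G \<xi> s) \<in> borel_measurable lebesgue" for s
    unfolding G_def by measurable
  have G_cont: "continuous_on {p..q} (G \<xi>)" for \<xi>
  proof (cases "0 < norm \<xi> \<and> norm \<xi> < \<delta>")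
    case True
    then have "G \<xi> = (\<lambda>s. - dispersion l (2 * pi * norm \<xi>) s (\<mu> \<xi>))"
      by (simp add: G_def[abs_def])
    moreover have "continuous_on {p..q} (\<lambda>s. dispersion l (2 * pi * norm \<xi>) s (\<mu> \<xi>))"
      by (rule dispersion_continuous) (use True pq in simp_all)
    ultimately show ?thesis
      by (simp add: continuous_on_minus)
  next
    case False
    then have "G \<xi> = (\<lambda>s. s - p)"
      unfolding G_def by (simp only: if_False)
    then show ?thesis
      by (simp add: continuous_on_diff)
  qed
  have G_sign: "G \<xi> p \<le> 0" "0 \<le> G \<xi> q" for \<xi>
    using dp[OF small, of \<xi>] dq[OF small, of \<xi>] pq by (simp_all add: G_def less_imp_le)
  obtain \<sigma> where \<sigma>: "\<sigma> \<in> borel_measurable lebesgue" "\<And>\<xi>. \<sigma> \<xi> \<in> {p..q}" "\<And>\<xi>. G \<xi> (\<sigma> \<xi>) = 0"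
    "\<And>\<xi> \<eta>. G \<xi> = G \<eta> \<Longrightarrow> \<sigma> \<xi> = \<sigma> \<eta>"
    by (rule measurable_root[OF G_meas G_cont less_imp_le[OF pq(2)] G_sign], rule that)
  interpret eigenmode l p q \<delta> \<mu> \<sigma>
  proof
    show "dispersion l (2 * pi * norm \<xi>) (\<sigma> \<xi>) (\<mu> \<xi>) = 0" if "0 < norm \<xi>" "norm \<xi> < \<delta>" for \<xi>
      using \<sigma>(3)[of \<xi>] that by (simp add: G_def)
    show "wfun 0 (of_real (2 * pi * norm \<xi>)) (of_real (2 * pi * norm \<xi>) * rt (\<sigma> \<xi>)) (of_real l) (of_real l) \<noteq> 0"
      if "0 < norm \<xi>" "norm \<xi> < \<delta>" for \<xi>
      using w[OF small(1,2)[OF that] \<sigma>(2)] .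
  qed (fact assms(1) pq(1-3) \<delta> \<sigma>(1,2))+
  have "real_fields l u (field bp) h" if "AE \<xi> in lebesgue. \<mu> (- \<xi>) = \<mu> \<xi>"
  proof (rule real_fields)
    show "AE \<xi> in lebesgue. \<sigma> (- \<xi>) = \<sigma> \<xi>"
      \<comment> \<open>If \<mu> agrees at \<xi> and - \<xi>, so do the functions \<open>G\<close>,
        and equal functions have the same selected root.\<close>
      using that by eventually_elim (rule \<sigma>(4), rule ext, simp add: G_def)
  qed
  moreover have \<mu>_pos: "\<mu> \<xi> > 0" for \<xi>
    using assms(3) assms(4)[of \<xi>] by linarith
  have "\<forall>\<xi>. norm \<xi> < \<delta> \<longrightarrow> energy l \<mu> U H \<xi> 0 > 0 \<and>
      (\<forall>t\<ge>0. energy l \<mu> U H \<xi> t \<ge> 1 * exp (- (8 * pi\<^sup>2 * q) * (norm \<xi>)\<^sup>2 * t) * energy l \<mu> U H \<xi> 0)"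
    by (intro allI impI conjI energy_positive[OF _ \<mu>_pos] energy_lower_bound[OF _ \<mu>_pos])
  ultimately have main: "solution l \<mu> u (field bp) h \<and>
    ((AE \<xi> in lebesgue. \<mu> (- \<xi>) = \<mu> \<xi>) \<longrightarrow> real_fields l u (field bp) h) \<and>
    horizontal_fourier l u h U H \<and>
    (\<forall>\<xi>. norm \<xi> < \<delta> \<longrightarrow> energy l \<mu> U H \<xi> 0 > 0 \<and>
      (\<forall>t\<ge>0. energy l \<mu> U H \<xi> t \<ge> 1 * exp (- (8 * pi\<^sup>2 * q) * (norm \<xi>)\<^sup>2 * t) * energy l \<mu> U H \<xi> 0))"
    using solution horizontal_fourier by blast
  have b2: "8 * pi\<^sup>2 * q > 0"
    using pq by simp
  show ?thesis
    by (rule exI[of _ 1], rule conjI[OF zero_less_one], rule exI[of _ "8 * pi\<^sup>2 * q"], rule conjI[OF b2],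
        rule exI[of _ \<delta>], rule conjI[OF \<delta>], rule exI[of _ u], rule exI[of _ "field bp"], rule exI[of _ h],
        rule exI[of _ U], rule exI[of _ H], rule main)
qed

end
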